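(* Let $Z$ be a Dedekind domain with field of fractions $Q$, let $K$ be a non-zero étale $Q$-algebra, and let $S\subseteq T$ be orders in $K$ such that $\mathrm{type}(T)=2$. Let $N$ be the number of primes $\mathfrak p$ of $T$ such that $\mathrm{type}_{\mathfrak p}(T)=2$. Then $|\mathcal{W}_T(S)|=2^N$ and $|\mathrm{ICM}_T(S)|=2^N\cdot|\mathrm{Pic}(T)|$.
   Context: Rings are commutative with unity and non-zero; a Dedekind domain is not a field. An étale $Q$-algebra is one isomorphic to a finite product of finite separable field extensions of $Q$. A lattice in $K$ is a finitely generated sub-$Z$-module of $K$ containing a $Q$-basis of $K$; an order in $K$ is a subring of $K$ that is a lattice. For an order $S$, a fractional $S$-ideal is a finitely generated sub-$S$-module of $K$ which is a lattice; a prime of $S$ is a fractional $S$-ideal which is also a prime ideal of $S$ (equivalently, a maximal ideal). For lattices $I,J$, $(I:J)=\{x\in K : xJ\subseteq I\}$; $(I:I)$ is the multiplicator ring of $I$. A fractional $S$-ideal $I$ is invertible if $I(S:I)=S$. The trace dual of a lattice $L$ is $L^t=\{x\in K : \mathrm{Tr}_{K/Q}(xL)\subseteq Z\}$. For a prime $\mathfrak p$ of an order $T$, $\mathrm{type}_{\mathfrak p}(T)=\dim_{T/\mathfrak p}(T^t/\mathfrak p T^t)$, and $\mathrm{type}(T)=\max_{\mathfrak p}\mathrm{type}_{\mathfrak p}(T)$ over all primes of $T$. Two fractional $S$-ideals $I,J$ are isomorphic as $S$-modules if and only if $J=\alpha I$ for some $\alpha\in K^\times$; they are weakly equivalent if $I_{\mathfrak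 p}\simeq J_{\mathfrak p}$ as $S_{\mathfrak p}$-modules for every prime $\mathfrak p$ of $S$ (subscript denoting localization); weakly equivalent ideals have the same multiplicator ring. $\mathcal{W}_T(S)$ (respectively $\mathrm{ICM}_T(S)$) is the set of weak equivalence classes (respectively isomorphism classes) of fractional $S$-ideals with multiplicator ring $T$. $\mathrm{Pic}(T)$ is the group of isomorphism classes of invertible fractional $T$-ideals. *)

theory Defs
  imports
    "HOL-Algebra.Algebra"
    "HOL-Algebra.Algebraic_Closure_Type"
    "HOL-Library.Equipollence"
    "Jordan_Normal_Form.Missing_VectorSpace"
begin

text \<open>
  The fraction field \<open>Q\<close> is a type \<open>'q\<close> of class \<open>field\<close>, the base ring \<open>Z\<close> is a subset of it,
  and the \<open>Q\<close>-algebra \<open>K\<close> is a type \<open>'k\<close> of class \<open>comm_ring_1\<close> (hence non-zero) with structure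
  map \<open>j :: 'q \<Rightarrow> 'k\<close>. Lattices, orders and ideals are subsets of \<open>'k\<close>. The constant
  \<^const>\<open>ring_of_type_algebra\<close> turns a type into a ring record; replacing its carrier gives subrings.
\<close>

abbreviation ring_on :: "'a::comm_ring_1 set \<Rightarrow> 'a ring" where
  "ring_on A \<equiv> ring_of_type_algebra\<lparr>carrier := A\<rparr>"

abbreviation ambient :: "'a::comm_ring_1 ring" where
  "ambient \<equiv> ring_of_type_algebra"


subsection \<open>Dedekind domains and etale algebras\<close>

definition integral_over :: "'q::field set \<Rightarrow> 'q \<Rightarrow> bool" where
  "integral_over Z x \<longleftrightarrow>
     (\<exists>f :: 'q poly. lead_coeff f = 1 \<and> set (coeffs f) \<subseteq> Z \<and> poly f x = 0)"

definition dedekind_domain :: "'q::field set \<Rightarrow> bool" where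
  "dedekind_domain Z \<longleftrightarrow>
     subring Z ambient \<and> noetherian_domain (ring_on Z) \<and> \<not> field (ring_on Z) \<and>
     (\<forall>a\<in>Z. \<forall>b\<in>Z. b \<noteq> 0 \<longrightarrow> integral_over Z (a / b) \<longrightarrow> a / b \<in> Z) \<and>
     (\<forall>P. primeideal P (ring_on Z) \<longrightarrow> P \<noteq> {0} \<longrightarrow> maximalideal P (ring_on Z))"

definition has_field_of_fractions_UNIV :: "'q::field set \<Rightarrow> bool" where
  "has_field_of_fractions_UNIV Z \<longleftrightarrow> (\<forall>x :: 'q. \<exists>a\<in>Z. \<exists>b\<in>Z. b \<noteq> 0 \<and> x = a / b)"

text \<open>
  An irreducible polynomial with root \<open>x\<close> is the minimal polynomial of \<open>x\<close> up to a unit, and an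
  irreducible polynomial is separable if it is coprime to its derivative. Polynomials in the sense
  of \<^const>\<open>ring.eval\<close> are coefficient lists with the leading coefficient first.
\<close>

definition finite_separable_extension :: "('q::field \<Rightarrow> 'l) \<Rightarrow> 'l ring \<Rightarrow> bool" where
  "finite_separable_extension \<sigma> L \<longleftrightarrow>
     field L \<and> \<sigma> \<in> ring_hom ambient L \<and>
     ring.finite_dimension L (range \<sigma>) (carrier L) \<and>
     (\<forall>x\<in>carrier L. \<exists>f :: 'q poly. Factorial_Ring.irreducible f \<and> coprime f (pderiv f) \<and>
        ring.eval L (map \<sigma> (rev (coeffs f))) x = \<zero>\<^bsub>L\<^esub>)"

text \<open>
  The factors are rings carried by \<open>'k\<close>. This is no restriction: each factor of a product
  decomposition of \<open>K\<close> embeds, as a set, into \<open>K\<close>.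
\<close>

definition etale_algebra :: "('q::field \<Rightarrow> 'k::comm_ring_1) \<Rightarrow> bool" where
  "etale_algebra j \<longleftrightarrow>
     j \<in> ring_hom ambient ambient \<and>
     (\<exists>(Ls :: 'k ring list) (\<sigma>s :: ('q \<Rightarrow> 'k) list).
        list_all2 finite_separable_extension \<sigma>s Ls \<and>
        (\<exists>\<phi> \<in> ring_iso ambient (RDirProd_list Ls). \<forall>q. \<phi> (j q) = map (\<lambda>\<sigma>. \<sigma> q) \<sigma>s))"

definition alg_scale :: "('q::field \<Rightarrow> 'k::comm_ring_1) \<Rightarrow> 'q \<Rightarrow> 'k \<Rightarrow> 'k" where
  "alg_scale j q x = j q * x"

text \<open>Trace of multiplication by \<open>x\<close>, computed on a chosen \<open>Q\<close>-basis of \<open>K\<close>.\<close>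

definition alg_trace :: "('q::field \<Rightarrow> 'k::comm_ring_1) \<Rightarrow> 'k \<Rightarrow> 'q" where
  "alg_trace j x =
     (let B = vector_space.extend_basis (alg_scale j) {}
      in \<Sum>b\<in>B. Modules.module.representation (alg_scale j) B (x * b) b)"


subsection \<open>Lattices, orders and fractional ideals\<close>

definition fg_submodule :: "'k::comm_ring_1 set \<Rightarrow> 'k set \<Rightarrow> bool" where
  "fg_submodule R M \<longleftrightarrow> (\<exists>B. finite B \<and> M = {\<Sum>b\<in>B. c b * b | c. c \<in> B \<rightarrow> R})"

definition lattice_in :: "'q::field set \<Rightarrow> ('q \<Rightarrow> 'k::comm_ring_1) \<Rightarrow> 'k set \<Rightarrow> bool" where
  "lattice_in Z j L \<longleftrightarrow> fg_submodule (j ` Z) L \<and>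
     (\<exists>B\<subseteq>L. \<not> Modules.module.dependent (alg_scale j) B \<and> Modules.module.span (alg_scale j) B = UNIV)"

definition order_in :: "'q::field set \<Rightarrow> ('q \<Rightarrow> 'k::comm_ring_1) \<Rightarrow> 'k set \<Rightarrow> bool" where
  "order_in Z j S \<longleftrightarrow> subring S ambient \<and> lattice_in Z j S"

definition fractional_ideal ::
    "'q::field set \<Rightarrow> ('q \<Rightarrow> 'k::comm_ring_1) \<Rightarrow> 'k set \<Rightarrow> 'k set \<Rightarrow> bool" where
  "fractional_ideal Z j S I \<longleftrightarrow> fg_submodule S I \<and> lattice_in Z j I"

definition primes_of :: "'q::field set \<Rightarrow> ('q \<Rightarrow> 'k::comm_ring_1) \<Rightarrow> 'k set \<Rightarrow> 'k set set" where
  "primes_of Z j S = {p. fractional_ideal Z j S p \<and> primeideal p (ring_on S)}"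

definition colon :: "'k::comm_ring_1 set \<Rightarrow> 'k set \<Rightarrow> 'k set" where
  "colon I J = {x. \<forall>y\<in>J. x * y \<in> I}"

definition multiplicator_ring :: "'k::comm_ring_1 set \<Rightarrow> 'k set" where
  "multiplicator_ring I = colon I I"

definition invertible_ideal :: "'k::comm_ring_1 set \<Rightarrow> 'k set \<Rightarrow> bool" where
  "invertible_ideal S I \<longleftrightarrow> I \<cdot>\<^bsub>ambient\<^esub> colon S I = S"

definition trace_dual :: "'q::field set \<Rightarrow> ('q \<Rightarrow> 'k::comm_ring_1) \<Rightarrow> 'k set \<Rightarrow> 'k set" where
  "trace_dual Z j L = {x. \<forall>y\<in>L. alg_trace j (x * y) \<in> Z}"


subsection \<open>The type of an order\<close>

text \<open>
  The quotient \<open>M / N\<close> as a module over a quotient ring \<open>S / p\<close> of a subring, whose elements are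
  cosets of \<open>p\<close>; the scalar multiplication is well defined if \<open>p M \<subseteq> N\<close>.
\<close>

definition quot_module :: "'k::comm_ring_1 set \<Rightarrow> 'k set \<Rightarrow> ('k set, 'k set) module" where
  "quot_module M N =
     \<lparr>carrier = (\<lambda>x. N +>\<^bsub>ambient\<^esub> x) ` M, monoid.mult = undefined, one = undefined,
      ring.zero = N, add = set_add ambient,
      module.smult = (\<lambda>A B. \<Union>a\<in>A. \<Union>x\<in>B. N +>\<^bsub>ambient\<^esub> (a * x))\<rparr>"

definition type_at ::
    "'q::field set \<Rightarrow> ('q \<Rightarrow> 'k::comm_ring_1) \<Rightarrow> 'k set \<Rightarrow> 'k set \<Rightarrow> nat" where
  "type_at Z j T p =
     vectorspace.dim (ring_on T Quot p)
       (quot_module (trace_dual Z j T) (p \<cdot>\<^bsub>ambient\<^esub> trace_dual Z j T))"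

definition order_type :: "'q::field set \<Rightarrow> ('q \<Rightarrow> 'k::comm_ring_1) \<Rightarrow> 'k set \<Rightarrow> nat" where
  "order_type Z j T = Max (type_at Z j T ` primes_of Z j T)"


subsection \<open>Localization at a prime\<close>

text \<open>
  \<open>S - p\<close> may contain zero divisors of \<open>K\<close>, so localizations are not subsets of \<open>K\<close> in general:
  their elements are classes of pairs (numerator, denominator).
\<close>

definition loc_rel :: "'k::comm_ring_1 set \<Rightarrow> 'k set \<Rightarrow> 'k set \<Rightarrow> (('k \<times> 'k) \<times> ('k \<times> 'k)) set" where
  "loc_rel S p M = {((x, s), (y, t)). x \<in> M \<and> y \<in> M \<and> s \<in> S - p \<and> t \<in> S - p \<and>
     (\<exists>u \<in> S - p. u * (t * x - s * y) = 0)}"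

definition loc_frac :: "'k::comm_ring_1 set \<Rightarrow> 'k set \<Rightarrow> 'k set \<Rightarrow> 'k \<Rightarrow> 'k \<Rightarrow> ('k \<times> 'k) set" where
  "loc_frac S p M x s = loc_rel S p M `` {(x, s)}"

definition loc_add ::
    "'k::comm_ring_1 set \<Rightarrow> 'k set \<Rightarrow> 'k set \<Rightarrow> ('k \<times> 'k) set \<Rightarrow> ('k \<times> 'k) set \<Rightarrow> ('k \<times> 'k) set" where
  "loc_add S p M A B = (\<Union>(x, s)\<in>A. \<Union>(y, t)\<in>B. loc_frac S p M (t * x + s * y) (s * t))"

definition loc_mult ::
    "'k::comm_ring_1 set \<Rightarrow> 'k set \<Rightarrow> 'k set \<Rightarrow> ('k \<times> 'k) set \<Rightarrow> ('k \<times> 'k) set \<Rightarrow> ('k \<times> 'k) set" where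
  "loc_mult S p M A B = (\<Union>(a, s)\<in>A. \<Union>(x, t)\<in>B. loc_frac S p M (a * x) (s * t))"

definition loc_ring :: "'k::comm_ring_1 set \<Rightarrow> 'k set \<Rightarrow> ('k \<times> 'k) set ring" where
  "loc_ring S p =
     \<lparr>carrier = (S \<times> (S - p)) // loc_rel S p S, monoid.mult = loc_mult S p S, one = loc_frac S p S 1 1,
      ring.zero = loc_frac S p S 0 1, add = loc_add S p S\<rparr>"

definition loc_module ::
    "'k::comm_ring_1 set \<Rightarrow> 'k set \<Rightarrow> 'k set \<Rightarrow> (('k \<times> 'k) set, ('k \<times> 'k) set) module" where
  "loc_module S p M =
     \<lparr>carrier = (M \<times> (S - p)) // loc_rel S p M, monoid.mult = undefined, one = undefined,
      ring.zero = loc_frac S p M 0 1, add = loc_add S p M, module.smult = loc_mult S p M\<rparr>"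


subsection \<open>Isomorphism and weak equivalence classes\<close>

definition module_isomorphic ::
    "('r, 'c) ring_scheme \<Rightarrow> ('r, 'm, 'd) module_scheme \<Rightarrow> ('r, 'n, 'e) module_scheme \<Rightarrow> bool" where
  "module_isomorphic R M N \<longleftrightarrow>
     (\<exists>f \<in> LinearCombinations.module_hom R M N. bij_betw f (carrier M) (carrier N))"

definition module_on :: "'k::comm_ring_1 set \<Rightarrow> ('k, 'k) module" where
  "module_on M =
     \<lparr>carrier = M, monoid.mult = undefined, one = undefined, ring.zero = 0, add = (+), module.smult = (*)\<rparr>"

definition ideal_isomorphic :: "'k::comm_ring_1 set \<Rightarrow> 'k set \<Rightarrow> 'k set \<Rightarrow> bool" where
  "ideal_isomorphic S I J \<longleftrightarrow> module_isomorphic (ring_on S) (module_on I) (module_on J)"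

definition weakly_equivalent ::
    "'q::field set \<Rightarrow> ('q \<Rightarrow> 'k::comm_ring_1) \<Rightarrow> 'k set \<Rightarrow> 'k set \<Rightarrow> 'k set \<Rightarrow> bool" where
  "weakly_equivalent Z j S I J \<longleftrightarrow>
     (\<forall>p\<in>primes_of Z j S. module_isomorphic (loc_ring S p) (loc_module S p I) (loc_module S p J))"

definition ideals_with_mult_ring ::
    "'q::field set \<Rightarrow> ('q \<Rightarrow> 'k::comm_ring_1) \<Rightarrow> 'k set \<Rightarrow> 'k set \<Rightarrow> 'k set set" where
  "ideals_with_mult_ring Z j S T = {I. fractional_ideal Z j S I \<and> multiplicator_ring I = T}"

definition weak_classes ::
    "'q::field set \<Rightarrow> ('q \<Rightarrow> 'k::comm_ring_1) \<Rightarrow> 'k set \<Rightarrow> 'k set \<Rightarrow> 'k set set set" where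
  "weak_classes Z j S T = ideals_with_mult_ring Z j S T //
     {(I, J). I \<in> ideals_with_mult_ring Z j S T \<and> J \<in> ideals_with_mult_ring Z j S T \<and>
        weakly_equivalent Z j S I J}"

definition ICM ::
    "'q::field set \<Rightarrow> ('q \<Rightarrow> 'k::comm_ring_1) \<Rightarrow> 'k set \<Rightarrow> 'k set \<Rightarrow> 'k set set set" where
  "ICM Z j S T = ideals_with_mult_ring Z j S T //
     {(I, J). I \<in> ideals_with_mult_ring Z j S T \<and> J \<in> ideals_with_mult_ring Z j S T \<and>
        ideal_isomorphic S I J}"

definition invertible_ideals ::
    "'q::field set \<Rightarrow> ('q \<Rightarrow> 'k::comm_ring_1) \<Rightarrow> 'k set \<Rightarrow> 'k set set" where
  "invertible_ideals Z j T = {I. fractional_ideal Z j T I \<and> invertible_ideal T I}"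

text \<open>The underlying set of the Picard group; only its cardinality is used.\<close>

definition Pic :: "'q::field set \<Rightarrow> ('q \<Rightarrow> 'k::comm_ring_1) \<Rightarrow> 'k set \<Rightarrow> 'k set set set" where
  "Pic Z j T = invertible_ideals Z j T //
     {(I, J). I \<in> invertible_ideals Z j T \<and> J \<in> invertible_ideals Z j T \<and> ideal_isomorphic T I J}"

end

theory Submission
  imports Defs
begin

text \<open>
  For fractional ideals \<open>I\<close>, \<open>J\<close> with multiplicator ring \<open>T\<close>, weak equivalence means that at every prime
  \<open>p\<close> of \<open>T\<close> some product \<open>x y\<close> with \<open>x \<in> (I : J)\<close>, \<open>y \<in> (J : I)\<close> lies outside \<open>p\<close>, which does not
  refer to \<open>S\<close>. Duality for the trace form gives \<open>I I\<^sup>t = T\<^sup>t\<close>. If \<open>T\<^sup>t / p T\<^sup>t\<close> has dimension at most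
  \<open>2\<close>, then some \<open>x \<in> I\<close> satisfies \<open>x I\<^sup>t = T\<^sup>t\<close> at \<open>p\<close> or some \<open>y \<in> I\<^sup>t\<close> satisfies \<open>y I = T\<^sup>t\<close> at \<open>p\<close>, so
  that \<open>I\<close> is at \<open>p\<close> isomorphic to \<open>T\<close> or to \<open>T\<^sup>t\<close>; these two differ exactly if the type at \<open>p\<close> is \<open>2\<close>.
  All \<open>2\<^sup>N\<close> combinations of local choices occur, and \<open>Pic T\<close> acts freely on isomorphism classes with
  the weak equivalence classes as orbits.
\<close>

subsection \<open>Modules over subrings\<close>

text \<open>\<open>K\<close> may have zero divisors, so the complement of a prime cannot be inverted
  inside \<open>K\<close>. Local statements are therefore made with denominators cleared: two
  elements of colon ideals whose product avoids the prime replace a local isomorphism and its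
  inverse. Images of nonzero elements of \<open>Z\<close> are invertible in \<open>K\<close> and
  serve as denominators throughout. The trace form is nondegenerate because \<open>K\<close> is
  separable; this is drawn from an idempotent of K \<otimes> K. \<open>Z\<close> need not be
  principal, so lattices need not have bases, but they are projective since nonzero ideals of
  \<open>Z\<close> are invertible; a dual basis in the sense of projective modules shows that double
  duals return the lattice. Then the dual of I I^t is (I : I) = T, whence I I^t = T^t. So the
  products of I and I^t span T^t / p T^t, and a bilinear map that spans a space of dimension at most
  2 has, in one of its arguments, a vector that already maps onto the space. The cross product
  violates this in dimension 3, whence the bound on the type. The action of Pic T is free because (L
  I : I) = L for invertible L.\<close>

definition is_subring :: "'a::comm_ring_1 set \<Rightarrow> bool" where
  "is_subring R \<longleftrightarrow> 1 \<in> R \<and> (\<forall>x\<in>R. \<forall>y\<in>R. x - y \<in> R \<and> x * y \<in> R)"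

definition submod :: "'a::comm_ring_1 set \<Rightarrow> 'a set \<Rightarrow> bool" where
  "submod R M \<longleftrightarrow> 0 \<in> M \<and> (\<forall>x\<in>M. \<forall>y\<in>M. x + y \<in> M) \<and> (\<forall>r\<in>R. \<forall>x\<in>M. r * x \<in> M)"

definition genby :: "'a::comm_ring_1 set \<Rightarrow> 'a set \<Rightarrow> 'a set" where
  "genby R B = {\<Sum>b\<in>B. c b * b | c. c \<in> B \<rightarrow> R}"

lemma fg_submodule_iff: "fg_submodule R M \<longleftrightarrow> (\<exists>B. finite B \<and> M = genby R B)"
  by (auto simp: fg_submodule_def genby_def)

lemma is_subringD:
  assumes "is_subring R"
  shows "1 \<in> R" "0 \<in> R" "x \<in> R \<Longrightarrow> y \<in> R \<Longrightarrow> x - y \<in> R" "x \<in> R \<Longrightarrow> y \<in> R \<Longrightarrow> x * y \<in> R"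
    "x \<in> R \<Longrightarrow> - x \<in> R" "x \<in> R \<Longrightarrow> y \<in> R \<Longrightarrow> x + y \<in> R"
proof -
  have d: "x - y \<in> R" if "x \<in> R" "y \<in> R" for x y
    using assms that by (auto simp: is_subring_def)
  have 1: "1 \<in> R" using assms by (auto simp: is_subring_def)
  have 0: "0 \<in> R" using d[OF 1 1] by simp
  have n: "- x \<in> R" if "x \<in> R" for x using d[OF 0 that] by simp
  show "x \<in> R \<Longrightarrow> y \<in> R \<Longrightarrow> x + y \<in> R" using d[of x "-y"] n[of y] by simp
  show "1 \<in> R" "0 \<in> R" "x \<in> R \<Longrightarrow> y \<in> R \<Longrightarrow> x - y \<in> R" "x \<in> R \<Longrightarrow> - x \<in> R"
    by (fact 1 0 d n)+
  show "x \<in> R \<Longrightarrow> y \<in> R \<Longrightarrow> x * y \<in> R" using assms by (auto simp: is_subring_def)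
qed

lemma is_subring_power: "is_subring R \<Longrightarrow> x \<in> R \<Longrightarrow> x ^ n \<in> R"
  by (induction n) (auto simp: is_subringD)

lemma submodD:
  assumes "submod R M"
  shows "0 \<in> M" "x \<in> M \<Longrightarrow> y \<in> M \<Longrightarrow> x + y \<in> M" "r \<in> R \<Longrightarrow> x \<in> M \<Longrightarrow> r * x \<in> M"
    "r \<in> R \<Longrightarrow> x \<in> M \<Longrightarrow> x * r \<in> M"
  using assms by (auto simp: submod_def mult.commute)

lemma submod_uminus: "is_subring R \<Longrightarrow> submod R M \<Longrightarrow> x \<in> M \<Longrightarrow> - x \<in> M"
  using submodD(3)[of R M "-1" x] by (simp add: is_subringD)

lemma submod_diff: "is_subring R \<Longrightarrow> submod R M \<Longrightarrow> x \<in> M \<Longrightarrow> y \<in> M \<Longrightarrow> x - y \<in> M"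
  using submodD(2)[of R M x "-y"] submod_uminus by auto

lemma submod_sum: "submod R M \<Longrightarrow> (\<And>i. i \<in> A \<Longrightarrow> f i \<in> M) \<Longrightarrow> (\<Sum>i\<in>A. f i) \<in> M"
  by (induction A rule: infinite_finite_induct) (auto simp: submodD)

lemma submod_self: "is_subring R \<Longrightarrow> submod R R"
  by (auto simp: submod_def is_subringD)

lemma submod_mono: "submod R M \<Longrightarrow> R' \<subseteq> R \<Longrightarrow> submod R' M"
  by (auto simp: submod_def)

lemma submod_Int: "submod R M \<Longrightarrow> submod R N \<Longrightarrow> submod R (M \<inter> N)"
  by (auto simp: submod_def)

lemma submod_scale: "submod R M \<Longrightarrow> submod R ((*) c ` M)"
  by (auto simp: submod_def image_iff) (metis mult_zero_right, metis distrib_left, metis mult.left_commute)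

lemma submod_plus:
  assumes "submod R M" "submod R N"
  shows "submod R {m + n | m n. m \<in> M \<and> n \<in> N}"
  unfolding submod_def
proof (intro conjI ballI)
  show "0 \<in> {m + n | m n. m \<in> M \<and> n \<in> N}"
    using submodD(1)[OF assms(1)] submodD(1)[OF assms(2)] by force
  fix x y assume "x \<in> {m + n | m n. m \<in> M \<and> n \<in> N}" "y \<in> {m + n | m n. m \<in> M \<and> n \<in> N}"
  then obtain m n m' n' where "x = m + n" "y = m' + n'" "m \<in> M" "n \<in> N" "m' \<in> M" "n' \<in> N" by blast
  then have "x + y = (m + m') + (n + n')" "m + m' \<in> M" "n + n' \<in> N"
    using submodD(2)[OF assms(1)] submodD(2)[OF assms(2)] by (auto simp: algebra_simps)
  then show "x + y \<in> {m + n | m n. m \<in> M \<and> n \<in> N}" by blast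
next
  fix r x assume "r \<in> R" "x \<in> {m + n | m n. m \<in> M \<and> n \<in> N}"
  then obtain m n where "x = m + n" "m \<in> M" "n \<in> N" by blast
  then have "r * x = r * m + r * n" "r * m \<in> M" "r * n \<in> N"
    using \<open>r \<in> R\<close> submodD(3)[OF assms(1)] submodD(3)[OF assms(2)] by (auto simp: distrib_left)
  then show "r * x \<in> {m + n | m n. m \<in> M \<and> n \<in> N}" by blast
qed

lemma submod_cyclic: "is_subring R \<Longrightarrow> submod R {r * a | r. r \<in> R}"
  unfolding submod_def by (auto simp: is_subringD) (metis is_subringD(2) mult_zero_left,
    metis distrib_right is_subringD(6), metis mult.assoc is_subringD(4))

lemma submod_adjoin:
  assumes "is_subring R" "submod R J" and U: "U = {m + n | m n. m \<in> J \<and> n \<in> {r * a | r. r \<in> R}}"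
  shows "submod R U" "J \<subseteq> U" "a \<in> U" "J \<subseteq> R \<Longrightarrow> a \<in> R \<Longrightarrow> U \<subseteq> R"
proof -
  show "submod R U" unfolding U using assms by (intro submod_plus submod_cyclic)
  have "m = m + 0 * a" "a = 0 + 1 * a" for m by simp_all
  then show "J \<subseteq> U" "a \<in> U" unfolding U using assms(1) submodD(1)[OF assms(2)] is_subringD(1,2) by blast+
  show "U \<subseteq> R" if "J \<subseteq> R" "a \<in> R" using that assms(1) unfolding U by (auto intro!: is_subringD)
qed

lemma genby_sum: "c \<in> B \<rightarrow> R \<Longrightarrow> (\<Sum>b\<in>B. c b * b) \<in> genby R B"
  by (auto simp: genby_def)

text \<open>Here \<open>p\<close> may be an ideal of \<open>R\<close>; then \<open>genby p B\<close> is \<open>p M\<close> for \<open>M = genby R B\<close>.\<close>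

lemma submod_genby:
  assumes "submod R p"
  shows "submod R (genby p B)"
  unfolding submod_def
proof (intro conjI ballI)
  show "0 \<in> genby p B" using genby_sum[of "\<lambda>_. 0" B p] submodD(1)[OF assms] by simp
  fix x y assume "x \<in> genby p B" "y \<in> genby p B"
  then obtain c d where "c \<in> B \<rightarrow> p" "d \<in> B \<rightarrow> p" "x = (\<Sum>b\<in>B. c b * b)" "y = (\<Sum>b\<in>B. d b * b)"
    by (auto simp: genby_def)
  moreover from this have "(\<lambda>b. c b + d b) \<in> B \<rightarrow> p" by (auto intro: submodD(2)[OF assms])
  ultimately show "x + y \<in> genby p B"
    using genby_sum[of "\<lambda>b. c b + d b" B p] by (simp add: algebra_simps sum.distrib)
next
  fix r x assume "r \<in> R" "x \<in> genby p B"
  then obtain c where "c \<in> B \<rightarrow> p" "x = (\<Sum>b\<in>B. c b * b)" by (auto simp: genby_def)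
  moreover from this have "(\<lambda>b. r * c b) \<in> B \<rightarrow> p" using \<open>r \<in> R\<close> by (auto intro: submodD(3)[OF assms])
  ultimately show "r * x \<in> genby p B"
    using genby_sum[of "\<lambda>b. r * c b" B p] by (simp add: algebra_simps sum_distrib_left)
qed

lemma genby_mult_mem:
  assumes "finite B" "b \<in> B" "r \<in> p" "0 \<in> p"
  shows "r * b \<in> genby p B"
proof -
  have "(\<Sum>x\<in>B. (if x = b then r else 0) * x) = (\<Sum>x\<in>B. if x = b then r * b else 0)"
    by (intro sum.cong) auto
  also have "\<dots> = r * b" using assms by simp
  finally show ?thesis using genby_sum[of "\<lambda>x. if x = b then r else 0" B p] assms by auto
qed

lemma genby_superset: "is_subring R \<Longrightarrow> finite B \<Longrightarrow> B \<subseteq> genby R B"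
  using genby_mult_mem[of B _ 1 R] by (auto simp: is_subringD)

lemma genby_least: "submod R M \<Longrightarrow> B \<subseteq> M \<Longrightarrow> genby R B \<subseteq> M"
  by (auto simp: genby_def intro!: submod_sum submodD(3))

lemma genby_mono_left: "p \<subseteq> q \<Longrightarrow> genby p B \<subseteq> genby q B"
  by (auto simp: genby_def)

lemma genby_insert:
  assumes "finite B" "b \<notin> B"
  shows "genby p (insert b B) = {r * b + m | r m. r \<in> p \<and> m \<in> genby p B}"
proof safe
  fix x assume "x \<in> genby p (insert b B)"
  then obtain c where c: "c \<in> insert b B \<rightarrow> p" "x = (\<Sum>y\<in>insert b B. c y * y)" by (auto simp: genby_def)
  have "x = c b * b + (\<Sum>y\<in>B. c y * y)" using c assms by simp
  moreover have "(\<Sum>y\<in>B. c y * y) \<in> genby p B" using c by (intro genby_sum) auto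
  ultimately show "\<exists>r m. x = r * b + m \<and> r \<in> p \<and> m \<in> genby p B" using c by auto
next
  fix r m assume "r \<in> p" "m \<in> genby p B"
  then obtain c where c: "c \<in> B \<rightarrow> p" "m = (\<Sum>y\<in>B. c y * y)" by (auto simp: genby_def)
  have "(\<Sum>y\<in>insert b B. (c(b := r)) y * y) = r * b + (\<Sum>y\<in>B. (c(b := r)) y * y)" using assms by simp
  also have "(\<Sum>y\<in>B. (c(b := r)) y * y) = m" unfolding c using assms by (intro sum.cong) auto
  finally show "r * b + m \<in> genby p (insert b B)"
    using genby_sum[of "c(b := r)" "insert b B" p] c \<open>r \<in> p\<close> by (auto simp: Pi_def)
qed

lemma genby_scale:
  assumes "finite B" "is_subring R"
  shows "genby R ((*) c ` B) = (*) c ` genby R B"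
proof
  show "genby R ((*) c ` B) \<subseteq> (*) c ` genby R B"
    using genby_superset[OF assms(2,1)]
    by (intro genby_least submod_scale submod_genby submod_self assms) auto
  have "c * b \<in> genby R ((*) c ` B)" if "b \<in> B" for b
    using genby_superset[OF assms(2), of "(*) c ` B"] assms(1) that by auto
  then have "genby R B \<subseteq> {x. c * x \<in> genby R ((*) c ` B)}"
    using submod_genby[OF submod_self[OF assms(2)], of "(*) c ` B"]
    by (intro genby_least) (auto simp: submod_def distrib_left, metis mult.left_commute)
  then show "(*) c ` genby R B \<subseteq> genby R ((*) c ` B)" by auto
qed

lemma fg_submodule_scale: "is_subring R \<Longrightarrow> fg_submodule R M \<Longrightarrow> fg_submodule R ((*) c ` M)"
  by (metis fg_submodule_iff genby_scale finite_imageI)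

lemma fg_submod: "is_subring R \<Longrightarrow> fg_submodule R M \<Longrightarrow> submod R M"
  using submod_genby[OF submod_self] by (auto simp: fg_submodule_iff)

section \<open>Noetherian subrings and Nakayama's lemma\<close>

definition noeth :: "'a::comm_ring_1 set \<Rightarrow> bool" where
  "noeth R \<longleftrightarrow> (\<forall>I. submod R I \<and> I \<subseteq> R \<longrightarrow> fg_submodule R I)"

text \<open>Induction on the generators: \<open>M\<close> is assembled from generators of its part
  inside \<open>genby R B\<close> and from lifts of generators of the ideal of coefficients with
  which the new generator \<open>b\<close> occurs in \<open>M\<close>.\<close>

lemma noeth_submod_fg:
  assumes R: "is_subring R" "noeth R"
  shows "finite B \<Longrightarrow> submod R M \<Longrightarrow> M \<subseteq> genby R B \<Longrightarrow> fg_submodule R M"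
proof (induction B arbitrary: M rule: finite_induct)
  case empty
  then have "M = genby R {}" by (auto simp: genby_def dest: submodD(1))
  then show ?case unfolding fg_submodule_iff by blast
next
  case (insert b B)
  define G where "G = genby R B"
  have G: "submod R G" unfolding G_def using submod_genby submod_self R by blast
  define I where "I = {r\<in>R. \<exists>m\<in>G. r * b + m \<in> M}"
  have "submod R I"
    unfolding submod_def I_def
  proof (intro conjI ballI CollectI; (elim CollectE conjE bexE)?)
    show "\<exists>m\<in>G. 0 * b + m \<in> M" using submodD(1)[OF G] submodD(1)[OF insert.prems(1)] by auto
  next
    fix x y m n assume "m \<in> G" "n \<in> G" "x * b + m \<in> M" "y * b + n \<in> M"
    then have "m + n \<in> G" "(x + y) * b + (m + n) \<in> M"
      using submodD(2)[OF insert.prems(1), of "x * b + m" "y * b + n"] submodD(2)[OF G]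
      by (auto simp: algebra_simps)
    then show "\<exists>m\<in>G. (x + y) * b + m \<in> M" by blast
  next
    fix r x m assume "r \<in> R" "m \<in> G" "x * b + m \<in> M"
    then have "r * m \<in> G" "(r * x) * b + r * m \<in> M"
      using submodD(3)[OF insert.prems(1), of r "x * b + m"] submodD(3)[OF G]
      by (auto simp: distrib_left mult.assoc)
    then show "\<exists>m\<in>G. (r * x) * b + m \<in> M" by blast
  qed (use R in \<open>auto simp: is_subringD\<close>)
  then have "fg_submodule R I" using R(2) unfolding noeth_def by (auto simp: I_def)
  then obtain C where C: "finite C" "I = genby R C" by (auto simp: fg_submodule_iff)
  have CI: "C \<subseteq> I" using genby_superset[OF R(1) C(1)] C(2) by simp
  then have "\<forall>c\<in>C. \<exists>m\<in>G. c * b + m \<in> M" unfolding I_def by blast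
  then obtain g where g: "\<And>c. c \<in> C \<Longrightarrow> g c \<in> G \<and> c * b + g c \<in> M" by metis
  have "fg_submodule R (M \<inter> G)"
    using insert.IH[of "M \<inter> G"] submod_Int[OF insert.prems(1) G] unfolding G_def by auto
  then obtain D where D: "finite D" "M \<inter> G = genby R D" by (auto simp: fg_submodule_iff)
  define E where "E = (\<lambda>c. c * b + g c) ` C \<union> D"
  have E: "finite E" using C D by (simp add: E_def)
  have sE: "submod R (genby R E)" using submod_genby submod_self R by blast
  have "genby R E \<subseteq> M"
    using g genby_superset[OF R(1) D(1)] D(2) insert.prems(1) by (intro genby_least) (auto simp: E_def)
  moreover have "x \<in> genby R E" if x: "x \<in> M" for x
  proof -
    obtain r m where rm: "x = r * b + m" "r \<in> R" "m \<in> G"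
      using x insert.prems(2) genby_insert[OF insert.hyps(1,2), of R] unfolding G_def by auto
    then have "r \<in> I" using x unfolding I_def by blast
    then obtain d where d: "d \<in> C \<rightarrow> R" "r = (\<Sum>c\<in>C. d c * c)" using C by (auto simp: genby_def)
    \<comment> \<open>Combining the lifts with the coefficients of \<open>r\<close> cancels the
      multiple of \<open>b\<close> in \<open>x\<close>, so \<open>x - y\<close> falls into
      \<open>M \<inter> G\<close>.\<close>
    define y where "y = (\<Sum>c\<in>C. d c * (c * b + g c))"
    have yM: "y \<in> M" unfolding y_def using d g insert.prems(1) by (intro submod_sum submodD(3)) auto
    have yE: "y \<in> genby R E" unfolding y_def using d genby_superset[OF R(1) E]
      by (intro submod_sum[OF sE] submodD(3)[OF sE]) (auto simp: E_def)
    have "x - y = m - (\<Sum>c\<in>C. d c * g c)"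
      by (simp add: y_def rm d algebra_simps sum.distrib sum_distrib_left sum_distrib_right)
    moreover have "(\<Sum>c\<in>C. d c * g c) \<in> G" using d g by (intro submod_sum[OF G] submodD(3)[OF G]) auto
    ultimately have "x - y \<in> M \<inter> G"
      using submod_diff[OF R(1) insert.prems(1) x yM] submod_diff[OF R(1) G rm(3)] by auto
    also have "\<dots> \<subseteq> genby R E" unfolding D using genby_superset[OF R(1) E]
      by (intro genby_least[OF sE]) (auto simp: E_def)
    finally show ?thesis using submodD(2)[OF sE, of "x - y" y] yE by simp
  qed
  ultimately show ?case using E unfolding fg_submodule_iff by blast
qed

lemma noeth_submod_fg':
  assumes "is_subring R" "noeth R" "fg_submodule R L" "submod R M" "M \<subseteq> L"
  shows "fg_submodule R M"
  using assms noeth_submod_fg fg_submodule_iff by metis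

text \<open>The union of a chain is a submodule of \<open>L\<close>, hence finitely generated. Its
  generators already lie in one member of the chain, which is therefore the union.\<close>

lemma exists_maximal_submod:
  assumes R: "is_subring R" "noeth R" and L: "fg_submodule R L"
    and F: "F \<noteq> {}" "\<And>M. M \<in> F \<Longrightarrow> submod R M \<and> M \<subseteq> L"
  shows "\<exists>M\<in>F. \<forall>U\<in>F. M \<subseteq> U \<longrightarrow> U = M"
proof (rule subset_Zorn_nonempty[OF F(1)])
  fix C assume C: "C \<noteq> {}" "subset.chain F C"
  have CF: "C \<subseteq> F" using C(2) by (simp add: subset_chain_def)
  have ch: "U \<subseteq> Y \<or> Y \<subseteq> U" if "U \<in> C" "Y \<in> C" for U Y
    using C(2) that by (auto simp: subset_chain_def)
  have "submod R (\<Union>C)" unfolding submod_def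
  proof (intro conjI ballI)
    show "0 \<in> \<Union>C" using C(1) CF F(2) submodD(1) by blast
    fix x y assume "x \<in> \<Union>C" "y \<in> \<Union>C"
    then obtain U Y where "U \<in> C" "Y \<in> C" "x \<in> U" "y \<in> Y" by blast
    then obtain W where "W \<in> C" "x \<in> W" "y \<in> W" using ch by blast
    then show "x + y \<in> \<Union>C" using CF F(2) submodD(2) by blast
  qed (use CF F(2) submodD(3) in blast)
  moreover have "\<Union>C \<subseteq> L" using CF F(2) by blast
  ultimately have "fg_submodule R (\<Union>C)" using noeth_submod_fg'[OF R L] by blast
  then obtain B where B: "finite B" "\<Union>C = genby R B" by (auto simp: fg_submodule_iff)
  then obtain U where U: "U \<in> C" "B \<subseteq> U"
    using finite_subset_Union_chain[OF B(1) _ C] genby_superset[OF R(1) B(1)] by auto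
  then have "\<Union>C \<subseteq> U" unfolding B(2) using genby_least CF F(2) by blast
  then have "\<Union>C = U" using U by blast
  then show "\<Union>C \<in> F" using U CF by blast
qed

lemma noeth_fg_self: "is_subring R \<Longrightarrow> fg_submodule R R"
proof -
  assume R: "is_subring R"
  have "R \<subseteq> genby R {1}" using genby_mult_mem[of "{1}" 1 _ R] R by (auto simp: is_subringD)
  moreover have "genby R {1} \<subseteq> R" using R by (intro genby_least submod_self) (auto simp: is_subringD)
  ultimately show ?thesis unfolding fg_submodule_iff by (intro exI[of _ "{1}"]) auto
qed

text \<open>Nakayama's lemma, proved by eliminating one generator at a time instead of by determinants.\<close>

lemma nakayama_aux:
  assumes R: "is_subring R" and p: "submod R p" "p \<subseteq> R" and N: "submod R N"
  shows "finite B \<Longrightarrow> s \<in> R \<Longrightarrow> 1 - s \<in> p \<Longrightarrow> (\<And>b. b \<in> B \<Longrightarrow> \<exists>n\<in>N. s * b - n \<in> genby p B)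
    \<Longrightarrow> \<exists>s'\<in>R. 1 - s' \<in> p \<and> (\<forall>b\<in>B. s' * b \<in> N)"
proof (induction B arbitrary: s rule: finite_induct)
  case empty
  then show ?case by auto
next
  case (insert b B)
  have sB: "submod R (genby p B)" using submod_genby p by blast
  have ex: "\<exists>n\<in>N. \<exists>q\<in>p. \<exists>m\<in>genby p B. s * y = n + q * b + m" if "y \<in> insert b B" for y
  proof -
    from insert.prems(3)[OF that] obtain n where n: "n \<in> N" "s * y - n \<in> genby p (insert b B)" by blast
    then obtain q m where "s * y - n = q * b + m" "q \<in> p" "m \<in> genby p B"
      using genby_insert[OF insert.hyps(1,2)] by auto
    then show ?thesis using n(1) by (intro bexI[of _ n] bexI[of _ q] bexI[of _ m]) (auto simp: algebra_simps)
  qed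
  obtain n0 q0 m0 where b0: "n0 \<in> N" "q0 \<in> p" "m0 \<in> genby p B" "s * b = n0 + q0 * b + m0"
    using ex[of b, OF insertI1] by blast
  \<comment> \<open>Moving \<open>q0 * b\<close> to the left isolates \<open>b\<close>:
    \<open>s1 * b\<close> involves only \<open>N\<close> and the remaining generators, and
    \<open>s1\<close> is still 1 modulo \<open>p\<close>. Eliminating \<open>b\<close> from the
    other relations multiplies them by \<open>s1\<close>.\<close>
  define s1 where "s1 = s - q0"
  have s1: "s1 \<in> R" "1 - s1 \<in> p" "s1 * b = n0 + m0"
    using insert.prems b0 p R submodD(2)[OF p(1), of "1 - s" q0]
    by (auto simp: s1_def algebra_simps is_subringD)
  have s1s: "s1 * s \<in> R" "1 - s1 * s \<in> p"
  proof -
    show "s1 * s \<in> R" using s1 insert.prems R by (auto simp: is_subringD)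
    have "1 - s1 * s = (1 - s1) + s1 * (1 - s)" by (simp add: algebra_simps)
    then show "1 - s1 * s \<in> p" using s1 insert.prems submodD[OF p(1)] by metis
  qed
  have "\<exists>n\<in>N. (s1 * s) * y - n \<in> genby p B" if yB: "y \<in> B" for y
  proof -
    obtain n q m where y: "n \<in> N" "q \<in> p" "m \<in> genby p B" "s * y = n + q * b + m"
      using ex[of y] yB by blast
    have "(s1 * s) * y - (s1 * n + q * n0) = s1 * m + q * m0"
    proof -
      have "(s1 * s) * y = s1 * n + q * (s1 * b) + s1 * m"
        unfolding mult.assoc[of s1 s y] y(4) by (simp add: algebra_simps)
      then show ?thesis unfolding s1(3) by (simp add: algebra_simps)
    qed
    moreover have "s1 * n + q * n0 \<in> N" "s1 * m + q * m0 \<in> genby p B"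
      using y b0 s1 p(2) by (auto intro!: submodD(2)[OF N] submodD(3)[OF N] submodD(2)[OF sB] submodD(3)[OF sB])
    ultimately show ?thesis by metis
  qed
  then obtain s' where s': "s' \<in> R" "1 - s' \<in> p" "\<forall>y\<in>B. s' * y \<in> N"
    using insert.IH[OF s1s] by blast
  have "submod R {x. s' * x \<in> N}"
    using N s' unfolding submod_def by (auto simp: distrib_left) (metis mult.left_commute)
  then have "genby R B \<subseteq> {x. s' * x \<in> N}" using s' by (intro genby_least) auto
  then have sm: "s' * m0 \<in> N" using b0 genby_mono_left[OF p(2), of B] by blast
  have "s' * s1 * b = s' * n0 + s' * m0" unfolding mult.assoc s1(3) by (simp add: algebra_simps)
  also have "\<dots> \<in> N" using sm s' b0 by (auto intro!: submodD(2)[OF N] submodD(3)[OF N])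
  finally have 1: "s' * s1 * b \<in> N" .
  have 2: "s' * s1 * y \<in> N" if "y \<in> B" for y
    using submodD(3)[OF N s1(1), of "s' * y"] s' that by (simp add: ac_simps)
  have "1 - s' * s1 = (1 - s') + s' * (1 - s1)" by (simp add: algebra_simps)
  then have 3: "1 - s' * s1 \<in> p" using s1 s' submodD[OF p(1)] by metis
  show ?case using 1 2 3 s1 s' R by (intro bexI[of _ "s' * s1"]) (auto simp: is_subringD)
qed

lemma nakayama:
  assumes R: "is_subring R" and p: "submod R p" "p \<subseteq> R" and N: "submod R N"
    and B: "finite B" "\<And>b. b \<in> B \<Longrightarrow> \<exists>n\<in>N. b - n \<in> genby p B"
  shows "\<exists>s\<in>R. 1 - s \<in> p \<and> (\<forall>x\<in>genby R B. s * x \<in> N)"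
proof -
  obtain s where s: "s \<in> R" "1 - s \<in> p" "\<forall>b\<in>B. s * b \<in> N"
    using nakayama_aux[OF R p N B(1), of 1] R B(2) submodD(1)[OF p(1)] by (auto simp: is_subringD)
  have "submod R {x. s * x \<in> N}"
    using N s unfolding submod_def by (auto simp: distrib_left) (metis mult.left_commute)
  then have "genby R B \<subseteq> {x. s * x \<in> N}" using s by (intro genby_least) auto
  then show ?thesis using s by blast
qed

section \<open>Prime ideals\<close>

definition is_prime :: "'a::comm_ring_1 set \<Rightarrow> 'a set \<Rightarrow> bool" where
  "is_prime R p \<longleftrightarrow> submod R p \<and> p \<subseteq> R \<and> 1 \<notin> p \<and> (\<forall>a\<in>R. \<forall>b\<in>R. a * b \<in> p \<longrightarrow> a \<in> p \<or> b \<in> p)"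

lemma is_primeD:
  assumes "is_prime R p"
  shows "submod R p" "p \<subseteq> R" "1 \<notin> p" "a \<in> R \<Longrightarrow> b \<in> R \<Longrightarrow> a * b \<in> p \<Longrightarrow> a \<in> p \<or> b \<in> p"
  using assms by (auto simp: is_prime_def)

lemma is_prime_prod:
  assumes "is_prime R p" "is_subring R" "finite A" "\<And>i. i \<in> A \<Longrightarrow> x i \<in> R - p"
  shows "(\<Prod>i\<in>A. x i) \<in> R - p"
  using assms(3,4)
proof (induction A rule: finite_induct)
  case empty
  then show ?case using assms(1,2) by (simp add: is_primeD is_subringD)
next
  case (insert i A)
  then show ?case using is_primeD(4)[OF assms(1), of "x i" "prod x A"] assms(2)
    by (auto simp: is_subringD)
qed

text \<open>Take \<open>p\<close> maximal among the proper ideals above \<open>I\<close>. Adjoining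
  an element outside \<open>p\<close> yields 1, which inverts that element modulo \<open>p\<close>;
  primality follows from these inverses.\<close>

lemma exists_prime_above:
  assumes R: "is_subring R" "noeth R" and I: "submod R I" "I \<subseteq> R" "1 \<notin> I"
  shows "\<exists>p. is_prime R p \<and> I \<subseteq> p \<and> (\<forall>a\<in>R - p. \<exists>r\<in>R. 1 - r * a \<in> p)"
proof -
  let ?F = "{J. submod R J \<and> J \<subseteq> R \<and> 1 \<notin> J \<and> I \<subseteq> J}"
  have "\<exists>M\<in>?F. \<forall>U\<in>?F. M \<subseteq> U \<longrightarrow> U = M"
    using I by (intro exists_maximal_submod[OF R noeth_fg_self[OF R(1)]]) auto
  then obtain p where p: "submod R p" "p \<subseteq> R" "1 \<notin> p" "I \<subseteq> p"
    and mx: "\<And>U. submod R U \<Longrightarrow> U \<subseteq> R \<Longrightarrow> 1 \<notin> U \<Longrightarrow> p \<subseteq> U \<Longrightarrow> U = p"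
    by (auto simp: Ball_def)
  have max: "\<exists>r\<in>R. 1 - r * a \<in> p" if a: "a \<in> R - p" for a
  proof -
    let ?U = "{m + n | m n. m \<in> p \<and> n \<in> {r * a | r. r \<in> R}}"
    have U: "submod R ?U" "p \<subseteq> ?U" "a \<in> ?U" "?U \<subseteq> R"
      using submod_adjoin[OF R(1) p(1) refl, of a] p(2) a by auto
    then have "1 \<in> ?U" using mx[of ?U] a by blast
    then obtain m r where "1 = m + r * a" "m \<in> p" "r \<in> R" by auto
    then have "1 - r * a = m" by (simp add: algebra_simps)
    then show ?thesis using \<open>m \<in> p\<close> \<open>r \<in> R\<close> by auto
  qed
  have "a \<in> p \<or> b \<in> p" if ab: "a \<in> R" "b \<in> R" "a * b \<in> p" for a b
  proof (rule ccontr)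
    assume "\<not> (a \<in> p \<or> b \<in> p)"
    then obtain r where r: "r \<in> R" "1 - r * a \<in> p" using max[of a] ab by auto
    have "b = (1 - r * a) * b + r * (a * b)" by (simp add: algebra_simps)
    then have "b \<in> p" using submodD(2)[OF p(1) submodD(4)[OF p(1) ab(2) r(2)] submodD(3)[OF p(1) r(1) ab(3)]] by simp
    then show False using \<open>\<not> (a \<in> p \<or> b \<in> p)\<close> by blast
  qed
  then show ?thesis using p max unfolding is_prime_def by blast
qed

text \<open>The product of the ideals \<open>P i\<close> is described through its elements.\<close>

lemma prime_product_below:
  assumes R: "is_subring R" "noeth R" and I: "submod R I" "I \<subseteq> R"
  shows "\<exists>(n::nat) P. (\<forall>i<n. is_prime R (P i) \<and> I \<subseteq> P i) \<and>
    (\<forall>x. (\<forall>i<n. x i \<in> P i) \<longrightarrow> (\<Prod>i<n. x i) \<in> I)"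
proof (rule ccontr)
  define good where "good J \<longleftrightarrow> (\<exists>(n::nat) P. (\<forall>i<n. is_prime R (P i) \<and> J \<subseteq> P i) \<and>
    (\<forall>x. (\<forall>i<n. x i \<in> P i) \<longrightarrow> (\<Prod>i<n. x i) \<in> J))" for J
  assume "\<not> ?thesis"
  then have "\<not> good I" unfolding good_def .
  let ?F = "{J. submod R J \<and> J \<subseteq> R \<and> \<not> good J}"
  have "\<exists>M\<in>?F. \<forall>U\<in>?F. M \<subseteq> U \<longrightarrow> U = M"
    using I \<open>\<not> good I\<close> by (intro exists_maximal_submod[OF R noeth_fg_self[OF R(1)]]) auto
  then obtain J where J: "submod R J" "J \<subseteq> R" "\<not> good J"
    and mx: "\<And>U. submod R U \<Longrightarrow> U \<subseteq> R \<Longrightarrow> \<not> good U \<Longrightarrow> J \<subseteq> U \<Longrightarrow> U = J"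
    by (auto simp: Ball_def)
  have "1 \<notin> J"
  proof
    assume "1 \<in> J"
    \<comment> \<open>The empty product is 1, so no primes are needed for the unit ideal.\<close>
    then have "good J" unfolding good_def by (intro exI[of _ 0]) auto
    then show False using J by blast
  qed
  have "\<not> is_prime R J"
  proof
    assume "is_prime R J"
    then have "good J" unfolding good_def by (intro exI[of _ 1] exI[of _ "\<lambda>_. J"]) auto
    then show False using J by blast
  qed
  then obtain a b where ab: "a \<in> R" "b \<in> R" "a * b \<in> J" "a \<notin> J" "b \<notin> J"
    using J \<open>1 \<notin> J\<close> unfolding is_prime_def by blast
  define U where "U c = {m + n | m n. m \<in> J \<and> n \<in> {r * c | r. r \<in> R}}" for c
  have U: "good (U c)" "J \<subseteq> U c" if c: "c \<in> R" "c \<notin> J" for c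
  proof -
    have U: "submod R (U c)" "J \<subseteq> U c" "c \<in> U c" "U c \<subseteq> R"
      using submod_adjoin[OF R(1) J(1) U_def[of c]] J(2) c by auto
    show "J \<subseteq> U c" by (fact U)
    show "good (U c)" using U mx[of "U c"] c by blast
  qed
  \<comment> \<open>The product of \<open>J + R a\<close> and \<open>J + R b\<close> lies in
    \<open>J\<close> because \<open>a * b\<close> does. Hence the primes of the two larger ideals,
    listed one after the other, serve \<open>J\<close>.\<close>
  have XX: "x * y \<in> J" if xy: "x \<in> U a" "y \<in> U b" for x y
  proof -
    obtain m r n t where e: "x = m + r * a" "y = n + t * b" "m \<in> J" "n \<in> J" "r \<in> R" "t \<in> R"
      using xy unfolding U_def by blast
    have "x * y = m * (n + t * b) + (r * a) * n + (r * t) * (a * b)" by (simp add: e algebra_simps)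
    moreover have "m * (n + t * b) \<in> J" "(r * a) * n \<in> J" "(r * t) * (a * b) \<in> J"
      using e ab J(2) R(1) by (meson submodD(3,4)[OF J(1)] is_subringD(4,6) subsetD)+
    ultimately show ?thesis using submodD(2)[OF J(1)] by metis
  qed
  obtain n P m P' where P: "\<forall>i<n. is_prime R (P i) \<and> U a \<subseteq> P i" "\<forall>i<m. is_prime R (P' i) \<and> U b \<subseteq> P' i"
    "\<And>x. (\<forall>i<n. x i \<in> P i) \<Longrightarrow> (\<Prod>i<n::nat. x i) \<in> U a"
    "\<And>x. (\<forall>i<m. x i \<in> P' i) \<Longrightarrow> (\<Prod>i<m::nat. x i) \<in> U b"
    using U(1)[OF ab(1,4)] U(1)[OF ab(2,5)] unfolding good_def by blast
  define P'' where "P'' i = (if i < n then P i else P' (i - n))" for i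
  have "is_prime R (P'' i) \<and> J \<subseteq> P'' i" if "i < n + m" for i
  proof (cases "i < n")
    case True
    then show ?thesis using P(1) U(2)[OF ab(1,4)] unfolding P''_def by auto
  next
    case False
    then have "i - n < m" using that by auto
    then show ?thesis using P(2) U(2)[OF ab(2,5)] False unfolding P''_def by auto
  qed
  moreover have "(\<Prod>i<n+m. x i) \<in> J" if x: "\<forall>i<n+m. x i \<in> P'' i" for x
  proof -
    have "{..<n+m} = {..<n} \<union> (\<lambda>i. n + i) ` {..<m}"
    proof -
      have "i \<in> (\<lambda>i. n + i) ` {..<m}" if "i < n + m" "\<not> i < n" for i
        using that by (intro image_eqI[of _ _ "i - n"]) auto
      then show ?thesis by auto
    qed
    then have "(\<Prod>i<n+m. x i) = (\<Prod>i<n. x i) * (\<Prod>i\<in>(\<lambda>i. n + i) ` {..<m}. x i)"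
      by (simp only:) (intro prod.union_disjoint, auto)
    also have "(\<Prod>i\<in>(\<lambda>i. n + i) ` {..<m}. x i) = (\<Prod>i<m. x (n + i))"
      by (simp add: prod.reindex)
    also have "(\<Prod>i<n. x i) * (\<Prod>i<m. x (n + i)) \<in> J"
    proof (rule XX[OF P(3) P(4)])
      show "\<forall>i<n. x i \<in> P i" 
      proof (intro allI impI)
        fix i assume "i < n"
        then show "x i \<in> P i" using x[rule_format, of i] by (simp add: P''_def)
      qed
      show "\<forall>i<m. x (n + i) \<in> P' i"
      proof (intro allI impI)
        fix i assume "i < m"
        then show "x (n + i) \<in> P' i" using x[rule_format, of "n + i"] by (simp add: P''_def)
      qed
    qed
    finally show ?thesis .
  qed
  ultimately have "good J" unfolding good_def by blast
  then show False using J by blast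
qed

text \<open>Elements of the factors chosen outside \<open>q\<close> would have a product outside
  \<open>q\<close>.\<close>

lemma prime_contains_factor:
  assumes "is_subring R" "is_prime R q" "finite A" "\<And>x. (\<forall>i\<in>A. x i \<in> P i) \<Longrightarrow> (\<Prod>i\<in>A. x i) \<in> q"
    and "\<And>i. i \<in> A \<Longrightarrow> P i \<subseteq> R"
  shows "\<exists>i\<in>A. P i \<subseteq> q"
proof (rule ccontr)
  assume "\<not> ?thesis"
  then have "\<forall>i\<in>A. \<exists>y. y \<in> P i - q" by blast
  then obtain x where x: "\<And>i. i \<in> A \<Longrightarrow> x i \<in> P i - q" by metis
  then have "(\<Prod>i\<in>A. x i) \<in> R - q" using assms(5) by (intro is_prime_prod[OF assms(2,1,3)]) auto
  then show False using assms(4)[of x] x by auto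
qed

text \<open>The spans of \<open>v 0\<close>, ..., \<open>v (n - 1)\<close> form an ascending chain
  in a noetherian module. For the powers of an element this yields a monic relation without
  determinants.\<close>

lemma noeth_relation:
  assumes R: "is_subring R" "noeth R" and L: "fg_submodule R L" and v: "\<And>k::nat. v k \<in> L"
  shows "\<exists>n a. (\<forall>k. a k \<in> R) \<and> v n = (\<Sum>k<n. a k * v k)"
proof -
  define M where "M n = {\<Sum>k<n. a k * v k | a. \<forall>k. a k \<in> R}" for n
  have sub: "submod R (M n)" for n
    unfolding submod_def
  proof (intro conjI ballI)
    show "0 \<in> M n" unfolding M_def using R(1) by (auto intro!: exI[of _ "\<lambda>_. 0"] simp: is_subringD)
    fix x y assume "x \<in> M n" "y \<in> M n"
    then obtain a b where "\<forall>k. a k \<in> R" "\<forall>k. b k \<in> R" "x = (\<Sum>k<n. a k * v k)" "y = (\<Sum>k<n. b k * v k)"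
      unfolding M_def by blast
    then show "x + y \<in> M n" unfolding M_def using R(1)
      by (auto intro!: exI[of _ "\<lambda>k. a k + b k"] simp: is_subringD sum.distrib distrib_right)
  next
    fix r x assume "r \<in> R" "x \<in> M n"
    then obtain a where "\<forall>k. a k \<in> R" "x = (\<Sum>k<n. a k * v k)" unfolding M_def by blast
    then show "r * x \<in> M n" unfolding M_def using R(1) \<open>r \<in> R\<close>
      by (auto intro!: exI[of _ "\<lambda>k. r * a k"] simp: is_subringD sum_distrib_left mult.assoc)
  qed
  have "M n \<subseteq> L" for n
    unfolding M_def using fg_submod[OF R(1) L] v by (auto intro!: submod_sum submodD(3))
  then have "\<exists>N\<in>range M. \<forall>U\<in>range M. N \<subseteq> U \<longrightarrow> U = N"
    using sub by (intro exists_maximal_submod[OF R L]) auto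
  then obtain n where n: "\<And>m. M n \<subseteq> M m \<Longrightarrow> M m = M n" by auto
  have "M n \<subseteq> M (Suc n)"
  proof
    fix x assume "x \<in> M n"
    then obtain a where "\<forall>k. a k \<in> R" "x = (\<Sum>k<n. a k * v k)" unfolding M_def by blast
    then show "x \<in> M (Suc n)" unfolding M_def using R(1)
      by (auto intro!: exI[of _ "a(n := 0)"] simp: is_subringD)
  qed
  moreover have "v n \<in> M (Suc n)"
    unfolding M_def using R(1) by (auto intro!: exI[of _ "(\<lambda>_. 0)(n := 1)"] simp: is_subringD)
  ultimately have "v n \<in> M n" using n by blast
  then show ?thesis unfolding M_def by blast
qed

subsection \<open>Dedekind domains\<close>

lemma ambient_simps [simp]:
  "carrier ambient = UNIV" "x \<otimes>\<^bsub>ambient\<^esub> y = x * y" "\<one>\<^bsub>ambient\<^esub> = 1"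
  "\<zero>\<^bsub>ambient\<^esub> = 0" "x \<oplus>\<^bsub>ambient\<^esub> y = x + y"
  by (simp_all add: ring_of_type_algebra_def)

lemma ring_on_simps [simp]:
  "x \<otimes>\<^bsub>ring_on R\<^esub> y = x * y" "\<one>\<^bsub>ring_on R\<^esub> = 1"
  "\<zero>\<^bsub>ring_on R\<^esub> = 0" "x \<oplus>\<^bsub>ring_on R\<^esub> y = x + y"
  by (simp_all add: ring_of_type_algebra_def)

lemma subring_ambient_iff: "subring R ambient \<longleftrightarrow> is_subring R"
proof
  have amb: "ring (ambient :: 'a ring)" by (rule ring_from_type_algebra)
  assume R: "subring R ambient"
  have neg: "\<ominus>\<^bsub>ambient\<^esub> x = - x" for x :: 'a
    using abelian_group.minus_equality[OF ring.is_abelian_group[OF amb], of "- x" x] by simp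
  show "is_subring R"
    unfolding is_subring_def
    using subringE(3)[OF R] subringE(5)[OF R] subringE(6)[OF R] subringE(7)[OF R] neg
    by simp (metis uminus_add_conv_diff add.commute)
next
  have amb: "ring (ambient :: 'a ring)" by (rule ring_from_type_algebra)
  assume R: "is_subring R"
  have neg: "\<ominus>\<^bsub>ambient\<^esub> x = - x" for x :: 'a
    using abelian_group.minus_equality[OF ring.is_abelian_group[OF amb], of "- x" x] by simp
  show "subring R ambient"
    using R by (intro ring.subringI[OF amb]) (auto simp: is_subringD neg)
qed

lemma cring_ring_on:
  fixes R :: "'a::comm_ring_1 set"
  assumes "is_subring R"
  shows "cring (ring_on R)"
proof -
  have cr: "cring (ambient :: 'a ring)" by (rule cring_from_type_algebra)
  then have "subcring R ambient"
    using assms cring.subcringI'[OF cr] by (simp add: subring_ambient_iff)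
  then show ?thesis using ring.subcring_iff[of "ambient :: 'a ring" R] cring.axioms(1)[OF cr] by simp
qed

lemma a_inv_ring_on:
  assumes "is_subring R" "x \<in> R"
  shows "\<ominus>\<^bsub>ring_on R\<^esub> x = - x"
proof -
  interpret cring "ring_on R" using cring_ring_on[OF assms(1)] .
  show ?thesis using minus_equality[of "- x" x] assms is_subringD(5)[OF assms] by simp
qed

lemma ideal_ring_on_iff:
  assumes R: "is_subring R"
  shows "ideal I (ring_on R) \<longleftrightarrow> submod R I \<and> I \<subseteq> R"
proof
  interpret cring "ring_on R" using cring_ring_on[OF R] .
  assume "ideal I (ring_on R)"
  then interpret I: ideal I "ring_on R" .
  show "submod R I \<and> I \<subseteq> R"
    unfolding submod_def using I.zero_closed I.a_closed I.I_l_closed I.a_subset by auto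
next
  interpret cring "ring_on R" using cring_ring_on[OF R] .
  assume I: "submod R I \<and> I \<subseteq> R"
  show "ideal I (ring_on R)"
  proof (rule idealI)
    show "ring (ring_on R)" by (rule ring_axioms)
    show "subgroup I (add_monoid (ring_on R))"
    proof (rule group.subgroupI[OF a_group])
      show "I \<noteq> {}" using I submodD(1) by blast
      fix a assume a: "a \<in> I"
      have "inv\<^bsub>add_monoid (ring_on R)\<^esub> a = - a"
        using a_inv_ring_on[OF R, of a] a I by (auto simp: a_inv_def)
      then show "inv\<^bsub>add_monoid (ring_on R)\<^esub> a \<in> I" using submod_uminus[OF R _ a] I by simp
    qed (use I submodD(2) in auto)
  qed (use I submodD(3,4) in auto)
qed

lemma primeideal_ring_on_iff:
  assumes R: "is_subring R"
  shows "primeideal p (ring_on R) \<longleftrightarrow> is_prime R p"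
proof
  assume "primeideal p (ring_on R)"
  then interpret primeideal p "ring_on R" .
  have 1: "submod R p" "p \<subseteq> R" using ideal_ring_on_iff[OF R] is_ideal by auto
  moreover have "1 \<notin> p"
    using 1 I_notcarr submodD(3)[OF 1(1), of _ 1] by auto
  ultimately show "is_prime R p" unfolding is_prime_def using I_prime by auto
next
  assume p: "is_prime R p"
  then have "p \<noteq> R" using is_primeD(3) is_subringD(1)[OF R] by blast
  then show "primeideal p (ring_on R)"
    using p cring_ring_on[OF R] ideal_ring_on_iff[OF R, of p] is_primeD[OF p]
    by (intro primeidealI) auto
qed

lemma noeth_ring_on:
  assumes R: "is_subring R" and "noetherian_ring (ring_on R)"
  shows "noeth R"
  unfolding noeth_def
proof (intro allI impI)
  interpret noetherian_ring "ring_on R" by fact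
  fix I assume I: "submod R I \<and> I \<subseteq> R"
  have "ideal I (ring_on R)" using I ideal_ring_on_iff[OF R] by simp
  from finetely_gen[OF this] obtain A where A: "A \<subseteq> R" "finite A" "I = Idl\<^bsub>ring_on R\<^esub> A"
    by (elim bexE exE conjE) simp
  have "A \<subseteq> I" using genideal_self[of A] A by simp
  then have "genby R A \<subseteq> I" using I by (intro genby_least) auto
  moreover have "ideal (genby R A) (ring_on R)"
    using ideal_ring_on_iff[OF R] submod_genby submod_self[OF R] genby_least[OF submod_self[OF R] A(1)] by blast
  then have "I \<subseteq> genby R A"
    unfolding A(3) using genby_superset[OF R A(2)] by (intro genideal_minimal)
  ultimately show "fg_submodule R I" unfolding fg_submodule_iff using A(2) by blast
qed

lemma maximalideal_ring_on:
  assumes R: "is_subring R" and "maximalideal p (ring_on R)" "a \<in> R - p"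
  shows "\<exists>r\<in>R. 1 - r * a \<in> p"
proof -
  interpret maximalideal p "ring_on R" by fact
  have p: "submod R p" "p \<subseteq> R" using is_ideal unfolding ideal_ring_on_iff[OF R] by simp_all
  define U where "U = {m + n | m n. m \<in> p \<and> n \<in> {r * a | r. r \<in> R}}"
  have U: "submod R U" "p \<subseteq> U" "U \<subseteq> R" "a \<in> U"
    using submod_adjoin[OF R p(1) U_def] p(2) assms(3) by blast+
  then have "ideal U (ring_on R)" unfolding ideal_ring_on_iff[OF R] by simp
  from I_maximal[OF this U(2)] U(3) have "U = p \<or> U = R" by simp
  then have UR: "U = R" using U(4) assms(3) by blast
  have "1 \<in> U" unfolding UR using is_subringD(1)[OF R] .
  then obtain m r where "1 = m + r * a" "m \<in> p" "r \<in> R" unfolding U_def by blast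
  then have "1 - r * a = m" by (simp add: algebra_simps)
  then show ?thesis using \<open>m \<in> p\<close> \<open>r \<in> R\<close> by auto
qed

section \<open>Invertibility of nonzero fractional ideals\<close>

locale dedekind =
  fixes Z :: "'q::field set"
  assumes dd: "dedekind_domain Z" and ff: "has_field_of_fractions_UNIV Z"
begin

lemma Z_ring: "is_subring Z" "noeth Z"
proof -
  show "is_subring Z" using dd by (simp add: dedekind_domain_def subring_ambient_iff)
  then show "noeth Z" using dd noeth_ring_on by (auto simp: dedekind_domain_def noetherian_domain_def)
qed

lemmas Z_simps = is_subringD[OF Z_ring(1)]

lemma fraction: "\<exists>a\<in>Z. \<exists>b\<in>Z. b \<noteq> 0 \<and> x = a / b"
  using ff by (simp add: has_field_of_fractions_UNIV_def)

lemma integral_mem: "integral_over Z x \<Longrightarrow> x \<in> Z"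
  using dd fraction[of x] by (auto simp: dedekind_domain_def)

lemma prime_maximal:
  assumes "is_prime Z p" "p \<noteq> {0}" "a \<in> Z - p"
  shows "\<exists>r\<in>Z. 1 - r * a \<in> p"
  using assms dd maximalideal_ring_on[OF Z_ring(1)] primeideal_ring_on_iff[OF Z_ring(1)]
  by (auto simp: dedekind_domain_def)

text \<open>All \<open>x ^ k * c\<close> stay in \<open>I\<close>, so noetherianity yields an
  integral equation for \<open>x\<close>, and \<open>Z\<close> is integrally closed.\<close>

lemma stabilizer_mem:
  assumes I: "fg_submodule Z I" "I \<noteq> {0}" and x: "\<And>y. y \<in> I \<Longrightarrow> x * y \<in> I"
  shows "x \<in> Z"
proof -
  have sI: "submod Z I" using fg_submod[OF Z_ring(1) I(1)] .
  obtain c where c: "c \<in> I" "c \<noteq> 0" using I(2) submodD(1)[OF sI] by blast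
  have "x ^ k * c \<in> I" for k
  proof (induction k)
    case (Suc k)
    then show ?case using x[OF Suc] by (simp add: mult.assoc)
  qed (use c in simp)
  then obtain n a where a: "\<And>k. a k \<in> Z" "x ^ n * c = (\<Sum>k<n. a k * (x ^ k * c))"
    using noeth_relation[OF Z_ring I(1), of "\<lambda>k. x ^ k * c"] by blast
  then have "x ^ n * c = (\<Sum>k<n. a k * x ^ k) * c" by (simp add: sum_distrib_right mult.assoc)
  then have xn: "x ^ n = (\<Sum>k<n. a k * x ^ k)" using c(2) by simp
  define g where "g = (\<Sum>k<n. monom (a k) k)"
  define f where "f = monom 1 n - g"
  have cg: "Polynomial.coeff g i = (if i < n then a i else 0)" for i
    unfolding g_def Polynomial.coeff_sum by (simp add: coeff_monom)
  have cf: "Polynomial.coeff f i = (if i = n then 1 else if i < n then - a i else 0)" for i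
    unfolding f_def by (simp add: cg coeff_monom)
  have "Polynomial.degree f = n"
    by (rule order_antisym) (auto intro!: Polynomial.degree_le Polynomial.le_degree simp: cf)
  then have "Polynomial.lead_coeff f = 1" by (simp add: cf)
  moreover have "set (coeffs f) \<subseteq> Z"
    using a(1) by (auto simp: coeffs_def cf Z_simps)
  moreover have "poly f x = 0"
    unfolding f_def g_def by (simp add: poly_monom poly_sum xn)
  ultimately have "integral_over Z x" unfolding integral_over_def by blast
  then show ?thesis by (rule integral_mem)
qed

text \<open>Some product of primes lies in the principal ideal of a nonzero \<open>a\<close> in
  \<open>p\<close>. In a minimal such product one factor is \<open>p\<close>. A suitable product
  \<open>b\<close> of elements of the other factors lies outside \<open>a Z\<close>, while
  \<open>b p\<close> lies inside it, so \<open>b / a\<close> is the required fraction.\<close>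

lemma prime_inverse_not_subset:
  assumes p: "is_prime Z p" "p \<noteq> {0}"
  shows "\<exists>t. t \<notin> Z \<and> (\<forall>x\<in>p. t * x \<in> Z)"
proof -
  obtain a where a: "a \<in> p" "a \<noteq> 0" using p(2) submodD(1)[OF is_primeD(1)[OF p(1)]] by blast
  let ?I = "{r * a | r. r \<in> Z}"
  have I: "submod Z ?I" "?I \<subseteq> Z" "?I \<subseteq> p" "a \<in> ?I"
    using submod_cyclic[OF Z_ring(1)] a is_primeD(1,2)[OF p(1)] submodD(3)[of Z p] Z_simps(1)
    by (auto simp: Z_simps intro!: exI[of _ 1])
  obtain n :: nat and P where P: "\<And>i. i < n \<Longrightarrow> is_prime Z (P i) \<and> ?I \<subseteq> P i"
    "\<And>x. (\<forall>i<n. x i \<in> P i) \<Longrightarrow> (\<Prod>i<n. x i) \<in> ?I"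
    using prime_product_below[OF Z_ring I(1,2)] by blast
  define good where "good A \<longleftrightarrow> A \<subseteq> {..<n} \<and> (\<forall>x. (\<forall>i\<in>A. x i \<in> P i) \<longrightarrow> (\<Prod>i\<in>A. x i) \<in> ?I)" for A
  have "good {..<n}" using P(2) by (auto simp: good_def)
  then obtain A where A: "good A" "\<And>B. good B \<Longrightarrow> card A \<le> card B"
    using ex_has_least_nat[of good "{..<n}" card] by blast
  have fin: "finite A" using A(1) finite_subset by (auto simp: good_def)
  have "\<exists>i\<in>A. P i \<subseteq> p"
  proof (rule prime_contains_factor[OF Z_ring(1) p(1) fin])
    show "(\<Prod>i\<in>A. x i) \<in> p" if "\<forall>i\<in>A. x i \<in> P i" for x
      using A(1) I(3) that unfolding good_def by blast
    show "P i \<subseteq> Z" if "i \<in> A" for i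
      using A(1) P(1)[of i] that is_primeD(2) unfolding good_def by blast
  qed
  then obtain i where i: "i \<in> A" "P i \<subseteq> p" by blast
  have Pi: "is_prime Z (P i)" "P i \<noteq> {0}" using P(1)[of i] i(1) A(1) I(4) a(2) unfolding good_def by blast+
  \<comment> \<open>\<open>P i\<close> is a nonzero prime and thus maximal, which turns the
    inclusion of \<open>P i\<close> in \<open>p\<close> into equality.\<close>
  have "p \<subseteq> P i"
  proof
    fix y assume y: "y \<in> p"
    show "y \<in> P i"
    proof (rule ccontr)
      assume "y \<notin> P i"
      then obtain r where "r \<in> Z" "1 - r * y \<in> P i"
        using prime_maximal[OF Pi, of y] y is_primeD(2)[OF p(1)] by blast
      then have "1 - r * y + r * y \<in> p"
        using i(2) y submodD(2,3)[OF is_primeD(1)[OF p(1)]] by blast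
      then show False using is_primeD(3)[OF p(1)] by simp
    qed
  qed
  have "\<not> good (A - {i})"
    using A(2)[of "A - {i}"] card_Diff1_less[OF fin i(1)] by auto
  then obtain x where x: "\<forall>k\<in>A - {i}. x k \<in> P k" "(\<Prod>k\<in>A - {i}. x k) \<notin> ?I"
    using A(1) unfolding good_def by blast
  let ?b = "\<Prod>k\<in>A - {i}. x k"
  have "?b / a \<notin> Z"
  proof
    assume "?b / a \<in> Z"
    then have "?b / a * a \<in> ?I" by blast
    then show False using x(2) a(2) by simp
  qed
  moreover have "?b / a * y \<in> Z" if y: "y \<in> p" for y
  proof -
    have "\<forall>k\<in>A. (x(i := y)) k \<in> P k" using x(1) y \<open>p \<subseteq> P i\<close> by auto
    then have "(\<Prod>k\<in>A. (x(i := y)) k) \<in> ?I" using A(1) unfolding good_def by blast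
    moreover have "(\<Prod>k\<in>A. (x(i := y)) k) = y * ?b"
      using prod.remove[OF fin i(1), of "x(i := y)"] by simp
    ultimately obtain r where "y * ?b = r * a" "r \<in> Z" by auto
    then have "?b / a * y = r" using a(2) by (simp add: field_simps)
    then show ?thesis using \<open>r \<in> Z\<close> by simp
  qed
  ultimately show ?thesis by blast
qed

text \<open>The list writes 1 as an element of the product of \<open>I\<close> with its inverse.
  Take a maximal counterexample \<open>J\<close> and a prime \<open>p\<close> above it. A fraction
  \<open>t\<close> outside \<open>Z\<close> with t p \<subseteq> Z enlarges \<open>J\<close> to
  \<open>J + t J\<close> inside \<open>Z\<close>, and strictly so: otherwise \<open>t\<close> would
  stabilize \<open>J\<close> and lie in \<open>Z\<close>.\<close>

lemma ideal_invertible: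
  assumes I: "submod Z I" "I \<subseteq> Z" "I \<noteq> {0}"
  shows "\<exists>xs. (\<forall>(c, d)\<in>set xs. c \<in> I \<and> (\<forall>x\<in>I. d * x \<in> Z)) \<and> (\<Sum>(c, d)\<leftarrow>xs. c * d) = 1"
proof (rule ccontr)
  define good where "good I \<longleftrightarrow>
    (\<exists>xs. (\<forall>(c, d)\<in>set xs. c \<in> I \<and> (\<forall>x\<in>I. d * x \<in> Z)) \<and> (\<Sum>(c, d)\<leftarrow>xs. c * d) = 1)" for I
  let ?F = "{J. submod Z J \<and> J \<subseteq> Z \<and> J \<noteq> {0} \<and> \<not> good J}"
  assume "\<not> ?thesis"
  then have "\<exists>M\<in>?F. \<forall>U\<in>?F. M \<subseteq> U \<longrightarrow> U = M"
    using I by (intro exists_maximal_submod[OF Z_ring noeth_fg_self[OF Z_ring(1)]]) (auto simp: good_def)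
  then obtain J where "J \<in> ?F" and JF: "\<forall>U\<in>?F. J \<subseteq> U \<longrightarrow> U = J" by blast
  then have J: "submod Z J" "J \<subseteq> Z" "J \<noteq> {0}" "\<not> good J" by simp_all
  have mx: "U = J" if "submod Z U" "U \<subseteq> Z" "U \<noteq> {0}" "\<not> good U" "J \<subseteq> U" for U
    using JF that by blast
  have "1 \<notin> J"
  proof
    assume "1 \<in> J"
    then have "good J" using J(2) unfolding good_def by (intro exI[of _ "[(1, 1)]"]) auto
    then show False using J by blast
  qed
  then obtain p where p: "is_prime Z p" "J \<subseteq> p" using exists_prime_above[OF Z_ring J(1,2)] by blast
  then have "p \<noteq> {0}" using J(3) submodD(1)[OF J(1)] by blast
  then obtain t where t: "t \<notin> Z" "\<forall>x\<in>p. t * x \<in> Z" using prime_inverse_not_subset[OF p(1)] by blast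
  define U where "U = {m + n | m n. m \<in> J \<and> n \<in> (*) t ` J}"
  have U: "submod Z U" unfolding U_def by (intro submod_plus submod_scale J)
  have mem: "m + t * n \<in> U" if "m \<in> J" "n \<in> J" for m n using that unfolding U_def by blast
  have JU: "J \<subseteq> U" "\<And>y. y \<in> J \<Longrightarrow> t * y \<in> U"
    using mem[of _ 0] mem[of 0] submodD(1)[OF J(1)] by auto
  have "U \<subseteq> Z"
  proof
    fix u assume "u \<in> U"
    then obtain m n where "u = m + t * n" "m \<in> J" "n \<in> J" unfolding U_def by blast
    moreover from this have "m \<in> Z" "t * n \<in> Z" using J(2) p(2) t(2) by auto
    ultimately show "u \<in> Z" using Z_simps(6) by simp
  qed
  moreover have "U \<noteq> {0}"
  proof -
    obtain x where "x \<in> J" "x \<noteq> 0" using J(3) submodD(1)[OF J(1)] by blast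
    then show ?thesis using JU(1) by blast
  qed
  moreover have "U \<noteq> J"
  proof
    assume "U = J"
    then have "t \<in> Z" using JU(2) noeth_submod_fg'[OF Z_ring noeth_fg_self[OF Z_ring(1)] J(1,2)] J(3)
      by (intro stabilizer_mem[of J]) auto
    then show False using t by blast
  qed
  ultimately have "good U" using mx[OF U] JU(1) by blast
  then obtain xs where xs: "\<And>c d. (c, d) \<in> set xs \<Longrightarrow> c \<in> U \<and> (\<forall>x\<in>U. d * x \<in> Z)" "(\<Sum>(c, d)\<leftarrow>xs. c * d) = 1"
    unfolding good_def by blast
  have *: "\<exists>ys. (\<forall>(c, d)\<in>set ys. c \<in> J \<and> (\<forall>x\<in>J. d * x \<in> Z)) \<and> (\<Sum>(c, d)\<leftarrow>ys. c * d) = (\<Sum>(c, d)\<leftarrow>xs. c * d)"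
    using xs(1)
  proof (induction xs)
    case Nil
    then show ?case by (intro exI[of _ "[]"]) auto
  next
    case (Cons cd xs)
    obtain c d where cd: "cd = (c, d)" by (cases cd)
    obtain ys where ys: "\<forall>(c, d)\<in>set ys. c \<in> J \<and> (\<forall>x\<in>J. d * x \<in> Z)"
      "(\<Sum>(c, d)\<leftarrow>ys. c * d) = (\<Sum>(c, d)\<leftarrow>xs. c * d)"
      using Cons.IH Cons.prems by fastforce
    have "c \<in> U" and d: "\<And>x. x \<in> U \<Longrightarrow> d * x \<in> Z" using Cons.prems[of c d] cd by auto
    \<comment> \<open>A term \<open>c * d\<close> with \<open>c = m + t * n\<close> splits into
      \<open>m * d\<close> and \<open>n * (d * t)\<close>; both cofactors map \<open>J\<close> into
      \<open>Z\<close>.\<close>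
    then obtain m n where mn: "c = m + t * n" "m \<in> J" "n \<in> J" unfolding U_def by blast
    have "d * x \<in> Z" "d * t * x \<in> Z" if "x \<in> J" for x
      using d[of x] d[OF JU(2)[OF that]] JU(1) that by (auto simp: mult.assoc)
    then show ?case using ys mn cd
      by (intro exI[of _ "(m, d) # (n, d * t) # ys"]) (auto simp: algebra_simps)
  qed
  then have "good J" unfolding good_def xs(2) by blast
  then show False using J by blast
qed

lemma common_denominator:
  assumes "finite B"
  shows "\<exists>e\<in>Z. e \<noteq> 0 \<and> (\<forall>b\<in>B. e * b \<in> Z)"
  using assms
proof (induction B rule: finite_induct)
  case empty
  then show ?case using Z_simps(1) by (intro bexI[of _ 1]) auto
next
  case (insert b B)
  then obtain e where e: "e \<in> Z" "e \<noteq> 0" "\<forall>b\<in>B. e * b \<in> Z" by blast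
  obtain u v where uv: "u \<in> Z" "v \<in> Z" "v \<noteq> 0" "b = u / v" using fraction[of b] by blast
  have "v * e * b = e * u" using uv by simp
  moreover have "v * e * x \<in> Z" if "x \<in> B" for x
    using Z_simps(4)[OF uv(2), of "e * x"] e that by (simp add: mult.assoc)
  ultimately show ?case using e uv by (intro bexI[of _ "v * e"]) (auto simp: Z_simps)
qed

lemma frac_ideal_invertible:
  assumes I: "fg_submodule Z I" "I \<noteq> {0}"
  shows "\<exists>xs. (\<forall>(c, d)\<in>set xs. c \<in> I \<and> (\<forall>x\<in>I. d * x \<in> Z)) \<and> (\<Sum>(c, d)\<leftarrow>xs. c * d) = 1"
proof -
  obtain B where B: "finite B" "I = genby Z B" using I by (auto simp: fg_submodule_iff)
  obtain e where e: "e \<in> Z" "e \<noteq> 0" "\<forall>b\<in>B. e * b \<in> Z" using common_denominator[OF B(1)] by blast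
  let ?J = "(*) e ` I"
  have sI: "submod Z I" using fg_submod[OF Z_ring(1) I(1)] .
  have "?J \<subseteq> Z" unfolding B(2) genby_scale[OF B(1) Z_ring(1), symmetric]
    using e by (intro genby_least submod_self Z_ring) auto
  moreover have "?J \<noteq> {0}"
  proof -
    obtain x where "x \<in> I" "x \<noteq> 0" using I(2) submodD(1)[OF sI] by blast
    then have "e * x \<in> ?J" "e * x \<noteq> 0" using e(2) by auto
    then show ?thesis by blast
  qed
  ultimately obtain xs where xs: "\<And>c d. (c, d) \<in> set xs \<Longrightarrow> c \<in> ?J \<and> (\<forall>x\<in>?J. d * x \<in> Z)"
    "(\<Sum>(c, d)\<leftarrow>xs. c * d) = 1"
    using ideal_invertible[OF submod_scale[OF sI], of e] by blast
  let ?ys = "map (\<lambda>(c, d). (c / e, d * e)) xs"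
  have "\<forall>(c, d)\<in>set ?ys. c \<in> I \<and> (\<forall>x\<in>I. d * x \<in> Z)"
    using xs(1) e(2) by (fastforce simp: mult.assoc)
  moreover have "(\<Sum>(c, d)\<leftarrow>?ys. c * d) = (\<Sum>(c, d)\<leftarrow>xs. c * d)"
    using e(2) by (simp add: o_def case_prod_unfold)
  ultimately show ?thesis using xs(2) by (intro exI[of _ ?ys] conjI) (assumption, simp only:)
qed

end

subsection \<open>Separability idempotents\<close>

text \<open>Coprimality as an identity, which survives evaluation at an element of
  \<open>K\<close>.\<close>

definition bezout :: "'q::field poly \<Rightarrow> 'q poly \<Rightarrow> bool" where
  "bezout f g \<longleftrightarrow> (\<exists>u v. u * f + v * g = 1)"

text \<open>By division with remainder, a nonzero combination of \<open>f\<close> and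
  \<open>g\<close> of least degree divides both.\<close>

lemma coprime_imp_bezout:
  fixes f g :: "'q::field poly"
  assumes "coprime f g"
  shows "bezout f g"
proof -
  define H where "H = {h. h \<noteq> 0 \<and> (\<exists>u v. h = u * f + v * g)}"
  have "f \<noteq> 0 \<or> g \<noteq> 0"
  proof (rule ccontr)
    assume "\<not> ?thesis"
    then have "is_unit [:0, 1 :: 'q:]" using assms by (intro coprime_common_divisor[of f g]) auto
    then show False by (simp add: is_unit_pCons_iff)
  qed
  moreover have "f = 1 * f + 0 * g" "g = 0 * f + 1 * g" by simp_all
  ultimately have "\<exists>h. h \<in> H" unfolding H_def by blast
  then obtain h where h: "h \<in> H" "\<And>k. k \<in> H \<Longrightarrow> Polynomial.degree h \<le> Polynomial.degree k"
    using ex_has_least_nat[of "\<lambda>h. h \<in> H" _ Polynomial.degree] by blast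
  then obtain u v where uv: "h = u * f + v * g" and h0: "h \<noteq> 0" by (auto simp: H_def)
  have dvd: "h dvd k" if "k = a * f + b * g" for k a b
  proof (rule ccontr)
    assume nd: "\<not> h dvd k"
    have "k mod h = k - k div h * h" by (simp add: minus_div_mult_eq_mod)
    also have "\<dots> = (a - k div h * u) * f + (b - k div h * v) * g"
      by (simp add: that uv algebra_simps)
    finally have "k mod h \<in> H" using nd unfolding H_def by (auto simp: dvd_eq_mod_eq_0)
    moreover have "Polynomial.degree (k mod h) < Polynomial.degree h"
      using degree_mod_less[OF h0, of k] nd by (auto simp: dvd_eq_mod_eq_0)
    ultimately show False using h(2) by fastforce
  qed
  have "h dvd f" "h dvd g" using dvd[of f 1 0] dvd[of g 0 1] by simp_all
  then have "is_unit h" using assms coprime_common_divisor by blast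
  then obtain w where "1 = h * w" by (auto elim: dvdE)
  then have "(w * u) * f + (w * v) * g = 1" using uv by (simp add: algebra_simps)
  then show ?thesis unfolding bezout_def by blast
qed

lemma bezout_sym: "bezout f g \<Longrightarrow> bezout g f"
  unfolding bezout_def by (metis add.commute)

lemma bezout_mult_left:
  assumes "bezout f h" "bezout g h"
  shows "bezout (f * g) h"
proof -
  obtain u v u' v' where e: "u * f + v * h = 1" "u' * g + v' * h = 1" using assms by (auto simp: bezout_def)
  have "(u * u') * (f * g) + (u * f * v' + v * (u' * g + v' * h)) * h = (u * f + v * h) * (u' * g + v' * h)"
    by (simp add: algebra_simps)
  then show ?thesis unfolding e bezout_def by auto
qed

lemma bezout_add_multiple:
  assumes "bezout f g"
  shows "bezout f (g + f * h)"
proof -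
  obtain u v where e: "u * f + v * g = 1" using assms by (auto simp: bezout_def)
  have "(u - v * h) * f + v * (g + f * h) = u * f + v * g" by (simp add: algebra_simps)
  then show ?thesis unfolding e bezout_def by blast
qed

text \<open>Modulo \<open>f\<close> the derivative of \<open>f * g\<close> is
  \<open>g * pderiv f\<close>, a product of two polynomials coprime to \<open>f\<close>;
  symmetrically for \<open>g\<close>.\<close>

lemma bezout_pderiv_mult:
  assumes "bezout f (pderiv f)" "bezout g (pderiv g)" "bezout f g"
  shows "bezout (f * g) (pderiv (f * g))"
proof (rule bezout_mult_left)
  have "bezout f (g * pderiv f)"
    using bezout_mult_left[OF bezout_sym[OF assms(3)] bezout_sym[OF assms(1)]] bezout_sym by blast
  from bezout_add_multiple[OF this, of "pderiv g"] show "bezout f (pderiv (f * g))"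
    by (simp add: pderiv_mult algebra_simps)
  have "bezout g (f * pderiv g)"
    using bezout_mult_left[OF assms(3) bezout_sym[OF assms(2)]] bezout_sym by blast
  from bezout_add_multiple[OF this, of "pderiv f"] show "bezout g (pderiv (f * g))"
    by (simp add: pderiv_mult algebra_simps)
qed

text \<open>Irreducible polynomials with a common non-unit divisor are associated, and associated
  monic polynomials are equal.\<close>

lemma irreducible_monic_bezout:
  fixes f g :: "'q::field poly"
  assumes "Factorial_Ring.irreducible f" "Factorial_Ring.irreducible g"
    and "Polynomial.lead_coeff f = 1" "Polynomial.lead_coeff g = 1" "f \<noteq> g"
  shows "bezout f g"
proof (rule coprime_imp_bezout, rule coprimeI)
  fix c assume c: "c dvd f" "c dvd g"
  show "is_unit c"
  proof (rule ccontr)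
    assume "\<not> is_unit c"
    then have "f dvd c" "g dvd c"
      using Factorial_Ring.irreducibleD'[OF assms(1) c(1)] Factorial_Ring.irreducibleD'[OF assms(2) c(2)] by auto
    then have "f dvd g" "g dvd f" using c dvd_trans by blast+
    obtain k where k: "g = f * k" using \<open>f dvd g\<close> by (elim dvdE)
    obtain l where l: "f = g * l" using \<open>g dvd f\<close> by (elim dvdE)
    have "f \<noteq> 0" using assms(3) by auto
    then have "k * l = 1" using k l by (metis mult.assoc mult_cancel_left2)
    then have "is_unit k" by (metis dvdI)
    then obtain c where "k = [:c:]" by (auto simp: is_unit_poly_iff)
    then have "g = smult c f" using k by simp
    then have "g = f" using assms(3,4) by (cases "c = 0") auto
    then show False using assms(5) by simp
  qed
qed

text \<open>\<open>G\<close> is a set, so no factor is repeated; a repeated factor would destroy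
  separability.\<close>

lemma bezout_pderiv_prod:
  fixes G :: "'q::field poly set"
  assumes "finite G" "\<And>g. g \<in> G \<Longrightarrow> Factorial_Ring.irreducible g \<and> Polynomial.lead_coeff g = 1 \<and> bezout g (pderiv g)"
  shows "bezout (\<Prod>G) (pderiv (\<Prod>G))"
  using assms
proof (induction G rule: finite_induct)
  case empty
  then show ?case by (auto simp: bezout_def intro: exI[of _ 1])
next
  case (insert f G)
  have fG: "bezout (\<Prod>A) f" if "A \<subseteq> G" for A
    using finite_subset[OF that insert.hyps(1)] that
  proof (induction A rule: finite_induct)
    case empty
    then show ?case unfolding bezout_def by (intro exI[of _ 1] exI[of _ 0]) simp
  next
    case (insert a A)
    then have "bezout a f"
      using insert.prems \<open>f \<notin> G\<close> by (intro irreducible_monic_bezout) (use \<open>\<And>g. g \<in> insert f G \<Longrightarrow> _\<close> in auto)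
    then show ?case using insert by (simp add: bezout_mult_left)
  qed
  have "bezout f (pderiv f)" "bezout (\<Prod>G) (pderiv (\<Prod>G))" using insert by auto
  then have "bezout (f * \<Prod>G) (pderiv (f * \<Prod>G))"
    using fG[of G] by (intro bezout_pderiv_mult) (auto intro: bezout_sym)
  then show ?case using insert.hyps by simp
qed

section \<open>Linear functionals and tensors in K \<otimes> K\<close>

locale q_algebra =
  fixes j :: "'q::field \<Rightarrow> 'k::comm_ring_1"
  assumes j_hom: "j \<in> ring_hom ambient ambient"
begin

lemma j_simps [simp]:
  "j (x + y) = j x + j y" "j (x * y) = j x * j y" "j 1 = 1" "j 0 = 0" "j (- x) = - j x" "j (x - y) = j x - j y"
proof -
  show a: "j (x + y) = j x + j y" "j (x * y) = j x * j y" "j 1 = 1" for x y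
    using ring_hom_add[OF j_hom, of x y] ring_hom_mult[OF j_hom, of x y] ring_hom_one[OF j_hom] by simp_all
  show 0: "j 0 = 0" using a(1)[of 0 0] by simp
  show m: "j (- x) = - j x" for x using a(1)[of x "-x"] 0 by (simp add: eq_neg_iff_add_eq_0 add.commute)
  show "j (x - y) = j x - j y" using a(1)[of x "-y"] m by simp
qed

lemma j_sum: "j (\<Sum>i\<in>A. f i) = (\<Sum>i\<in>A. j (f i))"
  by (induction A rule: infinite_finite_induct) auto

lemma j_inverse: "x \<noteq> 0 \<Longrightarrow> j x * j (inverse x) = 1"
  using j_simps(2)[of x "inverse x"] by simp

lemma j_cancel: "x \<noteq> 0 \<Longrightarrow> j x * y = j x * z \<longleftrightarrow> y = z"
proof
  assume x: "x \<noteq> 0" and "j x * y = j x * z"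
  then have "(j x * j (inverse x)) * y = (j x * j (inverse x)) * z" by (metis mult.assoc mult.commute)
  then show "y = z" using j_inverse[OF x] by simp
qed simp

lemma j_inj: "j x = j y \<longleftrightarrow> x = y"
proof
  assume "j x = j y"
  then have "j (x - y) = 0" by simp
  then show "x = y" using j_cancel[of "x - y" 1 0] by auto
qed simp

lemma j_nonzero: "x \<noteq> 0 \<Longrightarrow> j x \<noteq> 0"
  using j_inj[of x 0] by simp

sublocale vs: vector_space "alg_scale j"
  by unfold_locales (simp_all add: alg_scale_def algebra_simps)

definition qlinear :: "('k \<Rightarrow> 'q) \<Rightarrow> bool" where
  "qlinear \<phi> \<longleftrightarrow> (\<forall>x y. \<phi> (x + y) = \<phi> x + \<phi> y) \<and> (\<forall>q x. \<phi> (j q * x) = q * \<phi> x)"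

lemma qlinearD:
  assumes "qlinear \<phi>"
  shows "\<phi> (x + y) = \<phi> x + \<phi> y" "\<phi> (j q * x) = q * \<phi> x" "\<phi> 0 = 0"
    "\<phi> (x * j q) = q * \<phi> x"
    "\<phi> (\<Sum>i\<in>A. h i) = (\<Sum>i\<in>A. \<phi> (h i))" "\<phi> (- x) = - \<phi> x" "\<phi> (x - y) = \<phi> x - \<phi> y"
    "\<phi> (sum_list xs) = sum_list (map \<phi> xs)"
proof -
  show a: "\<phi> (x + y) = \<phi> x + \<phi> y" and s: "\<phi> (j q * x) = q * \<phi> x" for x y q
    using assms by (auto simp: qlinear_def)
  show "\<phi> (x * j q) = q * \<phi> x" using s by (simp add: mult.commute)
  show z: "\<phi> 0 = 0" using s[of 0 0] by simp
  show "\<phi> (\<Sum>i\<in>A. h i) = (\<Sum>i\<in>A. \<phi> (h i))"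
    by (induction A rule: infinite_finite_induct) (auto simp: a z)
  show m: "\<phi> (- x) = - \<phi> x" for x using s[of "-1" x] by simp
  show "\<phi> (x - y) = \<phi> x - \<phi> y" using a[of x "-y"] m by simp
  show "\<phi> (sum_list xs) = sum_list (map \<phi> xs)" by (induction xs) (auto simp: a z)
qed

lemma qlinear_mult: "qlinear \<phi> \<Longrightarrow> qlinear (\<lambda>x. \<phi> (c * x))"
  by (auto simp: qlinear_def distrib_left) (metis mult.left_commute)

text \<open>
  A list of pairs \<open>(a, b)\<close> stands for the tensor \<open>\<Sum> a \<otimes> b\<close> in \<open>K \<otimes> K\<close>, which is tested against linear
  functionals on the first factor. \<open>commuting E \<theta>\<close> says that \<open>(\<theta> \<otimes> 1) E = (1 \<otimes> \<theta>) E\<close>.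
\<close>

definition contract :: "('k \<times> 'k) list \<Rightarrow> ('k \<Rightarrow> 'q) \<Rightarrow> 'k" where
  "contract E \<phi> = (\<Sum>(a, b)\<leftarrow>E. j (\<phi> a) * b)"

definition commuting :: "('k \<times> 'k) list \<Rightarrow> 'k \<Rightarrow> bool" where
  "commuting E \<theta> \<longleftrightarrow> (\<forall>\<phi>. qlinear \<phi> \<longrightarrow> contract E (\<lambda>a. \<phi> (\<theta> * a)) = \<theta> * contract E \<phi>)"

definition tensor_prod :: "('k \<times> 'k) list \<Rightarrow> ('k \<times> 'k) list \<Rightarrow> ('k \<times> 'k) list" where
  "tensor_prod E F = concat (map (\<lambda>(a, b). map (\<lambda>(c, d). (a * c, b * d)) F) E)"

lemma tensor_prod_simps:
  "tensor_prod [] F = []"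
  "tensor_prod ((a, b) # E) F = map (\<lambda>(c, d). (a * c, b * d)) F @ tensor_prod E F"
  by (simp_all add: tensor_prod_def)

lemma contract_simps:
  "contract [] \<phi> = 0" "contract ((a, b) # E) \<phi> = j (\<phi> a) * b + contract E \<phi>"
  "contract (E @ F) \<phi> = contract E \<phi> + contract F \<phi>"
  by (simp_all add: contract_def)

lemma contract_map:
  "contract (map (\<lambda>(c, d). (a * c, b * d)) F) \<phi> = b * contract F (\<lambda>c. \<phi> (a * c))"
  by (induction F) (auto simp: contract_simps algebra_simps)

lemma contract_tensor_prod_left:
  "contract (tensor_prod E F) \<phi> = (\<Sum>(a, b)\<leftarrow>E. b * contract F (\<lambda>c. \<phi> (a * c)))"
  by (induction E) (auto simp: tensor_prod_simps contract_simps contract_map)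

lemma contract_tensor_prod_right:
  "contract (tensor_prod E F) \<phi> = (\<Sum>(c, d)\<leftarrow>F. d * contract E (\<lambda>a. \<phi> (a * c)))"
proof (induction E)
  case Nil
  then show ?case by (induction F) (auto simp: tensor_prod_simps contract_simps)
next
  case (Cons ab E)
  obtain a b where ab: "ab = (a, b)" by (cases ab)
  have "b * contract F (\<lambda>c. \<phi> (a * c)) + (\<Sum>(c, d)\<leftarrow>F. d * contract E (\<lambda>a. \<phi> (a * c)))
    = (\<Sum>(c, d)\<leftarrow>F. d * contract (ab # E) (\<lambda>a. \<phi> (a * c)))"
    unfolding ab by (induction F) (auto simp: contract_simps algebra_simps)
  then show ?case using Cons unfolding ab by (simp add: tensor_prod_simps contract_simps contract_map)
qed

text \<open>The tensors annihilated by \<theta> \<otimes> 1 - 1 \<otimes> \<theta> form an ideal of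
  K \<otimes> K. Concretely, the contraction of a product can be expanded along either
  factor.\<close>

lemma commuting_tensor_prod:
  assumes "commuting E \<theta> \<or> commuting F \<theta>"
  shows "commuting (tensor_prod E F) \<theta>"
  unfolding commuting_def
proof (intro allI impI)
  fix \<phi> assume phi: "qlinear \<phi>"
  have pull: "(\<Sum>(a, b)\<leftarrow>L. b * (\<theta> * h a)) = \<theta> * (\<Sum>(a, b)\<leftarrow>L. b * h a)" for L and h :: "'k \<Rightarrow> 'k"
    by (induction L) (auto simp: distrib_left mult.left_commute)
  from assms show "contract (tensor_prod E F) (\<lambda>a. \<phi> (\<theta> * a)) = \<theta> * contract (tensor_prod E F) \<phi>"
  proof
    assume F: "commuting F \<theta>"
    have "contract F (\<lambda>c. \<phi> (\<theta> * (a * c))) = \<theta> * contract F (\<lambda>c. \<phi> (a * c))" for a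
    proof -
      have "contract F (\<lambda>c. \<phi> (a * (\<theta> * c))) = \<theta> * contract F (\<lambda>c. \<phi> (a * c))"
        using F qlinear_mult[OF phi, of a] unfolding commuting_def by blast
      then show ?thesis by (simp add: mult.left_commute[of \<theta> a])
    qed
    then show ?thesis unfolding contract_tensor_prod_left by (simp only: pull)
  next
    assume E: "commuting E \<theta>"
    have "contract E (\<lambda>a. \<phi> (\<theta> * (a * c))) = \<theta> * contract E (\<lambda>a. \<phi> (a * c))" for c
    proof -
      have "qlinear (\<lambda>a. \<phi> (a * c))" using qlinear_mult[OF phi, of c] by (simp add: mult.commute[of c])
      then have "contract E (\<lambda>a. \<phi> ((\<theta> * a) * c)) = \<theta> * contract E (\<lambda>a. \<phi> (a * c))"
        using E unfolding commuting_def by blast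
      then show ?thesis by (simp only: mult.assoc)
    qed
    then show ?thesis unfolding contract_tensor_prod_right by (simp only: mult.assoc pull)
  qed
qed

text \<open>The multiplication map K \<otimes> K \<rightarrow> K.\<close>

definition tensor_mult :: "('k \<times> 'k) list \<Rightarrow> 'k" where
  "tensor_mult E = (\<Sum>(a, b)\<leftarrow>E. a * b)"

lemma tensor_mult_prod: "tensor_mult (tensor_prod E F) = tensor_mult E * tensor_mult F"
proof (induction E)
  case (Cons ab E)
  obtain a b where ab: "ab = (a, b)" by (cases ab)
  have "(\<Sum>(c, d)\<leftarrow>map (\<lambda>(c, d). (a * c, b * d)) F. c * d) = a * b * tensor_mult F"
    by (induction F) (auto simp: tensor_mult_def algebra_simps)
  then show ?case using Cons by (simp add: ab tensor_prod_simps tensor_mult_def algebra_simps)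
qed (simp add: tensor_prod_simps tensor_mult_def)

section \<open>Evaluation of polynomials over Q at elements of K\<close>

abbreviation peval :: "'q poly \<Rightarrow> 'k \<Rightarrow> 'k" where
  "peval f x \<equiv> poly (map_poly j f) x"

lemma peval_pCons: "peval (pCons a f) x = j a + x * peval f x"
  by (cases "f = 0 \<and> a = 0") (auto simp: map_poly_pCons)

lemma peval_add: "peval (f + g) x = peval f x + peval g x"
proof -
  have "map_poly j (f + g) = map_poly j f + map_poly j g"
    by (rule poly_eqI) (simp add: coeff_map_poly)
  then show ?thesis by simp
qed

lemma peval_smult: "peval (smult c g) x = j c * peval g x"
proof -
  have "map_poly j (smult c g) = smult (j c) (map_poly j g)"
    by (rule poly_eqI) (simp add: coeff_map_poly)
  then show ?thesis by simp
qed

lemma peval_mult: "peval (f * g) x = peval f x * peval g x"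
  by (induction f) (simp_all add: peval_pCons peval_add peval_smult algebra_simps)

lemma peval_one: "peval 1 x = 1"
  by (simp add: one_pCons peval_pCons)

lemma peval_altdef: "peval f x = (\<Sum>k\<le>Polynomial.degree f. j (Polynomial.coeff f k) * x ^ k)"
proof -
  have "Polynomial.degree (map_poly j f) = Polynomial.degree f"
    using j_nonzero by (intro degree_map_poly) auto
  then show ?thesis by (simp add: poly_altdef coeff_map_poly)
qed

lemma peval_sum: "peval (\<Sum>i\<in>A. f i) x = (\<Sum>i\<in>A. peval (f i) x)"
  by (induction A rule: infinite_finite_induct) (auto simp: peval_add)

lemma peval_monom: "peval (monom c k) x = j c * x ^ k"
  by (simp add: map_poly_monom poly_monom)

lemma peval_pderiv:
  "peval (pderiv f) x = (\<Sum>k\<le>Polynomial.degree f. j (Polynomial.coeff f k) * (of_nat k * x ^ (k - 1)))"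
proof -
  have nat: "j (of_nat n) = of_nat n" for n by (induction n) auto
  have "pderiv (\<Sum>k\<in>A. monom (Polynomial.coeff f k) k) =
    (\<Sum>k\<in>A. monom (of_nat k * Polynomial.coeff f k) (k - 1))" for A
    by (induction A rule: infinite_finite_induct) (auto simp: pderiv_add pderiv_monom)
  then have "pderiv f = (\<Sum>k\<le>Polynomial.degree f. monom (of_nat k * Polynomial.coeff f k) (k - 1))"
    by (metis poly_as_sum_of_monoms)
  then show ?thesis by (simp add: peval_sum peval_monom nat ac_simps)
qed

text \<open>The tensor is \<open>c (f(x) - f(y)) / (x - y)\<close> at \<open>x = \<theta> \<otimes> 1\<close>, \<open>y = 1 \<otimes> \<theta>\<close>, where \<open>c = 1 / f'(\<theta>)\<close>.\<close>

lemma separable_commuting: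
  assumes f: "bezout f (pderiv f)" "peval f \<theta> = 0"
  shows "\<exists>E. tensor_mult E = 1 \<and> commuting E \<theta>"
proof -
  obtain u v where "u * f + v * pderiv f = 1" using f(1) by (auto simp: bezout_def)
  then have "peval (u * f + v * pderiv f) \<theta> = 1" by (simp add: peval_one)
  then have c: "peval v \<theta> * peval (pderiv f) \<theta> = 1" using f(2) by (simp add: peval_add peval_mult)
  define c where "c = peval v \<theta>"
  define n where "n = Polynomial.degree f"
  define a where "a k = j (Polynomial.coeff f k)" for k
  \<comment> \<open>The quotient is formed termwise: the monomial of degree \<open>k\<close>
    contributes \<open>c * a k\<close> times the sum of all x^i y^(k-1-i) with i < k, which is empty
    for \<open>k = 0\<close>.\<close>
  define E where "E = concat (map (\<lambda>k. map (\<lambda>i. (\<theta> ^ i, c * a k * \<theta> ^ (k - 1 - i))) [0..<k]) [0..<Suc n])"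
  have contr: "contract E \<phi> = (\<Sum>k\<le>n. \<Sum>i<k. j (\<phi> (\<theta> ^ i)) * (c * a k * \<theta> ^ (k - 1 - i)))" for \<phi>
  proof -
    have "contract (map (\<lambda>i. (\<theta> ^ i, c * a k * \<theta> ^ (k - 1 - i))) [0..<m]) \<phi>
      = (\<Sum>i<m. j (\<phi> (\<theta> ^ i)) * (c * a k * \<theta> ^ (k - 1 - i)))" for k m
      by (induction m) (auto simp: contract_simps)
    then have "contract (concat (map (\<lambda>k. map (\<lambda>i. (\<theta> ^ i, c * a k * \<theta> ^ (k - 1 - i))) [0..<k]) [0..<m])) \<phi>
      = (\<Sum>k<m. \<Sum>i<k. j (\<phi> (\<theta> ^ i)) * (c * a k * \<theta> ^ (k - 1 - i)))" for m
      by (induction m) (auto simp: contract_simps)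
    then show ?thesis unfolding E_def lessThan_Suc_atMost[symmetric] by blast
  qed
  have "tensor_mult E = (\<Sum>k\<le>n. \<Sum>i<k. \<theta> ^ i * (c * a k * \<theta> ^ (k - 1 - i)))"
  proof -
    have "tensor_mult (map (\<lambda>i. (\<theta> ^ i, c * a k * \<theta> ^ (k - 1 - i))) [0..<m])
      = (\<Sum>i<m. \<theta> ^ i * (c * a k * \<theta> ^ (k - 1 - i)))" for k m
      by (induction m) (auto simp: tensor_mult_def)
    then have "tensor_mult (concat (map (\<lambda>k. map (\<lambda>i. (\<theta> ^ i, c * a k * \<theta> ^ (k - 1 - i))) [0..<k]) [0..<m]))
      = (\<Sum>k<m. \<Sum>i<k. \<theta> ^ i * (c * a k * \<theta> ^ (k - 1 - i)))" for m
      by (induction m) (auto simp: tensor_mult_def)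
    then show ?thesis unfolding E_def lessThan_Suc_atMost[symmetric] by blast
  qed
  \<comment> \<open>On the diagonal the \<open>k\<close> terms of degree \<open>k\<close> coincide,
    which produces the derivative.\<close>
  also have "\<dots> = (\<Sum>k\<le>n. c * (a k * (of_nat k * \<theta> ^ (k - 1))))"
  proof (intro sum.cong refl)
    fix k
    have "(\<Sum>i<k. \<theta> ^ i * (c * a k * \<theta> ^ (k - 1 - i))) = (\<Sum>i<k. c * a k * \<theta> ^ (k - 1))"
    proof (intro sum.cong refl)
      fix i assume "i \<in> {..<k}"
      then have "\<theta> ^ (k - 1) = \<theta> ^ i * \<theta> ^ (k - 1 - i)" by (subst power_add[symmetric]) simp
      then show "\<theta> ^ i * (c * a k * \<theta> ^ (k - 1 - i)) = c * a k * \<theta> ^ (k - 1)" by (simp add: ac_simps)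
    qed
    then show "(\<Sum>i<k. \<theta> ^ i * (c * a k * \<theta> ^ (k - 1 - i))) = c * (a k * (of_nat k * \<theta> ^ (k - 1)))"
      by (simp add: ac_simps)
  qed
  also have "\<dots> = c * peval (pderiv f) \<theta>" by (simp add: peval_pderiv n_def a_def sum_distrib_left)
  also have "\<dots> = 1" using c by (simp add: c_def)
  finally have m: "tensor_mult E = 1" .
  have "commuting E \<theta>"
    unfolding commuting_def
  proof (intro allI impI)
    fix \<phi> assume phi: "qlinear \<phi>"
    have "contract E (\<lambda>x. \<phi> (\<theta> * x)) - \<theta> * contract E \<phi>
      = (\<Sum>k\<le>n. \<Sum>i<k. c * a k * (j (\<phi> (\<theta> ^ Suc i)) * \<theta> ^ (k - Suc i) - j (\<phi> (\<theta> ^ i)) * \<theta> ^ (k - i)))"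
    proof -
      have "\<theta> * \<theta> ^ (k - Suc i) = \<theta> ^ (k - i)" if "i < k" for i k
        using that by (metis Suc_diff_Suc power_Suc)
      then have "j (\<phi> (\<theta> ^ Suc i)) * (c * a k * \<theta> ^ (k - 1 - i)) - \<theta> * (j (\<phi> (\<theta> ^ i)) * (c * a k * \<theta> ^ (k - 1 - i)))
        = c * a k * (j (\<phi> (\<theta> ^ Suc i)) * \<theta> ^ (k - Suc i) - j (\<phi> (\<theta> ^ i)) * \<theta> ^ (k - i))" if "i < k" for i k
        using that by (simp add: right_diff_distrib mult.assoc mult.left_commute[of \<theta>])
      then show ?thesis unfolding contr by (simp add: sum_distrib_left sum_subtractf[symmetric])
    qed
    \<comment> \<open>The inner sums telescope: multiplying the quotient by x - y leaves a multiple
      of f(x) - f(y), and \<open>\<theta>\<close> is a root of \<open>f\<close>.\<close>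
    also have "\<dots> = (\<Sum>k\<le>n. c * a k * (j (\<phi> (\<theta> ^ k)) - j (\<phi> 1) * \<theta> ^ k))"
    proof (intro sum.cong refl)
      fix k
      have "(\<Sum>i<k. j (\<phi> (\<theta> ^ Suc i)) * \<theta> ^ (k - Suc i) - j (\<phi> (\<theta> ^ i)) * \<theta> ^ (k - i))
        = j (\<phi> (\<theta> ^ k)) - j (\<phi> 1) * \<theta> ^ k"
        using sum_lessThan_telescope[of "\<lambda>i. j (\<phi> (\<theta> ^ i)) * \<theta> ^ (k - i)" k] by simp
      then show "(\<Sum>i<k. c * a k * (j (\<phi> (\<theta> ^ Suc i)) * \<theta> ^ (k - Suc i) - j (\<phi> (\<theta> ^ i)) * \<theta> ^ (k - i)))
        = c * a k * (j (\<phi> (\<theta> ^ k)) - j (\<phi> 1) * \<theta> ^ k)" by (simp add: sum_distrib_left[symmetric])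
    qed
    also have "\<dots> = c * (j (\<phi> (peval f \<theta>)) - j (\<phi> 1) * peval f \<theta>)"
      unfolding peval_altdef n_def[symmetric] a_def
      by (simp add: qlinearD[OF phi] j_sum sum_distrib_left sum_subtractf algebra_simps)
    also have "\<dots> = 0" using f(2) by (simp add: qlinearD[OF phi])
    finally show "contract E (\<lambda>a. \<phi> (\<theta> * a)) = \<theta> * contract E \<phi>" by simp
  qed
  then show ?thesis using m by blast
qed

text \<open>Multiply the tensors of the single elements, starting from 1 \<otimes> 1;
  \<open>tensor_mult\<close> is multiplicative. For a spanning set the result is a separability
  idempotent of \<open>K\<close>.\<close>

lemma finite_commuting:
  assumes "finite A" "\<And>\<theta>. \<theta> \<in> A \<Longrightarrow> \<exists>f. bezout f (pderiv f) \<and> peval f \<theta> = 0"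
  shows "\<exists>E. tensor_mult E = 1 \<and> (\<forall>\<theta>\<in>A. commuting E \<theta>)"
  using assms
proof (induction A rule: finite_induct)
  case empty
  then show ?case by (intro exI[of _ "[(1, 1)]"]) (simp add: tensor_mult_def)
next
  case (insert \<theta> A)
  obtain E where E: "tensor_mult E = 1" "\<forall>\<theta>\<in>A. commuting E \<theta>" using insert by auto
  obtain f where "bezout f (pderiv f)" "peval f \<theta> = 0" using insert.prems by auto
  then obtain F where F: "tensor_mult F = 1" "commuting F \<theta>" using separable_commuting by blast
  show ?case using E F commuting_tensor_prod[of E _ F]
    by (intro exI[of _ "tensor_prod E F"]) (auto simp: tensor_mult_prod)
qed

lemma commuting_span:
  assumes "\<forall>\<theta>\<in>A. commuting E \<theta>" "x \<in> vs.span A"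
  shows "commuting E x"
  using assms(2)
proof (induction rule: vs.span_induct_alt)
  case base
  have 0: "contract E (\<lambda>_. 0) = 0" by (induction E) (auto simp: contract_simps)
  show ?case unfolding commuting_def
  proof (intro allI impI)
    fix \<phi> assume "qlinear \<phi>"
    from qlinearD(3)[OF this] show "contract E (\<lambda>a. \<phi> (0 * a)) = 0 * contract E \<phi>" using 0 by simp
  qed
next
  case (step q x y)
  have x: "commuting E x" using step assms(1) by blast
  show ?case unfolding commuting_def
  proof (intro allI impI)
    fix \<phi> assume phi: "qlinear \<phi>"
    have "contract E (\<lambda>a. \<phi> ((alg_scale j q x + y) * a)) = j q * contract E (\<lambda>a. \<phi> (x * a)) + contract E (\<lambda>a. \<phi> (y * a))"
    proof -
      have "\<phi> ((alg_scale j q x + y) * a) = q * \<phi> (x * a) + \<phi> (y * a)" for a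
        using qlinearD(1,2)[OF phi] by (simp add: alg_scale_def distrib_right mult.assoc)
      then have "contract F (\<lambda>a. \<phi> ((alg_scale j q x + y) * a))
        = j q * contract F (\<lambda>a. \<phi> (x * a)) + contract F (\<lambda>a. \<phi> (y * a))" for F
        by (induction F) (auto simp: contract_simps algebra_simps)
      then show ?thesis .
    qed
    also have "\<dots> = (alg_scale j q x + y) * contract E \<phi>"
      using x step.IH phi unfolding commuting_def by (simp add: alg_scale_def algebra_simps)
    finally show "contract E (\<lambda>a. \<phi> ((alg_scale j q x + y) * a)) = (alg_scale j q x + y) * contract E \<phi>" .
  qed
qed

end

subsection \<open>Etale algebras and the trace\<close>

lemma RDirProd_list_nth:
  assumes "i < length Rs" "xs \<in> carrier (RDirProd_list Rs)" "ys \<in> carrier (RDirProd_list Rs)"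
  shows "(xs \<otimes>\<^bsub>RDirProd_list Rs\<^esub> ys) ! i = xs ! i \<otimes>\<^bsub>Rs ! i\<^esub> ys ! i \<and>
    (xs \<oplus>\<^bsub>RDirProd_list Rs\<^esub> ys) ! i = xs ! i \<oplus>\<^bsub>Rs ! i\<^esub> ys ! i"
  using assms
proof (induction Rs arbitrary: xs ys i)
  case (Cons R Rs)
  note hom = RDirProd_list_hom1[of R Rs]
  obtain a as b bs where e: "xs = a # as" "ys = b # bs" "a \<in> carrier R" "b \<in> carrier R"
    "as \<in> carrier (RDirProd_list Rs)" "bs \<in> carrier (RDirProd_list Rs)"
    using Cons.prems unfolding RDirProd_list_carrier by auto
  have c: "(a, as) \<in> carrier (RDirProd R (RDirProd_list Rs))" "(b, bs) \<in> carrier (RDirProd R (RDirProd_list Rs))"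
    using e by (auto simp: RDirProd_carrier)
  show ?case
    using ring_hom_mult[OF hom c, symmetric] ring_hom_add[OF hom c, symmetric]
      Cons.IH[of "i - 1", OF _ e(5,6)] Cons.prems e(1,2)
    by (cases i) (auto simp: RDirProd_def DirProd_def monoid.defs)
qed auto

lemma RDirProd_list_one_nth: "i < length Rs \<Longrightarrow> \<one>\<^bsub>RDirProd_list Rs\<^esub> ! i = \<one>\<^bsub>Rs ! i\<^esub>"
proof (induction Rs arbitrary: i)
  case (Cons R Rs)
  then show ?case
    using ring_hom_one[OF RDirProd_list_hom1[of R Rs], symmetric] Cons.IH[of "i - 1"]
    by (cases i) (auto simp: RDirProd_def DirProd_def monoid.defs)
qed auto

context q_algebra
begin

text \<open>Mirrors \<open>ring.eval\<close>, the format in which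
  \<open>finite_separable_extension\<close> states its polynomial equations.\<close>

fun hval :: "'q list \<Rightarrow> 'k \<Rightarrow> 'k" where
  "hval [] x = 0"
| "hval (a # p) x = j a * x ^ length p + hval p x"

lemma hval_append: "hval (p @ [a]) x = x * hval p x + j a"
  by (induction p) (auto simp: algebra_simps)

lemma hval_coeffs: "hval (rev (coeffs f)) x = peval f x"
  by (induction f) (auto simp: peval_pCons hval_append)

lemma ring_hom_hval:
  assumes L: "ring L" and \<pi>: "\<pi> \<in> ring_hom ambient L"
  shows "ring.eval L (map (\<lambda>q. \<pi> (j q)) p) (\<pi> x) = \<pi> (hval p x)"
proof -
  interpret L: ring L by fact
  have c: "\<pi> x \<in> carrier L" for x using ring_hom_closed[OF \<pi>, of x] by simp
  have a: "\<pi> (x + y) = \<pi> x \<oplus>\<^bsub>L\<^esub> \<pi> y" "\<pi> (x * y) = \<pi> x \<otimes>\<^bsub>L\<^esub> \<pi> y" "\<pi> 1 = \<one>\<^bsub>L\<^esub>" for x y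
    using ring_hom_add[OF \<pi>, of x y] ring_hom_mult[OF \<pi>, of x y] ring_hom_one[OF \<pi>] by simp_all
  have "\<pi> 0 \<oplus>\<^bsub>L\<^esub> \<pi> 0 = \<pi> 0" using a(1)[of 0 0] by simp
  then have z: "\<pi> 0 = \<zero>\<^bsub>L\<^esub>" using c[of 0] L.add.r_cancel_one' by metis
  have pw: "\<pi> (x ^ n) = \<pi> x [^]\<^bsub>L\<^esub> n" for n
    by (induction n) (auto simp: a c power_Suc2 simp del: power_Suc)
  show ?thesis
    by (induction p) (auto simp: z a pw)
qed

text \<open>Each component of \<open>x\<close> is a root of an irreducible separable polynomial over
  Q. The product of these polynomials, each taken once, is separable and vanishes in all
  components.\<close>

lemma etale_separable:
  assumes "etale_algebra j"
  shows "\<exists>f. bezout f (pderiv f) \<and> peval f x = 0"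
proof -
  obtain Ls :: "'k ring list" and \<sigma>s \<phi> where
    all: "list_all2 finite_separable_extension \<sigma>s Ls" and iso: "\<phi> \<in> ring_iso ambient (RDirProd_list Ls)"
    and comp: "\<And>q. \<phi> (j q) = map (\<lambda>\<sigma>. \<sigma> q) \<sigma>s"
    using assms unfolding etale_algebra_def by blast
  have hom: "\<phi> \<in> ring_hom ambient (RDirProd_list Ls)" and inj: "inj \<phi>"
    using iso unfolding ring_iso_def bij_betw_def by auto
  have carr: "\<phi> y \<in> carrier (RDirProd_list Ls)" for y using ring_hom_closed[OF hom, of y] by simp
  define n where "n = length Ls"
  have len: "length \<sigma>s = n" "length (\<phi> y) = n" for y
    using list_all2_lengthD[OF all] RDirProd_list_carrier_mem(1)[OF carr] by (auto simp: n_def)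
  have fse: "finite_separable_extension (\<sigma>s ! i) (Ls ! i)" if "i < n" for i
    using list_all2_nthD[OF all, of i] that len by simp
  then have ringL: "ring (Ls ! i)" if "i < n" for i
    using that unfolding finite_separable_extension_def by (meson cring.axioms(1) domain.axioms(1) field.axioms(1))
  have \<pi>: "(\<lambda>y. \<phi> y ! i) \<in> ring_hom ambient (Ls ! i)" if i: "i < n" for i
  proof (rule ring_hom_memI)
    have il: "i < length Ls" using i by (simp add: n_def)
    fix y z :: 'k
    show "\<phi> y ! i \<in> carrier (Ls ! i)" using RDirProd_list_carrier_mem(2)[OF carr il] .
    show "\<phi> (y \<otimes>\<^bsub>ambient\<^esub> z) ! i = \<phi> y ! i \<otimes>\<^bsub>Ls ! i\<^esub> \<phi> z ! i"
      using ring_hom_mult[OF hom, of y z] RDirProd_list_nth[OF il carr carr] by simp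
    show "\<phi> (y \<oplus>\<^bsub>ambient\<^esub> z) ! i = \<phi> y ! i \<oplus>\<^bsub>Ls ! i\<^esub> \<phi> z ! i"
      using ring_hom_add[OF hom, of y z] RDirProd_list_nth[OF il carr carr] by simp
    show "\<phi> \<one>\<^bsub>ambient\<^esub> ! i = \<one>\<^bsub>Ls ! i\<^esub>"
      using ring_hom_one[OF hom] RDirProd_list_one_nth[OF il] by simp
  qed
  have "\<exists>g. Factorial_Ring.irreducible g \<and> Polynomial.lead_coeff g = 1 \<and> bezout g (pderiv g) \<and>
    \<phi> (peval g x) ! i = \<zero>\<^bsub>Ls ! i\<^esub>" if i: "i < n" for i
  proof -
    interpret L: ring "Ls ! i" using ringL[OF i] .
    have "\<phi> x ! i \<in> carrier (Ls ! i)" using ring_hom_closed[OF \<pi>[OF i], of x] by simp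
    then obtain f :: "'q poly" where f: "Factorial_Ring.irreducible f" "coprime f (pderiv f)"
      "ring.eval (Ls ! i) (map (\<sigma>s ! i) (rev (coeffs f))) (\<phi> x ! i) = \<zero>\<^bsub>Ls ! i\<^esub>"
      using fse[OF i] unfolding finite_separable_extension_def by blast
    have "(\<lambda>q. \<phi> (j q) ! i) = \<sigma>s ! i" using comp i len by auto
    then have f0: "\<phi> (peval f x) ! i = \<zero>\<^bsub>Ls ! i\<^esub>"
      using f(3) ring_hom_hval[OF ringL[OF i] \<pi>[OF i], of "rev (coeffs f)" x] by (simp add: hval_coeffs)
    \<comment> \<open>Monic normalization makes associated polynomials of different components
      equal, so that the set of all \<open>g i\<close> contains no two associates.\<close>
    define c where "c = inverse (Polynomial.lead_coeff f)"
    have "f \<noteq> 0" using f(1) by auto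
    then have c: "c \<noteq> 0" by (simp add: c_def)
    define g where "g = smult c f"
    have "g = [:c:] * f" by (simp add: g_def)
    moreover have "is_unit [:c:]" using c by (simp add: is_unit_pCons_iff)
    ultimately have "Factorial_Ring.irreducible g" using f(1) irreducible_mult_unit_left by metis
    moreover have "Polynomial.lead_coeff g = 1" using \<open>f \<noteq> 0\<close> by (simp add: g_def c_def)
    moreover have "bezout g (pderiv g)"
    proof -
      obtain u v where uv: "u * f + v * pderiv f = 1" using coprime_imp_bezout[OF f(2)] by (auto simp: bezout_def)
      have "smult (inverse c) u * g + smult (inverse c) v * pderiv g = u * f + v * pderiv f"
        using c by (simp add: g_def pderiv_smult)
      then show ?thesis unfolding bezout_def uv by blast
    qed
    moreover have "\<phi> (peval g x) ! i = \<zero>\<^bsub>Ls ! i\<^esub>"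
      using ring_hom_mult[OF \<pi>[OF i], of "j c" "peval f x"] f0 ring_hom_closed[OF \<pi>[OF i], of "j c"]
      by (simp add: g_def peval_smult)
    ultimately show ?thesis by blast
  qed
  then obtain g where g: "\<And>i. i < n \<Longrightarrow> Factorial_Ring.irreducible (g i) \<and> Polynomial.lead_coeff (g i) = 1 \<and>
    bezout (g i) (pderiv (g i)) \<and> \<phi> (peval (g i) x) ! i = \<zero>\<^bsub>Ls ! i\<^esub>"
    by metis
  define F where "F = \<Prod>(g ` {..<n})"
  have "bezout F (pderiv F)" unfolding F_def using g by (intro bezout_pderiv_prod) auto
  moreover have "peval F x = 0"
  proof -
    have "\<phi> (peval F x) ! i = \<phi> 0 ! i" if i: "i < n" for i
    proof -
      interpret L: ring "Ls ! i" using ringL[OF i] .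
      have "F = g i * \<Prod>(g ` {..<n} - {g i})" unfolding F_def using i by (intro prod.remove) auto
      then have e: "peval F x = peval (g i) x * peval (\<Prod>(g ` {..<n} - {g i})) x" by (simp add: peval_mult)
      have 0: "\<phi> (peval (g i) x * y) ! i = \<zero>\<^bsub>Ls ! i\<^esub>" for y
        using ring_hom_mult[OF \<pi>[OF i], of "peval (g i) x" y] g[OF i] ring_hom_closed[OF \<pi>[OF i], of y] by simp
      show ?thesis using 0[of 0] 0[of "peval (\<Prod>(g ` {..<n} - {g i})) x"] unfolding e by simp
    qed
    then have "\<phi> (peval F x) = \<phi> 0" using len by (intro nth_equalityI) auto
    then show ?thesis using inj by (simp add: inj_eq)
  qed
  ultimately show ?thesis by blast
qed

lemma finite_basis:
  assumes A: "finite A" "vs.span A = UNIV"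
  shows "finite (vs.extend_basis {})" "vs.independent (vs.extend_basis {})" "vs.span (vs.extend_basis {}) = UNIV"
proof -
  show i: "vs.independent (vs.extend_basis {})" and "vs.span (vs.extend_basis {}) = UNIV"
    using vs.independent_extend_basis[OF vs.independent_empty] vs.span_extend_basis[OF vs.independent_empty] by auto
  show "finite (vs.extend_basis {})" using vs.independent_span_bound[OF A(1) i] A(2) by auto
qed

lemma alg_trace_eq:
  "alg_trace j x = (\<Sum>b\<in>vs.extend_basis {}. vs.representation (vs.extend_basis {}) (x * b) b)"
  by (simp add: alg_trace_def Let_def)

lemma qlinear_representation:
  assumes "finite A" "vs.span A = UNIV"
  shows "qlinear (\<lambda>x. vs.representation (vs.extend_basis {}) x b)"
proof -
  note B = finite_basis[OF assms]
  have "vs.representation (vs.extend_basis {}) (j q * x) b = q * vs.representation (vs.extend_basis {}) x b" for q x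
    using fun_cong[OF vs.representation_scale[OF B(2), of x q]] B(3) by (simp add: alg_scale_def)
  then show ?thesis
    unfolding qlinear_def using vs.representation_add[OF B(2)] B(3) by simp
qed

lemma qlinear_trace:
  assumes "finite A" "vs.span A = UNIV"
  shows "qlinear (alg_trace j)"
proof -
  note l = qlinearD[OF qlinear_representation[OF assms]]
  show ?thesis unfolding qlinear_def alg_trace_eq
    by (simp add: distrib_right l sum.distrib sum_distrib_left mult.assoc)
qed

text \<open>
  A separability idempotent \<open>E = \<Sum> a \<otimes> b\<close> yields dual generators for the trace form: writing the
  trace as \<open>\<Sum>\<^sub>k e\<^sub>k\<^sup>*(x e\<^sub>k)\<close>, one may move \<open>x e\<^sub>k\<close> across \<open>E\<close>.
\<close>

lemma trace_dual_generators:
  assumes A: "finite A" "vs.span A = UNIV" and et: "etale_algebra j"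
  shows "\<exists>E. \<forall>x. x = (\<Sum>(a, b)\<leftarrow>E. j (alg_trace j (x * a)) * b)"
proof -
  define B where "B = vs.extend_basis {}"
  note B = finite_basis[OF A, folded B_def]
  note l = qlinear_representation[OF A, folded B_def]
  obtain E where E: "tensor_mult E = 1" "\<forall>\<theta>\<in>A. commuting E \<theta>"
    using finite_commuting[OF A(1) etale_separable[OF et]] by blast
  have comm: "commuting E x" for x using commuting_span[OF E(2)] A(2) by simp
  have "contract E (\<lambda>a. alg_trace j (x * a)) = x" for x
  proof -
    have "contract E (\<lambda>a. alg_trace j (x * a)) = (\<Sum>k\<in>B. contract E (\<lambda>a. vs.representation B ((x * k) * a) k))"
    proof -
      have "contract F (\<lambda>a. \<Sum>k\<in>B. h k a) = (\<Sum>k\<in>B. contract F (h k))" for F h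
        by (induction F) (auto simp: contract_simps j_sum sum.distrib sum_distrib_right)
      then show ?thesis unfolding alg_trace_eq B_def[symmetric] by (simp add: ac_simps)
    qed
    also have "\<dots> = (\<Sum>k\<in>B. x * k * contract E (\<lambda>a. vs.representation B a k))"
      using comm l unfolding commuting_def by (intro sum.cong refl) blast
    also have "\<dots> = x * (\<Sum>k\<in>B. k * contract E (\<lambda>a. vs.representation B a k))"
      by (simp add: sum_distrib_left mult.assoc)
    also have "(\<Sum>k\<in>B. k * contract E (\<lambda>a. vs.representation B a k)) = tensor_mult E"
    proof -
      have rep: "(\<Sum>k\<in>B. j (vs.representation B a k) * k) = a" for a
        using vs.sum_representation_eq[OF B(2) _ B(1) subset_refl, of a] B(3) by (simp add: alg_scale_def)
      show ?thesis
      proof (induction E)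
        case (Cons ab E)
        obtain a b where ab: "ab = (a, b)" by (cases ab)
        have "(\<Sum>k\<in>B. k * (j (vs.representation B a k) * b)) = (\<Sum>k\<in>B. j (vs.representation B a k) * k) * b"
          unfolding sum_distrib_right by (intro sum.cong refl) (simp add: ac_simps)
        then show ?case using Cons unfolding ab rep
          by (simp add: contract_simps tensor_mult_def distrib_left sum.distrib)
      qed (simp add: contract_simps tensor_mult_def)
    qed
    finally show ?thesis using E(1) by simp
  qed
  then show ?thesis unfolding contract_def by metis
qed

end

subsection \<open>Lattices and duality\<close>

lemma submod_ideal_prod:
  assumes "submod R I" "submod R' J"
  shows "submod R (I \<cdot>\<^bsub>ambient\<^esub> J)"
  unfolding submod_def
proof (intro conjI ballI)
  show "0 \<in> I \<cdot>\<^bsub>ambient\<^esub> J"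
    using ideal_prod.prod[of 0 I 0 J ambient] submodD(1)[OF assms(1)] submodD(1)[OF assms(2)] by simp
  show "x + y \<in> I \<cdot>\<^bsub>ambient\<^esub> J" if "x \<in> I \<cdot>\<^bsub>ambient\<^esub> J" "y \<in> I \<cdot>\<^bsub>ambient\<^esub> J" for x y
    using ideal_prod.sum[OF that] by simp
  fix r x assume "r \<in> R" "x \<in> I \<cdot>\<^bsub>ambient\<^esub> J"
  from this(2) show "r * x \<in> I \<cdot>\<^bsub>ambient\<^esub> J"
  proof (induction rule: ideal_prod.induct)
    case (prod i k)
    then show ?case
      using ideal_prod.prod[of "r * i" I k J ambient] submodD(3)[OF assms(1) \<open>r \<in> R\<close>] by (simp add: mult.assoc)
  next
    case (sum s1 s2)
    then show ?case using ideal_prod.sum[of "r * s1" ambient I J "r * s2"] by (simp add: distrib_left)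
  qed
qed

lemma ideal_prod_least:
  assumes "submod R M" "\<And>x y. x \<in> I \<Longrightarrow> y \<in> J \<Longrightarrow> x * y \<in> M"
  shows "I \<cdot>\<^bsub>ambient\<^esub> J \<subseteq> M"
proof
  fix x assume "x \<in> I \<cdot>\<^bsub>ambient\<^esub> J"
  then show "x \<in> M"
    by (induction rule: ideal_prod.induct) (use assms(2) submodD(2)[OF assms(1)] in auto)
qed

lemma ideal_prod_mem: "x \<in> I \<Longrightarrow> y \<in> J \<Longrightarrow> x * y \<in> I \<cdot>\<^bsub>ambient\<^esub> J"
  using ideal_prod.prod[of x I y J ambient] by simp

locale dedekind_algebra = dedekind Z + q_algebra j
  for Z :: "'q::field set" and j :: "'q \<Rightarrow> 'k::comm_ring_1" +
  assumes etale: "etale_algebra j" and finite_dim: "\<exists>A. finite A \<and> vs.span A = UNIV"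
begin

abbreviation "JZ \<equiv> j ` Z"
abbreviation "Tr \<equiv> alg_trace j"
abbreviation "dual \<equiv> trace_dual Z j"

lemma JZ_ring: "is_subring JZ" "noeth JZ"
proof -
  show R: "is_subring JZ" unfolding is_subring_def
    by (auto simp flip: j_simps(2,3,6) intro!: imageI Z_simps)
  show "noeth JZ" unfolding noeth_def
  proof (intro allI impI)
    fix I assume I: "submod JZ I \<and> I \<subseteq> JZ"
    define I' where "I' = {z\<in>Z. j z \<in> I}"
    have "submod Z I'" using I unfolding submod_def I'_def by (auto simp: Z_simps)
    then obtain B where B: "finite B" "I' = genby Z B"
      using Z_ring(2) unfolding noeth_def I'_def fg_submodule_iff by blast
    have "I = j ` I'" using I unfolding I'_def by auto
    also have "\<dots> = genby JZ (j ` B)"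
    proof
      have inj: "inj_on j B" using j_inj by (auto simp: inj_on_def)
      show "j ` I' \<subseteq> genby JZ (j ` B)"
      proof
        fix y assume "y \<in> j ` I'"
        then obtain c where c: "c \<in> B \<rightarrow> Z" "y = j (\<Sum>b\<in>B. c b * b)" unfolding B(2) genby_def by auto
        have "y = (\<Sum>b\<in>B. j (c b) * j b)" unfolding c(2) by (simp add: j_sum)
        also have "\<dots> \<in> genby JZ (j ` B)"
          using c(1) genby_superset[OF R finite_imageI[OF B(1)], of j]
          by (intro submod_sum[OF submod_genby[OF submod_self[OF R]]]
              submodD(3)[OF submod_genby[OF submod_self[OF R]]]) auto
        finally show "y \<in> genby JZ (j ` B)" .
      qed
      show "genby JZ (j ` B) \<subseteq> j ` I'"
        using I genby_superset[OF Z_ring(1) B(1)] \<open>I = j ` I'\<close> B(2) by (intro genby_least) auto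
    qed
    finally show "fg_submodule JZ I" using B(1) unfolding fg_submodule_iff by blast
  qed
qed

lemma j_inverse_cancel: "d \<noteq> 0 \<Longrightarrow> j (inverse d) * (j d * x) = x"
  by (simp add: mult.assoc[symmetric] flip: j_simps(2))

lemma submod_JZ_mult: "submod JZ L \<Longrightarrow> d \<in> Z \<Longrightarrow> x \<in> L \<Longrightarrow> j d * x \<in> L"
  by (simp add: submodD(3))

text \<open>For a \<open>Z\<close>-module this amounts to containing a Q-basis of \<open>K\<close>
  (compare \<open>lattice_in_iff\<close>), in a form that only requires clearing
  denominators.\<close>

definition full :: "'k set \<Rightarrow> bool" where
  "full L \<longleftrightarrow> (\<forall>x. \<exists>d\<in>Z. d \<noteq> 0 \<and> j d * x \<in> L)"

definition lattice :: "'k set \<Rightarrow> bool" where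
  "lattice L \<longleftrightarrow> fg_submodule JZ L \<and> full L"

lemma lattice_in_iff: "lattice_in Z j L \<longleftrightarrow> lattice L"
proof
  assume L: "lattice_in Z j L"
  then obtain B where B: "B \<subseteq> L" "vs.span B = UNIV" by (auto simp: lattice_in_def)
  have fg: "fg_submodule JZ L" using L by (simp add: lattice_in_def)
  note sL = fg_submod[OF JZ_ring(1) fg]
  have "\<exists>d\<in>Z. d \<noteq> 0 \<and> j d * x \<in> L" if "x \<in> vs.span B" for x
    using that
  proof (induction rule: vs.span_induct_alt)
    case base
    then show ?case using Z_simps(1) submodD(1)[OF sL] by (intro bexI[of _ 1]) auto
  next
    case (step q x y)
    then obtain d where d: "d \<in> Z" "d \<noteq> 0" "j d * y \<in> L" by blast
    obtain u v where uv: "u \<in> Z" "v \<in> Z" "v \<noteq> 0" "q = u / v" using fraction[of q] by blast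
    have "j (v * d) * (alg_scale j q x + y) = j (d * (v * q)) * x + j v * (j d * y)"
      by (simp add: alg_scale_def algebra_simps)
    also have "v * q = u" using uv by simp
    also have "j (d * u) * x + j v * (j d * y) \<in> L"
      using submodD(2)[OF sL submod_JZ_mult[OF sL Z_simps(4)[OF d(1) uv(1)]] submod_JZ_mult[OF sL uv(2) d(3)]]
        step.hyps B(1) by blast
    finally show ?case using uv d by (intro bexI[of _ "v * d"]) (auto simp: Z_simps)
  qed
  then show "lattice L" using fg B(2) by (auto simp: lattice_def full_def)
next
  assume L: "lattice L"
  obtain B where B: "B \<subseteq> L" "vs.independent B" "L \<subseteq> vs.span B" by (rule vs.maximal_independent_subset)
  have "x \<in> vs.span B" for x
  proof -
    obtain d where d: "d \<in> Z" "d \<noteq> 0" "j d * x \<in> L" using L by (auto simp: lattice_def full_def)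
    then have "alg_scale j (inverse d) (j d * x) \<in> vs.span B" using B(3) by (intro vs.span_scale) auto
    moreover have "alg_scale j (inverse d) (j d * x) = x"
      using j_inverse_cancel[OF d(2)] by (simp add: alg_scale_def)
    ultimately show ?thesis by simp
  qed
  then show "lattice_in Z j L" using L B unfolding lattice_in_def lattice_def by blast
qed

lemma latticeD:
  assumes "lattice L"
  shows "fg_submodule JZ L" "submod JZ L" "full L" "\<exists>d\<in>Z. d \<noteq> 0 \<and> j d \<in> L"
proof -
  show fg: "fg_submodule JZ L" and f: "full L" using assms by (auto simp: lattice_def)
  show "submod JZ L" using fg_submod[OF JZ_ring(1) fg] .
  show "\<exists>d\<in>Z. d \<noteq> 0 \<and> j d \<in> L" using f unfolding full_def by (metis mult.right_neutral)
qed

lemma lattice_subset: "lattice L \<Longrightarrow> submod JZ M \<Longrightarrow> M \<subseteq> L \<Longrightarrow> full M \<Longrightarrow> lattice M"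
  unfolding lattice_def using noeth_submod_fg'[OF JZ_ring] by blast

lemma full_finite:
  assumes "submod JZ L" "full L" "finite B"
  shows "\<exists>d\<in>Z. d \<noteq> 0 \<and> (\<forall>b\<in>B. j d * b \<in> L)"
  using assms(3)
proof (induction B rule: finite_induct)
  case empty
  then show ?case using Z_simps(1) by (intro bexI[of _ 1]) auto
next
  case (insert b B)
  then obtain d where d: "d \<in> Z" "d \<noteq> 0" "\<forall>b\<in>B. j d * b \<in> L" by blast
  obtain e where e: "e \<in> Z" "e \<noteq> 0" "j e * b \<in> L" using assms(2) by (auto simp: full_def)
  have "j (d * e) * b \<in> L" using submodD(3)[OF assms(1), of "j d" "j e * b"] d e by (simp add: mult.assoc)
  moreover have "j (d * e) * x \<in> L" if "x \<in> B" for x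
    using submodD(3)[OF assms(1), of "j e" "j d * x"] d e that by (simp add: ac_simps)
  ultimately show ?case using d e by (intro bexI[of _ "d * e"]) (auto simp: Z_simps)
qed

lemma full_lattice:
  assumes "submod JZ L" "full L" "lattice M"
  shows "\<exists>d\<in>Z. d \<noteq> 0 \<and> (\<forall>x\<in>M. j d * x \<in> L)"
proof -
  obtain B where B: "finite B" "M = genby JZ B" using latticeD(1)[OF assms(3)] by (auto simp: fg_submodule_iff)
  obtain d where d: "d \<in> Z" "d \<noteq> 0" "\<forall>b\<in>B. j d * b \<in> L" using full_finite[OF assms(1,2) B(1)] by blast
  have "submod JZ {x. j d * x \<in> L}" using assms(1) unfolding submod_def
    by (auto simp: distrib_left) (metis imageI mult.left_commute)
  then have "M \<subseteq> {x. j d * x \<in> L}" unfolding B(2) using d(3) by (intro genby_least) auto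
  then show ?thesis using d by blast
qed

lemma full_mono: "full M \<Longrightarrow> M \<subseteq> L \<Longrightarrow> full L"
  unfolding full_def by blast

lemma full_contains:
  assumes "full M" "d \<in> Z" "d \<noteq> 0" "\<And>x. x \<in> M \<Longrightarrow> j d * x \<in> L"
  shows "full L"
  unfolding full_def
proof
  fix x
  obtain e where e: "e \<in> Z" "e \<noteq> 0" "j e * x \<in> M" using assms(1) by (auto simp: full_def)
  then have "j (d * e) * x \<in> L" using assms(4)[OF e(3)] by (simp add: mult.assoc)
  then show "\<exists>d\<in>Z. d \<noteq> 0 \<and> j d * x \<in> L" using e assms(2,3) by (intro bexI[of _ "d * e"]) (auto simp: Z_simps)
qed

lemma lattice_scale:
  assumes "lattice L" "d \<noteq> 0"
  shows "lattice ((*) (j d) ` L)"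
  unfolding lattice_def
proof
  show "fg_submodule JZ ((*) (j d) ` L)" using fg_submodule_scale[OF JZ_ring(1) latticeD(1)[OF assms(1)]] .
  show "full ((*) (j d) ` L)" unfolding full_def
  proof
    fix x
    obtain e where e: "e \<in> Z" "e \<noteq> 0" "j e * (j (inverse d) * x) \<in> L"
      using latticeD(3)[OF assms(1)] unfolding full_def by blast
    have "j d * (j e * (j (inverse d) * x)) = (j d * j (inverse d)) * (j e * x)" by (simp only: ac_simps)
    then have "j e * x = j d * (j e * (j (inverse d) * x))" using j_inverse[OF assms(2)] by simp
    then show "\<exists>d'\<in>Z. d' \<noteq> 0 \<and> j d' * x \<in> (*) (j d) ` L" using e by blast
  qed
qed

text \<open>\<open>M\<close> lies in \<open>L\<close> scaled by the inverse of \<open>d\<close>;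
  finite generation is inherited because \<open>Z\<close> is noetherian.\<close>

lemma lattice_below_scaled:
  assumes "lattice L" "submod JZ M" "full M" "d \<noteq> 0" "\<And>x. x \<in> M \<Longrightarrow> j d * x \<in> L"
  shows "lattice M"
proof (rule lattice_subset[OF lattice_scale[OF assms(1)] assms(2) _ assms(3)])
  show "inverse d \<noteq> 0" using assms(4) by simp
  show "M \<subseteq> (*) (j (inverse d)) ` L"
  proof
    fix x assume "x \<in> M"
    have "x = j (inverse d) * (j d * x)" using j_inverse_cancel[OF assms(4)] by simp
    then show "x \<in> (*) (j (inverse d)) ` L" using assms(5)[OF \<open>x \<in> M\<close>] by (rule image_eqI)
  qed
qed

lemma submod_colon: "submod R I \<Longrightarrow> submod R (colon I J)"
  unfolding submod_def colon_def by (auto simp: distrib_right mult.assoc)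

text \<open>Finite generation: a nonzero scalar \<open>j c\<close> in \<open>J\<close> multiplies
  the colon into \<open>I\<close>. Fullness: denominators are needed only for products with the
  finitely many generators of \<open>J\<close>.\<close>

lemma lattice_colon:
  assumes "lattice I" "lattice J"
  shows "lattice (colon I J)"
proof -
  obtain c where c: "c \<in> Z" "c \<noteq> 0" "j c \<in> J" using latticeD(4)[OF assms(2)] by blast
  obtain d where d: "d \<in> Z" "d \<noteq> 0" "\<forall>x\<in>J. j d * x \<in> I"
    using full_lattice[OF latticeD(2,3)[OF assms(1)] assms(2)] by blast
  have sub: "submod JZ (colon I J)" by (rule submod_colon[OF latticeD(2)[OF assms(1)]])
  have "full (colon I J)" unfolding full_def
  proof
    fix x
    obtain B where B: "finite B" "J = genby JZ B" using latticeD(1)[OF assms(2)] by (auto simp: fg_submodule_iff)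
    obtain e where e: "e \<in> Z" "e \<noteq> 0" "\<forall>b\<in>(*) x ` B. j e * b \<in> I"
      using full_finite[OF latticeD(2,3)[OF assms(1)] finite_imageI[OF B(1)]] by blast
    have "submod JZ {y. j e * x * y \<in> I}" using latticeD(2)[OF assms(1)] unfolding submod_def
      by (auto simp: distrib_left) (metis imageI mult.left_commute)
    then have "J \<subseteq> {y. j e * x * y \<in> I}" unfolding B(2) using e(3)
      by (intro genby_least) (auto simp: mult.assoc)
    then show "\<exists>d\<in>Z. d \<noteq> 0 \<and> j d * x \<in> colon I J" using e unfolding colon_def by blast
  qed
  moreover have "j c * x \<in> I" if "x \<in> colon I J" for x
    using that c(3) by (auto simp: colon_def mult.commute)
  ultimately show ?thesis using lattice_below_scaled[OF assms(1) sub _ c(2)] by blast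
qed

text \<open>The product is closed additively, without given generators. Finite generation comes from
  a common denominator \<open>e\<close> with which all generators of \<open>I\<close>, hence all of
  \<open>I\<close>, map \<open>J\<close> into \<open>J\<close>.\<close>

lemma lattice_ideal_prod:
  assumes "lattice I" "lattice J"
  shows "lattice (I \<cdot>\<^bsub>ambient\<^esub> J)"
proof -
  obtain c where c: "c \<in> Z" "c \<noteq> 0" "j c \<in> J" using latticeD(4)[OF assms(2)] by blast
  have sub: "submod JZ (I \<cdot>\<^bsub>ambient\<^esub> J)"
    using submod_ideal_prod latticeD(2) assms by blast
  have full: "full (I \<cdot>\<^bsub>ambient\<^esub> J)"
    using ideal_prod_mem[OF _ c(3), of _ I]
    by (intro full_contains[OF latticeD(3)[OF assms(1)] c(1,2)]) (simp add: mult.commute)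
  obtain B where B: "finite B" "I = genby JZ B" using latticeD(1)[OF assms(1)] by (auto simp: fg_submodule_iff)
  have "\<exists>e\<in>Z. e \<noteq> 0 \<and> (\<forall>b\<in>B. \<forall>y\<in>J. j e * (b * y) \<in> J)"
    using B(1)
  proof (induction B rule: finite_induct)
    case empty
    then show ?case using Z_simps(1) by (intro bexI[of _ 1]) auto
  next
    case (insert b B)
    then obtain e where e: "e \<in> Z" "e \<noteq> 0" "\<forall>b\<in>B. \<forall>y\<in>J. j e * (b * y) \<in> J" by blast
    obtain d where d: "d \<in> Z" "d \<noteq> 0" "j d * b \<in> colon J J"
      using latticeD(3)[OF lattice_colon[OF assms(2,2)]] by (auto simp: full_def)
    have "j (d * e) * (x * y) \<in> J" if "x \<in> insert b B" "y \<in> J" for x y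
    proof (cases "x = b")
      case True
      have "j e * ((j d * b) * y) \<in> J" using d(3) that(2)
        by (intro submod_JZ_mult[OF latticeD(2)[OF assms(2)] e(1)]) (auto simp: colon_def)
      then show ?thesis by (simp add: True ac_simps)
    next
      case False
      then have "j d * (j e * (x * y)) \<in> J"
        using that e(3) by (intro submod_JZ_mult[OF latticeD(2)[OF assms(2)] d(1)]) auto
      then show ?thesis by (simp add: mult.assoc)
    qed
    then show ?case using d e by (intro bexI[of _ "d * e"]) (auto simp: Z_simps)
  qed
  then obtain e where e: "e \<in> Z" "e \<noteq> 0" "\<forall>b\<in>B. \<forall>y\<in>J. j e * (b * y) \<in> J" by blast
  have s1: "submod JZ {x. \<forall>y\<in>J. j e * (x * y) \<in> J}"
    using latticeD(2)[OF assms(2)] unfolding submod_def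
    by (auto simp: distrib_left distrib_right mult.assoc) (metis imageI mult.left_commute)
  have "I \<subseteq> {x. \<forall>y\<in>J. j e * (x * y) \<in> J}" unfolding B(2) using e(3) by (intro genby_least[OF s1]) auto
  then have "I \<cdot>\<^bsub>ambient\<^esub> J \<subseteq> {x. j e * x \<in> J}"
    using latticeD(2)[OF assms(2)] unfolding submod_def
    by (intro ideal_prod_least[of JZ]) (auto simp: submod_def distrib_left, metis imageI mult.left_commute)
  then show ?thesis using lattice_below_scaled[OF assms(2) sub full e(2)] by blast
qed

section \<open>Duality for the trace form\<close>

lemma trace_lin: "qlinear Tr"
  using finite_dim qlinear_trace by blast

lemmas trace_simps = qlinearD[OF trace_lin]

lemma trace_in_Z_submod: "submod JZ {x. Tr (c * x) \<in> Z}"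
  unfolding submod_def
  by (auto simp: trace_simps distrib_left mult.left_commute[of c] Z_simps)

text \<open>An element is reconstructed from its traces by the expansion in
  \<open>trace_dual_generators\<close>.\<close>

lemma trace_nondegenerate: "(\<And>y. Tr (x * y) = Tr (z * y)) \<Longrightarrow> x = z"
proof -
  assume eq: "\<And>y. Tr (x * y) = Tr (z * y)"
  obtain A where A: "finite A" "vs.span A = UNIV" using finite_dim by blast
  obtain E where E: "\<forall>x. x = (\<Sum>(a, b)\<leftarrow>E. j (Tr (x * a)) * b)"
    using trace_dual_generators[OF A etale] by blast
  show "x = z" using E[rule_format, of x] E[rule_format, of z] unfolding eq by simp
qed

text \<open>Applying \<phi> to the expansion of \<open>x\<close> in dual generators gives the
  solution explicitly: \<open>c\<close> is the sum of the \<open>j (\<phi> b) * a\<close>.\<close>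

lemma functional_is_trace:
  assumes "qlinear \<phi>"
  shows "\<exists>c. \<forall>x. \<phi> x = Tr (c * x)"
proof -
  obtain A where A: "finite A" "vs.span A = UNIV" using finite_dim by blast
  obtain E where E: "\<forall>x. x = (\<Sum>(a, b)\<leftarrow>E. j (Tr (x * a)) * b)"
    using trace_dual_generators[OF A etale] by blast
  have "\<phi> (\<Sum>(a, b)\<leftarrow>F. j (Tr (x * a)) * b) = Tr ((\<Sum>(a, b)\<leftarrow>F. j (\<phi> b) * a) * x)" for F x
    by (induction F) (auto simp: qlinearD(1-3)[OF assms] trace_simps(1-3) distrib_right mult.assoc mult.commute[of x])
  then show ?thesis using E by metis
qed

text \<open>Lattices over \<open>Z\<close> are projective, expressed by a dual basis of coordinate
  functionals. Induction on a finite set \<open>C\<close> of functionals that separates 0 from the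
  rest of \<open>M\<close>: the image of \<open>M\<close> under \<phi> is zero or an invertible
  fractional ideal; invertibility splits the map of \<open>M\<close> onto it, and the kernel needs
  one functional fewer.\<close>

lemma functional_dual_basis:
  assumes "finite C" "\<And>\<phi>. \<phi> \<in> C \<Longrightarrow> qlinear \<phi>" "fg_submodule JZ M"
    "\<And>x. x \<in> M \<Longrightarrow> (\<forall>\<phi>\<in>C. \<phi> x = 0) \<Longrightarrow> x = 0"
  shows "\<exists>xs. (\<forall>(\<psi>, l)\<in>set xs. qlinear \<psi> \<and> l \<in> M \<and> \<psi> ` M \<subseteq> Z) \<and>
    (\<forall>x\<in>M. x = (\<Sum>(\<psi>, l)\<leftarrow>xs. j (\<psi> x) * l))"
  using assms
proof (induction C arbitrary: M rule: finite_induct)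
  case empty
  then have "\<forall>x\<in>M. x = 0" by auto
  then show ?case by (intro exI[of _ "[]"]) simp
next
  case (insert \<phi> C)
  have phi: "qlinear \<phi>" using insert.prems by simp
  note l = qlinearD[OF phi]
  note sM = fg_submod[OF JZ_ring(1) insert.prems(2)]
  show ?case
  proof (cases "\<phi> ` M = {0}")
    case True
    then have "\<forall>\<psi>\<in>insert \<phi> C. \<psi> x = 0" if "x \<in> M" "\<forall>\<psi>\<in>C. \<psi> x = 0" for x using that by auto
    then show ?thesis using insert.IH[OF _ insert.prems(2)] insert.prems(1,3) by auto
  next
    case False
    obtain B where B: "finite B" "M = genby JZ B" using insert.prems(2) by (auto simp: fg_submodule_iff)
    have "\<phi> ` M = genby Z (\<phi> ` B)"
    proof
      have BM: "B \<subseteq> M" using genby_superset[OF JZ_ring(1) B(1)] B(2) by simp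
      have sI: "submod Z (\<phi> ` M)" unfolding submod_def
      proof (intro conjI ballI)
        show "0 \<in> \<phi> ` M" using submodD(1)[OF sM] l(3) by (metis imageI)
        show "x + y \<in> \<phi> ` M" if "x \<in> \<phi> ` M" "y \<in> \<phi> ` M" for x y
          using that submodD(2)[OF sM] by (auto simp flip: l(1))
        show "r * x \<in> \<phi> ` M" if "r \<in> Z" "x \<in> \<phi> ` M" for r x
          using that submodD(3)[OF sM] by (auto simp flip: l(2))
      qed
      show "genby Z (\<phi> ` B) \<subseteq> \<phi> ` M" using BM by (intro genby_least sI) auto
      have "submod JZ {x. \<phi> x \<in> genby Z (\<phi> ` B)}"
        using submod_genby[OF submod_self[OF Z_ring(1)], of "\<phi> ` B"] unfolding submod_def by (auto simp: l)
      then have "M \<subseteq> {x. \<phi> x \<in> genby Z (\<phi> ` B)}"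
        unfolding B(2) using genby_superset[OF Z_ring(1) finite_imageI[OF B(1)], of \<phi>] by (intro genby_least) auto
      then show "\<phi> ` M \<subseteq> genby Z (\<phi> ` B)" by auto
    qed
    then have "fg_submodule Z (\<phi> ` M)" using B(1) unfolding fg_submodule_iff by blast
    then obtain cds where cds: "\<And>c d. (c, d) \<in> set cds \<Longrightarrow> c \<in> \<phi> ` M \<and> (\<forall>x\<in>\<phi> ` M. d * x \<in> Z)"
      "(\<Sum>(c, d)\<leftarrow>cds. c * d) = 1" using frac_ideal_invertible[OF _ False] by blast
    define lift where "lift c = (SOME m. m \<in> M \<and> \<phi> m = c)" for c
    have lift: "lift c \<in> M \<and> \<phi> (lift c) = c" if "c \<in> \<phi> ` M" for c
      unfolding lift_def using that by (intro someI_ex[of "\<lambda>m. m \<in> M \<and> \<phi> m = c"]) auto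
    \<comment> \<open>The splitting. \<open>cds\<close> writes 1 as a sum of products of
      \<open>c\<close> in the image with \<open>d\<close> in its inverse, so
      \<open>\<phi> (pr x) = \<phi> x\<close> and \<open>x - pr x\<close> lies in the
      kernel.\<close>
    define pr where "pr x = (\<Sum>(c, d)\<leftarrow>cds. j (d * \<phi> x) * lift c)" for x
    have pr_add: "pr (x + y) = pr x + pr y" for x y
      unfolding pr_def by (induction cds) (auto simp: l algebra_simps)
    have pr_scale: "pr (j q * x) = j q * pr x" for q x
      unfolding pr_def by (induction cds) (auto simp: l algebra_simps)
    have pr_mem: "pr x \<in> M" if "x \<in> M" for x
      unfolding pr_def using cds(1)
    proof (induction cds)
      case (Cons cd cds)
      obtain c d where cd: "cd = (c, d)" by (cases cd)
      have "j (d * \<phi> x) * lift c \<in> M"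
        using Cons.prems[of c d] cd that lift by (intro submodD(3)[OF sM]) (auto simp del: j_simps(2))
      moreover have "(\<Sum>(c, d)\<leftarrow>cds. j (d * \<phi> x) * lift c) \<in> M"
        using Cons.prems by (intro Cons.IH) auto
      ultimately show ?case using submodD(2)[OF sM] by (auto simp: cd simp del: j_simps(2))
    qed (simp add: submodD(1)[OF sM])
    have "\<phi> (pr x) = (\<Sum>(c, d)\<leftarrow>cds. c * d) * \<phi> x" for x
      unfolding pr_def using cds(1)
    proof (induction cds)
      case (Cons cd cds)
      obtain c d where cd: "cd = (c, d)" by (cases cd)
      have "\<phi> (lift c) = c" using Cons.prems[of c d] cd lift by auto
      then have "\<phi> (j (d * \<phi> x) * lift c) = c * d * \<phi> x" unfolding l(2) by (simp add: ac_simps)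
      then show ?case using Cons by (auto simp: cd l(1) distrib_right simp del: j_simps(2))
    qed (simp add: l(3))
    then have pr_phi: "\<phi> (pr x) = \<phi> x" for x using cds(2) by simp
    define M' where "M' = {x\<in>M. \<phi> x = 0}"
    have "submod JZ M'" using sM unfolding submod_def M'_def by (auto simp: l)
    then have M': "fg_submodule JZ M'" using noeth_submod_fg'[OF JZ_ring insert.prems(2)] by (auto simp: M'_def)
    have "x = 0" if "x \<in> M'" "\<forall>\<psi>\<in>C. \<psi> x = 0" for x
      using that insert.prems(3)[of x] by (auto simp: M'_def)
    then have "\<exists>xs. (\<forall>(\<psi>, l)\<in>set xs. qlinear \<psi> \<and> l \<in> M' \<and> \<psi> ` M' \<subseteq> Z) \<and>
      (\<forall>x\<in>M'. x = (\<Sum>(\<psi>, l)\<leftarrow>xs. j (\<psi> x) * l))"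
      using insert.prems(1) by (intro insert.IH[OF _ M']) auto
    then obtain xs where xs: "\<And>\<psi> l. (\<psi>, l) \<in> set xs \<Longrightarrow> qlinear \<psi> \<and> l \<in> M' \<and> \<psi> ` M' \<subseteq> Z"
      "\<forall>x\<in>M'. x = (\<Sum>(\<psi>, l)\<leftarrow>xs. j (\<psi> x) * l)"
      by blast
    have xM': "x - pr x \<in> M'" if "x \<in> M" for x
      using submod_diff[OF JZ_ring(1) sM that pr_mem[OF that]] pr_phi by (simp add: M'_def l)
    \<comment> \<open>Coordinates of \<open>pr x\<close>, followed by those of
      \<open>x - pr x\<close> in the kernel.\<close>
    define ys where "ys = map (\<lambda>(c, d). (\<lambda>x. d * \<phi> x, lift c)) cds @ map (\<lambda>(\<psi>, l). (\<lambda>x. \<psi> (x - pr x), l)) xs"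
    have "qlinear \<psi> \<and> l \<in> M \<and> \<psi> ` M \<subseteq> Z" if "(\<psi>, l) \<in> set ys" for \<psi> l
    proof -
      from that consider c d where "(c, d) \<in> set cds" "\<psi> = (\<lambda>x. d * \<phi> x)" "l = lift c"
        | \<psi>' where "(\<psi>', l) \<in> set xs" "\<psi> = (\<lambda>x. \<psi>' (x - pr x))"
        unfolding ys_def by auto
      then show ?thesis
      proof cases
        case 1
        then show ?thesis using cds(1)[OF 1(1)] lift phi by (auto simp: qlinear_def algebra_simps)
      next
        case 2
        have q: "qlinear \<psi>'" using xs(1)[OF 2(1)] by simp
        have "qlinear \<psi>" unfolding qlinear_def 2(2)
        proof (intro conjI allI)
          fix x y
          have e: "x + y - pr (x + y) = (x - pr x) + (y - pr y)" by (simp add: pr_add)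
          show "\<psi>' (x + y - pr (x + y)) = \<psi>' (x - pr x) + \<psi>' (y - pr y)"
            unfolding e by (rule qlinearD(1)[OF q])
          have e: "j q * x - pr (j q * x) = j q * (x - pr x)" for q by (simp add: pr_scale right_diff_distrib)
          show "\<psi>' (j q * x - pr (j q * x)) = q * \<psi>' (x - pr x)" for q
            unfolding e by (rule qlinearD(2)[OF q])
        qed
        then show ?thesis using xs(1)[OF 2(1)] xM' 2(2) by (auto simp: M'_def)
      qed
    qed
    moreover have "x = (\<Sum>(\<psi>, l)\<leftarrow>ys. j (\<psi> x) * l)" if "x \<in> M" for x
    proof -
      have "(\<Sum>(\<psi>, l)\<leftarrow>ys. j (\<psi> x) * l) = pr x + (\<Sum>(\<psi>, l)\<leftarrow>xs. j (\<psi> (x - pr x)) * l)"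
        unfolding ys_def pr_def by (simp add: o_def case_prod_unfold)
      also have "\<dots> = pr x + (x - pr x)" using xs(2) xM'[OF that] by auto
      finally show ?thesis by simp
    qed
    ultimately show ?thesis by (intro exI[of _ ys]) auto
  qed
qed

text \<open>The coordinate functionals of a dual basis are traces against elements of the dual
  lattice. The expansion extends from \<open>L\<close> to \<open>K\<close> by clearing a
  denominator.\<close>

lemma lattice_dual_basis:
  assumes L: "lattice L"
  shows "\<exists>xs. (\<forall>(c, l)\<in>set xs. c \<in> dual L \<and> l \<in> L) \<and> (\<forall>x. x = (\<Sum>(c, l)\<leftarrow>xs. j (Tr (c * x)) * l))"
proof -
  obtain A where A: "finite A" "vs.span A = UNIV" using finite_dim by blast
  define B where "B = vs.extend_basis {}"
  note B = finite_basis[OF A, folded B_def]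
  have lin: "qlinear (\<lambda>x. vs.representation B x b)" for b
    using qlinear_representation[OF A] unfolding B_def .
  have "x = 0" if "\<forall>\<phi>\<in>(\<lambda>b x. vs.representation B x b) ` B. \<phi> x = 0" for x
  proof -
    have "x = (\<Sum>b\<in>B. alg_scale j (vs.representation B x b) b)"
      using vs.sum_representation_eq[OF B(2) _ B(1) subset_refl, of x] B(3) by simp
    also have "\<dots> = 0" using that by (intro sum.neutral) (auto simp: alg_scale_def)
    finally show ?thesis .
  qed
  then have "\<exists>xs. (\<forall>(\<psi>, l)\<in>set xs. qlinear \<psi> \<and> l \<in> L \<and> \<psi> ` L \<subseteq> Z) \<and>
    (\<forall>x\<in>L. x = (\<Sum>(\<psi>, l)\<leftarrow>xs. j (\<psi> x) * l))"
    using B(1) lin latticeD(1)[OF L]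
    by (intro functional_dual_basis[of "(\<lambda>b x. vs.representation B x b) ` B"]) auto
  then obtain xs where xs: "\<And>\<psi> l. (\<psi>, l) \<in> set xs \<Longrightarrow> qlinear \<psi> \<and> l \<in> L \<and> \<psi> ` L \<subseteq> Z"
    "\<And>x. x \<in> L \<Longrightarrow> x = (\<Sum>(\<psi>, l)\<leftarrow>xs. j (\<psi> x) * l)"
    by blast
  define g where "g \<psi> = (SOME c. \<forall>x. \<psi> x = Tr (c * x))" for \<psi>
  have g: "Tr (g \<psi> * x) = \<psi> x" if "qlinear \<psi>" for \<psi> x
  proof -
    have "\<forall>x. \<psi> x = Tr (g \<psi> * x)" unfolding g_def by (rule someI_ex[OF functional_is_trace[OF that]])
    then have "\<psi> x = Tr (g \<psi> * x)" by blast
    then show ?thesis by (rule sym)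
  qed
  define ys where "ys = map (\<lambda>(\<psi>, l). (g \<psi>, l)) xs"
  have sum: "(\<Sum>(c, l)\<leftarrow>ys. j (Tr (c * x)) * l) = (\<Sum>(\<psi>, l)\<leftarrow>xs. j (\<psi> x) * l)" for x
  proof -
    have "(\<Sum>(c, l)\<leftarrow>map (\<lambda>(\<psi>, l). (g \<psi>, l)) zs. j (Tr (c * x)) * l) = (\<Sum>(\<psi>, l)\<leftarrow>zs. j (\<psi> x) * l)"
      if "\<forall>(\<psi>, l)\<in>set zs. qlinear \<psi>" for zs :: "(('k \<Rightarrow> 'q) \<times> 'k) list"
      using that by (induction zs) (auto simp: g)
    then show ?thesis using xs(1) unfolding ys_def by blast
  qed
  have "c \<in> dual L \<and> l \<in> L" if cl: "(c, l) \<in> set ys" for c l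
  proof -
    obtain \<psi> where "(\<psi>, l) \<in> set xs" "c = g \<psi>" using cl unfolding ys_def by auto
    moreover from this have "qlinear \<psi>" "l \<in> L" "\<psi> ` L \<subseteq> Z" using xs(1) by blast+
    ultimately show ?thesis using g by (auto simp: trace_dual_def)
  qed
  moreover have "x = (\<Sum>(c, l)\<leftarrow>ys. j (Tr (c * x)) * l)" for x
  proof -
    obtain d where d: "d \<in> Z" "d \<noteq> 0" "j d * x \<in> L" using latticeD(3)[OF L] by (auto simp: full_def)
    have "j d * x = (\<Sum>(c, l)\<leftarrow>ys. j (Tr (c * (j d * x))) * l)" using xs(2)[OF d(3)] sum by simp
    also have "\<dots> = j d * (\<Sum>(c, l)\<leftarrow>ys. j (Tr (c * x)) * l)"
      by (induction ys) (auto simp: mult.left_commute[of _ "j d"] trace_simps distrib_left mult.assoc)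
    finally show ?thesis using j_cancel[OF d(2)] by blast
  qed
  ultimately show ?thesis by (intro exI[of _ ys]) blast
qed

lemma submod_dual: "submod JZ (dual L)"
  unfolding submod_def trace_dual_def
  by (auto simp: trace_simps distrib_right mult.assoc Z_simps)

text \<open>For \<open>x\<close> in the double dual all coefficients \<open>Tr (c * x)\<close> of
  its expansion lie in \<open>Z\<close>.\<close>

lemma dual_dual:
  assumes L: "lattice L"
  shows "dual (dual L) = L"
proof
  show "L \<subseteq> dual (dual L)" by (auto simp: trace_dual_def mult.commute)
  obtain xs where xs: "\<And>c l. (c, l) \<in> set xs \<Longrightarrow> c \<in> dual L \<and> l \<in> L"
    "\<And>x. x = (\<Sum>(c, l)\<leftarrow>xs. j (Tr (c * x)) * l)" using lattice_dual_basis[OF L] by blast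
  show "dual (dual L) \<subseteq> L"
  proof
    fix x assume x: "x \<in> dual (dual L)"
    have "(\<Sum>(c, l)\<leftarrow>xs. j (Tr (c * x)) * l) \<in> L" using xs(1)
    proof (induction xs)
      case (Cons cl xs)
      obtain c l where cl: "cl = (c, l)" by (cases cl)
      have "j (Tr (c * x)) * l \<in> L"
        using Cons.prems[of c l] x by (intro submodD(3)[OF latticeD(2)[OF L]]) (auto simp: cl trace_dual_def mult.commute)
      then show ?case using Cons submodD(2)[OF latticeD(2)[OF L]] by (auto simp: cl)
    qed (simp add: submodD(1)[OF latticeD(2)[OF L]])
    then show "x \<in> L" using xs(2)[of x] by simp
  qed
qed

lemma lattice_dual:
  assumes L: "lattice L"
  shows "lattice (dual L)"
proof -
  obtain xs where xs: "\<And>c l. (c, l) \<in> set xs \<Longrightarrow> c \<in> dual L \<and> l \<in> L"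
    "\<And>x. x = (\<Sum>(c, l)\<leftarrow>xs. j (Tr (c * x)) * l)" using lattice_dual_basis[OF L] by blast
  have "dual L = genby JZ (fst ` set xs)"
  proof
    show "genby JZ (fst ` set xs) \<subseteq> dual L" using xs(1) by (intro genby_least submod_dual) auto
    note G = submod_genby[OF submod_self[OF JZ_ring(1)], of "fst ` set xs"]
    show "dual L \<subseteq> genby JZ (fst ` set xs)"
    proof
      fix z assume z: "z \<in> dual L"
      \<comment> \<open>The expansion in the dual basis, transposed with respect to the trace form;
        it shows that the first components generate the dual.\<close>
      have "z = (\<Sum>(c, l)\<leftarrow>xs. j (Tr (l * z)) * c)"
      proof (rule trace_nondegenerate)
        fix x
        have "Tr (z * (\<Sum>(c, l)\<leftarrow>ys. j (Tr (c * x)) * l)) = Tr ((\<Sum>(c, l)\<leftarrow>ys. j (Tr (l * z)) * c) * x)" for ys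
          by (induction ys) (auto simp: trace_simps distrib_left distrib_right mult.assoc
              mult.left_commute[of z "j _"] mult.commute[of z])
        from this[of xs] show "Tr (z * x) = Tr ((\<Sum>(c, l)\<leftarrow>xs. j (Tr (l * z)) * c) * x)"
          using xs(2)[of x] by simp
      qed
      moreover have "(\<Sum>(c, l)\<leftarrow>ys. j (Tr (l * z)) * c) \<in> genby JZ (fst ` set xs)" if "set ys \<subseteq> set xs" for ys
        using that
      proof (induction ys)
        case (Cons cl ys)
        obtain c l where cl: "cl = (c, l)" by (cases cl)
        have "l \<in> L" "c \<in> fst ` set xs" using Cons.prems xs(1)[of c l] by (force simp: cl)+
        then have "j (Tr (l * z)) * c \<in> genby JZ (fst ` set xs)"
          using z genby_superset[OF JZ_ring(1), of "fst ` set xs"]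
          by (intro submodD(3)[OF G]) (auto simp: trace_dual_def mult.commute)
        then show ?case using Cons submodD(2)[OF G] by (auto simp: cl)
      qed (simp add: submodD(1)[OF G])
      ultimately show "z \<in> genby JZ (fst ` set xs)" by (metis subset_refl)
    qed
  qed
  then have "fg_submodule JZ (dual L)" unfolding fg_submodule_iff by blast
  moreover have "full (dual L)" unfolding full_def
  proof
    fix x
    obtain B where B: "finite B" "L = genby JZ B" using latticeD(1)[OF L] by (auto simp: fg_submodule_iff)
    obtain e where e: "e \<in> Z" "e \<noteq> 0" "\<forall>t\<in>(\<lambda>b. Tr (x * b)) ` B. e * t \<in> Z"
      using common_denominator[OF finite_imageI[OF B(1)]] by blast
    have "L \<subseteq> {y. Tr (j e * x * y) \<in> Z}"
      unfolding B(2) using e(3) by (intro genby_least trace_in_Z_submod) (auto simp: mult.assoc trace_simps)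
    then show "\<exists>d\<in>Z. d \<noteq> 0 \<and> j d * x \<in> dual L" using e unfolding trace_dual_def by blast
  qed
  ultimately show ?thesis by (simp add: lattice_def)
qed

text \<open>Both sides consist of the \<open>x\<close> with \<open>Tr (x * z * y) \<in> Z\<close>
  for all \<open>z\<close> in \<open>I\<close> and \<open>y\<close> in the dual of \<open>J\<close>:
  this puts \<open>x * z\<close> into the double dual of \<open>J\<close>.\<close>

lemma colon_dual:
  assumes "lattice J"
  shows "colon (dual I) (dual J) = colon J I"
proof -
  have "x \<in> colon (dual I) (dual J) \<longleftrightarrow> (\<forall>z\<in>I. x * z \<in> dual (dual J))" for x
  proof -
    have "x * y \<in> dual I \<longleftrightarrow> (\<forall>z\<in>I. Tr (x * z * y) \<in> Z)" for y
      by (simp add: trace_dual_def mult.assoc mult.commute[of y])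
    then show ?thesis unfolding colon_def trace_dual_def[of Z j "dual J"] by blast
  qed
  then show ?thesis unfolding dual_dual[OF assms] by (auto simp: colon_def)
qed

lemma submod_dual':
  assumes "submod T L"
  shows "submod T (dual L)"
  unfolding submod_def
proof (intro conjI ballI)
  fix r x assume "r \<in> T" "x \<in> dual L"
  have e: "r * x * y = x * (r * y)" for y by (simp add: ac_simps)
  show "r * x \<in> dual L"
    using submodD(3)[OF assms \<open>r \<in> T\<close>] \<open>x \<in> dual L\<close> unfolding trace_dual_def mem_Collect_eq e by blast
qed (use submod_dual[of L] in \<open>auto simp: submod_def\<close>)

lemma colon_dual_self:
  assumes "submod T I" "1 \<in> T"
  shows "colon (dual T) I = dual I"
proof
  show "colon (dual T) I \<subseteq> dual I"
    using assms(2) by (fastforce simp: colon_def trace_dual_def)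
  show "dual I \<subseteq> colon (dual T) I"
    using submodD(4)[OF assms(1)] by (auto simp: colon_def trace_dual_def mult.assoc)
qed

text \<open>The dual of I I^t consists of the \<open>x\<close> that map \<open>I\<close> into its
  double dual \<open>I\<close>, so it is \<open>T\<close>; dualizing again gives I I^t = T^t. With
  \<open>U\<close> the result can be applied to any module suspected to contain all
  products.\<close>

lemma dual_subset_products:
  assumes I: "lattice I" "multiplicator_ring I = T"
    and U: "submod JZ U" "\<And>x y. x \<in> I \<Longrightarrow> y \<in> dual I \<Longrightarrow> x * y \<in> U"
  shows "dual T \<subseteq> U"
proof -
  let ?J = "I \<cdot>\<^bsub>ambient\<^esub> dual I"
  have "dual ?J = T"
  proof (rule Set.set_eqI)
    fix x
    have "x \<in> dual ?J \<longleftrightarrow> (\<forall>i\<in>I. \<forall>y\<in>dual I. Tr (x * (i * y)) \<in> Z)"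
      using ideal_prod_least[OF trace_in_Z_submod, of I "dual I" x] ideal_prod_mem[of _ I _ "dual I"]
      by (fastforce simp: trace_dual_def)
    also have "\<dots> \<longleftrightarrow> (\<forall>i\<in>I. x * i \<in> dual (dual I))" by (simp add: trace_dual_def mult.assoc)
    also have "\<dots> \<longleftrightarrow> x \<in> T" using I(2) dual_dual[OF I(1)] by (auto simp: multiplicator_ring_def colon_def)
    finally show "x \<in> dual ?J \<longleftrightarrow> x \<in> T" .
  qed
  then have "dual T = ?J" using dual_dual[OF lattice_ideal_prod[OF I(1) lattice_dual[OF I(1)]]] by simp
  then show ?thesis using ideal_prod_least[OF U] by simp
qed

end

subsection \<open>Orders and their primes\<close>

lemma colonD: "x \<in> colon I J \<Longrightarrow> y \<in> J \<Longrightarrow> x * y \<in> I"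
  by (simp add: colon_def)

lemma colonI: "(\<And>y. y \<in> J \<Longrightarrow> x * y \<in> I) \<Longrightarrow> x \<in> colon I J"
  by (simp add: colon_def)

lemma colon_trans: "x \<in> colon I J \<Longrightarrow> y \<in> colon J L \<Longrightarrow> x * y \<in> colon I L"
  by (simp add: colon_def mult.assoc)

lemma ideal_prod_genby:
  assumes "is_subring T" "submod T p" "finite B"
  shows "p \<cdot>\<^bsub>ambient\<^esub> genby T B = genby p B"
proof
  have "genby T B \<subseteq> {y. \<forall>x\<in>p. x * y \<in> genby p B}"
  proof (rule genby_least)
    show "submod T {y. \<forall>x\<in>p. x * y \<in> genby p B}"
      using submod_genby[OF assms(2), of B] unfolding submod_def
      by (auto simp: distrib_left) (metis mult.left_commute)
    show "B \<subseteq> {y. \<forall>x\<in>p. x * y \<in> genby p B}"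
      using genby_mult_mem[OF assms(3)] submodD(1)[OF assms(2)] by auto
  qed
  then show "p \<cdot>\<^bsub>ambient\<^esub> genby T B \<subseteq> genby p B"
    by (intro ideal_prod_least[OF submod_genby[OF assms(2)]]) auto
  show "genby p B \<subseteq> p \<cdot>\<^bsub>ambient\<^esub> genby T B"
    using genby_superset[OF assms(1,3)]
    by (auto simp: genby_def[of p] intro!: submod_sum[OF submod_ideal_prod[OF assms(2) submod_genby[OF submod_self[OF assms(1)]]]] ideal_prod_mem)
qed

context dedekind_algebra
begin

definition order :: "'k set \<Rightarrow> bool" where
  "order T \<longleftrightarrow> is_subring T \<and> lattice T"

lemma order_in_iff: "order_in Z j T \<longleftrightarrow> order T"
  by (simp add: order_in_def order_def lattice_in_iff subring_ambient_iff)

lemma orderD: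
  assumes "order T"
  shows "is_subring T" "lattice T" "JZ \<subseteq> T" "noeth T" "submod T T" "1 \<in> T"
proof -
  show s: "is_subring T" and l: "lattice T" using assms by (auto simp: order_def)
  show o: "1 \<in> T" using is_subringD(1)[OF s] .
  show jz: "JZ \<subseteq> T" using submodD(3)[OF latticeD(2)[OF l] _ o] by auto
  show "submod T T" using submod_self[OF s] .
  show "noeth T" unfolding noeth_def
  proof (intro allI impI)
    fix I assume I: "submod T I \<and> I \<subseteq> T"
    then have "fg_submodule JZ I"
      using noeth_submod_fg'[OF JZ_ring latticeD(1)[OF l]] submod_mono[OF _ jz] by blast
    then obtain B where B: "finite B" "I = genby JZ B" by (auto simp: fg_submodule_iff)
    then have "I \<subseteq> genby T B" using genby_mono_left[OF jz] by blast
    moreover have "genby T B \<subseteq> I" using I genby_superset[OF JZ_ring(1) B(1)] B(2) by (intro genby_least) auto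
    ultimately show "fg_submodule T I" using B(1) unfolding fg_submodule_iff by blast
  qed
qed

lemma submod_JZ: "order T \<Longrightarrow> submod T M \<Longrightarrow> submod JZ M"
  using submod_mono orderD(3) by blast

lemma lattice_fg:
  assumes "order T" "submod T M" "lattice M"
  shows "\<exists>B. finite B \<and> M = genby T B"
proof -
  obtain B where B: "finite B" "M = genby JZ B" using latticeD(1)[OF assms(3)] by (auto simp: fg_submodule_iff)
  then have "M \<subseteq> genby T B" using genby_mono_left[OF orderD(3)[OF assms(1)]] by blast
  moreover have "genby T B \<subseteq> M" using assms(2) genby_superset[OF JZ_ring(1) B(1)] B(2) by (intro genby_least) auto
  ultimately show ?thesis using B(1) by blast
qed

lemma fractional_ideal_iff:
  assumes "order T"
  shows "fractional_ideal Z j T I \<longleftrightarrow> submod T I \<and> lattice I"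
  using lattice_fg[OF assms] fg_submod[OF orderD(1)[OF assms]]
  unfolding fractional_ideal_def lattice_in_iff fg_submodule_iff by blast

abbreviation "primes T \<equiv> primes_of Z j T"

lemma full_ideal: "order T \<Longrightarrow> submod T I \<Longrightarrow> d \<in> Z \<Longrightarrow> d \<noteq> 0 \<Longrightarrow> j d \<in> I \<Longrightarrow> full I"
  using full_contains[OF latticeD(3)[OF orderD(2)]] submodD(4) by blast

text \<open>The lattice condition in \<open>primes_of\<close> reduces to fullness, because an ideal
  of \<open>T\<close> is a submodule of a lattice.\<close>

lemma primes_iff:
  assumes T: "order T"
  shows "p \<in> primes T \<longleftrightarrow> is_prime T p \<and> full p"
proof -
  have "lattice p" if "is_prime T p" "full p"
    using lattice_subset[OF orderD(2)[OF T] submod_JZ[OF T is_primeD(1)[OF that(1)]] is_primeD(2)[OF that(1)] that(2)] .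
  then show ?thesis
    unfolding primes_of_def mem_Collect_eq fractional_ideal_iff[OF T] primeideal_ring_on_iff[OF orderD(1)[OF T]]
    using latticeD(3) is_primeD(1) by blast
qed

text \<open>
  Primes are maximal: a monic relation for \<open>a\<close> over \<open>Z\<close> has, modulo \<open>p\<close>, a lowest nonzero
  coefficient, which is invertible modulo \<open>p\<close> because \<open>p \<inter> Z\<close> is maximal.
\<close>

lemma primes_maximal:
  assumes T: "order T" and p: "p \<in> primes T" and a: "a \<in> T - p"
  shows "\<exists>r\<in>T. 1 - r * a \<in> p"
proof -
  note s = is_subringD[OF orderD(1)[OF T]]
  have pp: "is_prime T p" "full p" using p primes_iff[OF T] by auto
  note sp = is_primeD(1)[OF pp(1)]
  define q where "q = {z\<in>Z. j z \<in> p}"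
  have "is_prime Z q" unfolding is_prime_def
  proof (intro conjI ballI impI)
    show "submod Z q" using submod_JZ[OF T sp] unfolding submod_def q_def by (auto simp: Z_simps)
    show "1 \<notin> q" using is_primeD(3)[OF pp(1)] by (simp add: q_def)
    show "x \<in> q \<or> y \<in> q" if "x \<in> Z" "y \<in> Z" "x * y \<in> q" for x y
      using is_primeD(4)[OF pp(1), of "j x" "j y"] that orderD(3)[OF T] by (auto simp: q_def)
  qed (simp add: q_def)
  moreover have "q \<noteq> {0}"
  proof -
    obtain d where "d \<in> Z" "d \<noteq> 0" "j d * 1 \<in> p" using pp(2) unfolding full_def by blast
    then have "d \<in> q" "d \<noteq> 0" by (auto simp: q_def)
    then show ?thesis by blast
  qed
  ultimately have inv: "\<exists>u\<in>T. 1 - u * c \<in> p" if c: "c \<in> JZ" "c \<notin> p" for c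
  proof -
    obtain z where z: "c = j z" "z \<in> Z" using c(1) by blast
    then have "z \<in> Z - q" using c(2) by (auto simp: q_def)
    then obtain r where "r \<in> Z" "1 - r * z \<in> q"
      using prime_maximal[OF \<open>is_prime Z q\<close> \<open>q \<noteq> {0}\<close>] by blast
    then have "j r \<in> T" "1 - j r * c \<in> p" using orderD(3)[OF T] z by (auto simp: q_def)
    then show ?thesis by blast
  qed
  have pw: "a ^ k \<in> T" for k using is_subring_power[OF orderD(1)[OF T], of a k] a by simp
  then obtain n c where c: "\<forall>k. c k \<in> JZ" "a ^ n = (\<Sum>k<n. c k * a ^ k)"
    using noeth_relation[OF JZ_ring latticeD(1)[OF orderD(2)[OF T]], of "\<lambda>k. a ^ k"] by blast
  have key: "(\<forall>k. c k \<in> JZ) \<Longrightarrow> (\<Sum>k\<le>n. c k * a ^ k) \<in> p \<Longrightarrow> \<exists>k\<le>n. c k \<notin> p \<Longrightarrow> \<exists>r\<in>T. 1 - r * a \<in> p" for n c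
  proof (induction n arbitrary: c)
    case 0
    then show ?case by auto
  next
    case (Suc n)
    define t where "t = (\<Sum>k\<le>n. c (Suc k) * a ^ k)"
    have tT: "t \<in> T"
      unfolding t_def using Suc.prems(1) orderD(3)[OF T] pw by (intro submod_sum[OF orderD(5)[OF T]] s(4)) auto
    have "(\<Sum>k\<le>Suc n. c k * a ^ k) = c 0 + (\<Sum>k\<le>n. c (Suc k) * a ^ Suc k)"
      by (subst sum.atMost_Suc_shift) simp
    also have "\<dots> = c 0 + a * t" by (simp add: t_def sum_distrib_left mult.left_commute)
    finally have ct: "c 0 + a * t \<in> p" using Suc.prems(2) by simp
    show ?case
    proof (cases "c 0 \<in> p")
      case False
      then obtain u where u: "u \<in> T" "1 - u * c 0 \<in> p" using inv Suc.prems(1) by blast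
      have "1 - (- (u * t)) * a = (1 - u * c 0) + u * (c 0 + a * t)" by (simp add: algebra_simps)
      also have "\<dots> \<in> p" using submodD(2)[OF sp u(2) submodD(3)[OF sp u(1) ct]] .
      finally show ?thesis using u(1) tT s(4,5) by blast
    next
      case True
      have "(c 0 + a * t) - c 0 \<in> p" using submod_diff[OF orderD(1)[OF T] sp ct True] .
      then have "a * t \<in> p" by simp
      then have "t \<in> p" using is_primeD(4)[OF pp(1), of a t] a tT by auto
      moreover obtain k where "k \<le> Suc n" "c k \<notin> p" using Suc.prems(3) by blast
      then have "\<exists>k\<le>n. c (Suc k) \<notin> p" using True by (cases k) auto
      ultimately show ?thesis using Suc.IH[of "\<lambda>k. c (Suc k)"] Suc.prems(1) by (simp add: t_def)
    qed
  qed
  define c' where "c' k = (if k = n then 1 else - c k)" for k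
  have "(\<Sum>k\<le>n. c' k * a ^ k) = (\<Sum>k<n. c' k * a ^ k) + a ^ n"
    by (simp add: lessThan_Suc_atMost[symmetric] c'_def)
  also have "(\<Sum>k<n. c' k * a ^ k) = - (\<Sum>k<n. c k * a ^ k)"
    unfolding sum_negf[symmetric] by (intro sum.cong) (auto simp: c'_def)
  finally have "(\<Sum>k\<le>n. c' k * a ^ k) \<in> p" using c(2) submodD(1)[OF sp] by simp
  moreover have "\<forall>k. c' k \<in> JZ" using c(1) is_subringD(1,5)[OF JZ_ring(1)] by (auto simp: c'_def)
  moreover have "\<exists>k\<le>n. c' k \<notin> p" using is_primeD(3)[OF pp(1)] by (intro exI[of _ n]) (simp add: c'_def)
  ultimately show ?thesis using key by blast
qed

lemma primes_subset_eq:
  assumes T: "order T" and p: "p \<in> primes T" "q \<in> primes T" "p \<subseteq> q"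
  shows "p = q"
proof (rule ccontr)
  assume "p \<noteq> q"
  then obtain a where a: "a \<in> q" "a \<notin> p" using p(3) by blast
  have pr: "is_prime T q" using p(2) primes_iff[OF T] by auto
  have "a \<in> T" using a(1) is_primeD(2)[OF pr] by blast
  then obtain r where r: "r \<in> T" "1 - r * a \<in> p" using primes_maximal[OF T p(1)] a(2) by blast
  then have "1 - r * a + r * a \<in> q"
    using p(3) a(1) by (intro submodD(2)[OF is_primeD(1)[OF pr]] submodD(3)[OF is_primeD(1)[OF pr]]) auto
  then show False using is_primeD(3)[OF pr] by simp
qed

lemma ideal_below_prime:
  assumes T: "order T" and I: "submod T I" "I \<subseteq> T" "full I" "1 \<notin> I"
  shows "\<exists>p\<in>primes T. I \<subseteq> p"
  using exists_prime_above[OF orderD(1,4)[OF T] I(1,2,4)] full_mono[OF I(3)] primes_iff[OF T] by blast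

lemma ideal_eq_order:
  assumes T: "order T" and I: "submod T I" "I \<subseteq> T" "full I" "\<And>p. p \<in> primes T \<Longrightarrow> \<not> I \<subseteq> p"
  shows "1 \<in> I"
  using ideal_below_prime[OF T I(1-3)] I(4) by blast

text \<open>A prime above \<open>I\<close> contains one of the finitely many primes whose product
  lies in \<open>I\<close>, and equals it by maximality.\<close>

lemma finite_primes_above:
  assumes T: "order T" and I: "submod T I" "I \<subseteq> T" "full I"
  shows "finite {p \<in> primes T. I \<subseteq> p}"
proof -
  obtain n :: nat and P where P: "\<And>i. i < n \<Longrightarrow> is_prime T (P i) \<and> I \<subseteq> P i"
    "\<And>x. (\<forall>i<n. x i \<in> P i) \<Longrightarrow> (\<Prod>i<n. x i) \<in> I"
    using prime_product_below[OF orderD(1,4)[OF T] I(1,2)] by blast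
  have "{p \<in> primes T. I \<subseteq> p} \<subseteq> P ` {..<n}"
  proof
    fix p assume p: "p \<in> {p \<in> primes T. I \<subseteq> p}"
    then have pp: "is_prime T p" "I \<subseteq> p" using primes_iff[OF T] by auto
    have "\<exists>i\<in>{..<n}. P i \<subseteq> p"
    proof (rule prime_contains_factor[OF orderD(1)[OF T] pp(1)])
      show "prod x {..<n} \<in> p" if "\<forall>i\<in>{..<n}. x i \<in> P i" for x using P(2)[of x] that pp(2) by auto
      show "P i \<subseteq> T" if "i \<in> {..<n}" for i using P(1)[of i] that is_primeD(2) by auto
    qed simp
    then obtain i where i: "i < n" "P i \<subseteq> p" by auto
    then have "P i \<in> primes T" using P(1)[OF i(1)] full_mono[OF I(3)] primes_iff[OF T] by blast
    then show "p \<in> P ` {..<n}" using primes_subset_eq[OF T _ _ i(2)] p i(1) by blast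
  qed
  then show ?thesis using finite_surj by blast
qed

section \<open>Ideals with multiplicator ring T and local isomorphism\<close>

definition mult_ideal :: "'k set \<Rightarrow> 'k set \<Rightarrow> bool" where
  "mult_ideal T I \<longleftrightarrow> lattice I \<and> multiplicator_ring I = T"

lemma mult_idealD:
  assumes "mult_ideal T I"
  shows "lattice I" "colon I I = T" "submod T I"
proof -
  show l: "lattice I" and c: "colon I I = T" using assms by (auto simp: mult_ideal_def multiplicator_ring_def)
  show "submod T I"
    using submodD(1,2)[OF latticeD(2)[OF l]] colonD[of _ I I] c unfolding submod_def by blast
qed

text \<open>An ideal with multiplicator ring \<open>T\<close> is already a \<open>T\<close>-module,
  so the same set arises from every order \<open>S\<close> inside \<open>T\<close>.\<close>

lemma ideals_with_mult_ring_eq: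
  assumes "order S" "order T" "S \<subseteq> T"
  shows "ideals_with_mult_ring Z j S T = Collect (mult_ideal T)"
  using submod_mono[OF mult_idealD(3) assms(3)]
  unfolding ideals_with_mult_ring_def fractional_ideal_iff[OF assms(1)] by (auto simp: mult_ideal_def)

lemma mult_ideal_self: "order T \<Longrightarrow> mult_ideal T T"
  using orderD(2,5,6)[of T] unfolding mult_ideal_def multiplicator_ring_def
  by (auto simp: colon_def submod_def)

lemma mult_ideal_dual:
  assumes "order T"
  shows "mult_ideal T (dual T)"
  using mult_ideal_self[OF assms] lattice_dual[OF orderD(2)[OF assms]] colon_dual[OF orderD(2)[OF assms]]
  by (simp add: mult_ideal_def multiplicator_ring_def)

text \<open>Isomorphism at \<open>p\<close> with denominators cleared: multiplication by
  \<open>x\<close> and by \<open>y\<close> compose to multiplication by \<open>x * y\<close>, which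
  becomes invertible at \<open>p\<close> when the multiplicator rings are \<open>T\<close>.\<close>

definition loc_iso :: "'k set \<Rightarrow> 'k set \<Rightarrow> 'k set \<Rightarrow> bool" where
  "loc_iso p I J \<longleftrightarrow> (\<exists>x\<in>colon I J. \<exists>y\<in>colon J I. x * y \<notin> p)"

lemma loc_iso_sym: "loc_iso p I J \<Longrightarrow> loc_iso p J I"
  unfolding loc_iso_def by (metis mult.commute)

lemma loc_iso_trans:
  assumes p: "is_prime T p" and J: "mult_ideal T J" and "loc_iso p I J" "loc_iso p J L"
    and I: "mult_ideal T I"
  shows "loc_iso p I L"
proof -
  obtain x y where xy: "x \<in> colon I J" "y \<in> colon J I" "x * y \<notin> p" using assms(3) by (auto simp: loc_iso_def)
  obtain u v where uv: "u \<in> colon J L" "v \<in> colon L J" "u * v \<notin> p" using assms(4) by (auto simp: loc_iso_def)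
  have "x * y \<in> T" using colon_trans[OF xy(1,2)] mult_idealD(2)[OF I] by simp
  moreover have "u * v \<in> T" using colon_trans[OF uv(1,2)] mult_idealD(2)[OF J] by simp
  ultimately have "(x * y) * (u * v) \<notin> p" using is_primeD(4)[OF p] xy(3) uv(3) by blast
  then have "(x * u) * (v * y) \<notin> p" by (simp add: ac_simps)
  then show ?thesis using colon_trans[OF xy(1) uv(1)] colon_trans[OF uv(2) xy(2)] unfolding loc_iso_def by blast
qed

lemma loc_iso_dual:
  assumes "lattice I" "lattice J" "loc_iso p (dual I) (dual J)"
  shows "loc_iso p I J"
  using assms(3) unfolding loc_iso_def colon_dual[OF assms(1)] colon_dual[OF assms(2)]
  by (metis mult.commute)

text \<open>
  Multiplication by \<open>y\<close> need not be injective on \<open>K\<close>, so its inverse on \<open>y K\<close> is multiplied by \<open>s\<close>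
  once more.
\<close>

lemma loc_iso_cyclic:
  assumes p: "is_prime T p" and s: "s \<in> T - p" and I: "submod T I" and J: "lattice J"
    and y: "y \<in> colon J I" and sub: "\<And>w. w \<in> J \<Longrightarrow> s * w \<in> (*) y ` I"
  shows "loc_iso p I J"
proof -
  obtain d where d: "d \<in> Z" "d \<noteq> 0" "j d \<in> J" using latticeD(4)[OF J] by blast
  obtain i where i: "s * j d = y * i" using sub[OF d(3)] by blast
  define z where "z = i * j (inverse d)"
  have "y * z = (s * j d) * j (inverse d)" by (simp add: z_def i mult.assoc)
  also have "\<dots> = s" using j_inverse[OF d(2)] by (simp add: mult.assoc)
  finally have yz: "y * z = s" .
  have "s * z \<in> colon I J"
  proof (rule colonI)
    fix w assume "w \<in> J"
    then obtain i where i: "i \<in> I" "s * w = y * i" using sub by blast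
    have "s * z * w = z * (s * w)" by (simp add: ac_simps)
    also have "\<dots> = (y * z) * i" unfolding i(2) by (simp add: ac_simps)
    also have "\<dots> = s * i" unfolding yz ..
    also have "\<dots> \<in> I" using submodD(3)[OF I _ i(1)] s by blast
    finally show "s * z * w \<in> I" .
  qed
  moreover have "(s * z) * y = s * s" using yz by (metis mult.assoc mult.commute)
  moreover have "s * s \<notin> p" using is_primeD(4)[OF p, of s s] s by blast
  ultimately show ?thesis using y unfolding loc_iso_def by metis
qed

lemma local_nakayama:
  assumes T: "order T" and p: "is_prime T p" and V: "submod T V" "lattice V" and N: "submod T N"
    and gen: "\<And>v. v \<in> V \<Longrightarrow> \<exists>n\<in>N. v - n \<in> p \<cdot>\<^bsub>ambient\<^esub> V"
  shows "\<exists>s\<in>T - p. \<forall>v\<in>V. s * v \<in> N"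
proof -
  obtain B where B: "finite B" "V = genby T B" using lattice_fg[OF T V] by blast
  have "B \<subseteq> V" using genby_superset[OF orderD(1)[OF T] B(1)] B(2) by simp
  then have "\<exists>n\<in>N. b - n \<in> genby p B" if "b \<in> B" for b
    using gen[of b] that ideal_prod_genby[OF orderD(1)[OF T] is_primeD(1)[OF p] B(1)] unfolding B(2) by auto
  then obtain s where s: "s \<in> T" "1 - s \<in> p" "\<forall>x\<in>V. s * x \<in> N"
    using nakayama[OF orderD(1)[OF T] is_primeD(1,2)[OF p] N B(1)] unfolding B(2) by blast
  have "s \<notin> p"
  proof
    assume "s \<in> p"
    then have "1 - s + s \<in> p" using submodD(2)[OF is_primeD(1)[OF p] s(2)] by blast
    then show False using is_primeD(3)[OF p] by simp
  qed
  then show ?thesis using s by blast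
qed

text \<open>
  Cramer's rule: \<open>V/W\<close> is a vector space of dimension at most \<open>2\<close> over \<open>T/p\<close>, and \<open>u\<^sub>1\<close>, \<open>u\<^sub>2\<close> are
  linearly independent modulo \<open>W\<close>.
\<close>

lemma two_generators:
  assumes T: "order T" and p: "p \<in> primes T" and W: "submod T W" "\<And>r v. r \<in> p \<Longrightarrow> v \<in> V \<Longrightarrow> r * v \<in> W"
    and w: "w1 \<in> V" "w2 \<in> V" "\<And>v. v \<in> V \<Longrightarrow> \<exists>a\<in>T. \<exists>b\<in>T. v - (a * w1 + b * w2) \<in> W"
    and u: "u1 \<in> V" "u2 \<in> V" "u1 \<notin> W" "\<And>r. r \<in> T \<Longrightarrow> u2 - r * u1 \<notin> W"
    and U: "submod T U" "W \<subseteq> U" "u1 \<in> U" "u2 \<in> U"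
  shows "V \<subseteq> U"
proof -
  note s = is_subringD[OF orderD(1)[OF T]]
  have pp: "is_prime T p" using p primes_iff[OF T] by auto
  note diff = submod_diff[OF orderD(1)[OF T]]
  obtain a b where ab: "a \<in> T" "b \<in> T" "u1 - (a * w1 + b * w2) \<in> W" using w(3)[OF u(1)] by blast
  obtain c d where cd: "c \<in> T" "d \<in> T" "u2 - (c * w1 + d * w2) \<in> W" using w(3)[OF u(2)] by blast
  \<comment> \<open>The determinant of the coordinates of \<open>u1\<close>, \<open>u2\<close> with
    respect to \<open>w1\<close>, \<open>w2\<close>; \<open>e1\<close> and \<open>e2\<close> express
    \<open>D * w1\<close> and \<open>D * w2\<close> through \<open>u1\<close> and
    \<open>u2\<close>.\<close>
  define D where "D = a * d - b * c"
  have DT: "D \<in> T" using ab cd s by (auto simp: D_def)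
  have "a * u2 - c * u1 - D * w2 = a * (u2 - (c * w1 + d * w2)) - c * (u1 - (a * w1 + b * w2))"
    by (simp add: D_def algebra_simps)
  then have e2: "a * u2 - c * u1 - D * w2 \<in> W"
    using diff[OF W(1) submodD(3)[OF W(1) ab(1) cd(3)] submodD(3)[OF W(1) cd(1) ab(3)]] by simp
  have "d * u1 - b * u2 - D * w1 = d * (u1 - (a * w1 + b * w2)) - b * (u2 - (c * w1 + d * w2))"
    by (simp add: D_def algebra_simps)
  then have e1: "d * u1 - b * u2 - D * w1 \<in> W"
    using diff[OF W(1) submodD(3)[OF W(1) cd(2) ab(3)] submodD(3)[OF W(1) ab(2) cd(3)]] by simp
  have contra: False if r: "e \<in> T - p" "f \<in> T" "e * u2 - f * u1 \<in> W" for e f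
  proof -
    obtain r where r': "r \<in> T" "1 - r * e \<in> p" using primes_maximal[OF T p r(1)] by blast
    have "u2 - (r * f) * u1 = (1 - r * e) * u2 + r * (e * u2 - f * u1)" by (simp add: algebra_simps)
    also have "\<dots> \<in> W" using submodD(2)[OF W(1) W(2)[OF r'(2) u(2)] submodD(3)[OF W(1) r'(1) r(3)]] .
    finally show False using u(4)[of "r * f"] r'(1) r(2) s by blast
  qed
  \<comment> \<open>If \<open>D\<close> were 0 modulo \<open>p\<close>, then \<open>e1\<close> and
    \<open>e2\<close> would be relations between \<open>u1\<close> and \<open>u2\<close>.
    Independence forces \<open>a\<close> and \<open>b\<close> into \<open>p\<close>, which puts
    \<open>u1\<close> into \<open>W\<close>.\<close>
  have "D \<notin> p"
  proof
    assume D: "D \<in> p"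
    have "a * u2 - c * u1 - D * w2 + D * w2 \<in> W" using submodD(2)[OF W(1) e2 W(2)[OF D w(2)]] .
    then have "a \<in> p" using contra[of a c] ab(1) cd(1) by auto
    have "d * u1 - b * u2 - D * w1 + D * w1 \<in> W" using submodD(2)[OF W(1) e1 W(2)[OF D w(1)]] .
    then have "d * u1 - b * u2 \<in> W" by simp
    from submod_uminus[OF orderD(1)[OF T] W(1) this] have "b * u2 - d * u1 \<in> W" by simp
    then have "b \<in> p" using contra[of b d] ab(2) cd(2) by auto
    have "(u1 - (a * w1 + b * w2)) + (a * w1 + b * w2) \<in> W"
      using submodD(2)[OF W(1)] ab(3) W(2)[OF \<open>a \<in> p\<close> w(1)] W(2)[OF \<open>b \<in> p\<close> w(2)] by blast
    then show False using u(3) by simp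
  qed
  then obtain r where r: "r \<in> T" "1 - r * D \<in> p" using primes_maximal[OF T p] DT by blast
  have inU: "x \<in> U" if "x \<in> V" "y - D * x \<in> W" "y \<in> U" for x y
  proof -
    have "x = (1 - r * D) * x + r * (y - (y - D * x))" by (simp add: algebra_simps)
    moreover have "(1 - r * D) * x \<in> U" "y - D * x \<in> U" using W(2)[OF r(2) that(1)] U(2) that(2) by auto
    ultimately show ?thesis
      using submodD(2)[OF U(1) _ submodD(3)[OF U(1) r(1) diff[OF U(1) that(3)]]] by metis
  qed
  have "w1 \<in> U" using e1 U(3,4) ab cd
      submodD(3)[OF U(1)] by (intro inU[OF w(1), of "d * u1 - b * u2"] diff[OF U(1)]) auto
  moreover have "w2 \<in> U" using e2 U(3,4) ab cd
      submodD(3)[OF U(1)] by (intro inU[OF w(2), of "a * u2 - c * u1"] diff[OF U(1)]) auto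
  ultimately show ?thesis
  proof (intro subsetI)
    fix v assume wU: "w1 \<in> U" "w2 \<in> U" and "v \<in> V"
    then obtain a b where ab: "a \<in> T" "b \<in> T" "v - (a * w1 + b * w2) \<in> W" using w(3) by blast
    then have "v - (a * w1 + b * w2) + (a * w1 + b * w2) \<in> U"
      using U(2) submodD(2)[OF U(1)] submodD(3)[OF U(1) ab(1) wU(1)] submodD(3)[OF U(1) ab(2) wU(2)] by blast
    then show "v \<in> U" by simp
  qed
qed

end

subsection \<open>Comparison with the order and its trace dual\<close>

context dedekind_algebra
begin

lemma loc_iso_cyclic_mod_prime:
  assumes T: "order T" and p: "is_prime T p" and I: "submod T I" and V: "submod T V" "lattice V"
    and y: "y \<in> colon V I" and gen: "\<And>v. v \<in> V \<Longrightarrow> \<exists>n\<in>(*) y ` I. v - n \<in> p \<cdot>\<^bsub>ambient\<^esub> V"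
  shows "loc_iso p I V"
proof -
  obtain s where "s \<in> T - p" "\<forall>v\<in>V. s * v \<in> (*) y ` I"
    using local_nakayama[OF T p V submod_scale[OF I] gen] by blast
  then show ?thesis using loc_iso_cyclic[OF p _ I V(2) y] by blast
qed

text \<open>
  The products \<open>x y\<close> with \<open>x \<in> I\<close>, \<open>y \<in> I\<^sup>t\<close> span \<open>V = T\<^sup>t\<close> modulo \<open>W = p T\<^sup>t\<close>. If two of them,
  \<open>x\<^sub>1 y\<^sub>1\<close> and \<open>x\<^sub>2 y\<^sub>2\<close>, are independent, then one of \<open>x\<^sub>1\<close>, \<open>x\<^sub>2\<close>, \<open>x\<^sub>1 + x\<^sub>2\<close> multiplies \<open>I\<^sup>t\<close>
  onto \<open>V\<close>, or one of \<open>y\<^sub>1\<close>, \<open>y\<^sub>2\<close> multiplies \<open>I\<close> onto \<open>V\<close>, modulo \<open>W\<close>: otherwise the cross terms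
  \<open>x\<^sub>1 y\<^sub>2\<close> and \<open>x\<^sub>2 y\<^sub>1\<close> vanish, and \<open>x\<^sub>1 + x\<^sub>2\<close> has rank two.
\<close>

lemma loc_iso_order_or_dual:
  assumes T: "order T" and p: "p \<in> primes T" and I: "mult_ideal T I"
    and w: "w1 \<in> dual T" "w2 \<in> dual T"
      "\<And>v. v \<in> dual T \<Longrightarrow> \<exists>a\<in>T. \<exists>b\<in>T. v - (a * w1 + b * w2) \<in> p \<cdot>\<^bsub>ambient\<^esub> dual T"
  shows "loc_iso p I T \<or> loc_iso p I (dual T)"
proof -
  define V where "V = dual T"
  define W where "W = p \<cdot>\<^bsub>ambient\<^esub> V"
  have pp: "is_prime T p" using p primes_iff[OF T] by auto
  note lV = mult_idealD[OF mult_ideal_dual[OF T], folded V_def]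
  note lI = mult_idealD[OF I]
  have W: "submod T W" "\<And>r v. r \<in> p \<Longrightarrow> v \<in> V \<Longrightarrow> r * v \<in> W"
    unfolding W_def by (rule submod_ideal_prod[OF is_primeD(1)[OF pp] lV(3)], rule ideal_prod_mem)
  note W1 = submodD[OF W(1)]
  define gen where "gen M = {n + m | n m. n \<in> M \<and> m \<in> W}" for M
  have genI: "m + n \<in> gen M" if "m \<in> M" "n \<in> W" for m n M using that unfolding gen_def by blast
  have gen: "submod T (gen M)" "M \<subseteq> gen M" "W \<subseteq> gen M" if "submod T M" for M
  proof -
    show "submod T (gen M)" unfolding gen_def by (rule submod_plus[OF that W(1)])
    show "M \<subseteq> gen M" "W \<subseteq> gen M"
      using genI[of _ M 0] genI[of 0 M] W1(1) submodD(1)[OF that] by auto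
  qed
  have genD: "\<exists>n\<in>M. v - n \<in> W" if VM: "V \<subseteq> gen M" "v \<in> V" for v M
  proof -
    obtain n m where "v = n + m" "n \<in> M" "m \<in> W" using VM unfolding gen_def by blast
    then show ?thesis by (intro bexI[of _ n]) auto
  qed
  have prodV: "x * y \<in> V" if "x \<in> I" "y \<in> dual I" for x y
    using colonD[of y "dual T" I x] colon_dual_self[OF lI(3) orderD(6)[OF T]] that by (simp add: V_def mult.commute)
  have sd: "submod T (dual I)" by (rule submod_dual'[OF lI(3)])
  define fst_good where "fst_good x \<longleftrightarrow> V \<subseteq> gen ((*) x ` dual I)" for x
  define snd_good where "snd_good y \<longleftrightarrow> V \<subseteq> gen ((*) y ` I)" for y
  have fg: "loc_iso p I T" if x: "x \<in> I" "fst_good x" for x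
  proof -
    have "loc_iso p (dual I) V"
    proof (rule loc_iso_cyclic_mod_prime[OF T pp sd lV(3,1)])
      show "x \<in> colon V (dual I)" using prodV x(1) by (simp add: colon_def)
      show "\<exists>n\<in>(*) x ` dual I. v - n \<in> p \<cdot>\<^bsub>ambient\<^esub> V" if "v \<in> V" for v
        using genD[OF x(2)[unfolded fst_good_def] that] unfolding W_def .
    qed
    \<comment> \<open>Dualizing turns a local isomorphism of I^t with T^t into one of I with
      T.\<close>
    then show ?thesis unfolding V_def by (rule loc_iso_dual[OF lI(1) orderD(2)[OF T]])
  qed
  have sg: "loc_iso p I V" if y: "y \<in> dual I" "snd_good y" for y
  proof (rule loc_iso_cyclic_mod_prime[OF T pp lI(3) lV(3,1)])
    show "y \<in> colon V I" using prodV y(1) by (simp add: colon_def mult.commute)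
    show "\<exists>n\<in>(*) y ` I. v - n \<in> p \<cdot>\<^bsub>ambient\<^esub> V" if "v \<in> V" for v
      using genD[OF y(2)[unfolded snd_good_def] that] unfolding W_def .
  qed
  have "(\<exists>x\<in>I. fst_good x) \<or> (\<exists>y\<in>dual I. snd_good y)"
  proof (rule ccontr)
    assume "\<not> ?thesis"
    then have nx: "\<And>x. x \<in> I \<Longrightarrow> \<not> V \<subseteq> gen ((*) x ` dual I)" and ny: "\<And>y. y \<in> dual I \<Longrightarrow> \<not> V \<subseteq> gen ((*) y ` I)"
      unfolding fst_good_def snd_good_def by auto
    \<comment> \<open>Since I I^t = T^t, a submodule that does not contain \<open>V\<close> misses
      some product.\<close>
    have ex: "\<exists>x\<in>I. \<exists>y\<in>dual I. x * y \<notin> U" if "submod T U" "\<not> V \<subseteq> U" for U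
      using dual_subset_products[OF lI(1) _ submod_JZ[OF T that(1)], of T] that(2) lI(2)
      unfolding V_def multiplicator_ring_def by blast
    have two: "V \<subseteq> U" if "u1 \<in> V" "u2 \<in> V" "u1 \<notin> W" "\<And>r. r \<in> T \<Longrightarrow> u2 - r * u1 \<notin> W"
      "submod T U" "W \<subseteq> U" "u1 \<in> U" "u2 \<in> U" for u1 u2 U
      using two_generators[OF T p W w[folded V_def, folded W_def] that] .
    have "\<not> V \<subseteq> W"
      using nx[OF submodD(1)[OF lI(3)]] gen(3)[OF submod_scale[OF sd]] by blast
    then obtain x1 y1 where 1: "x1 \<in> I" "y1 \<in> dual I" "x1 * y1 \<notin> W" using ex[OF W(1)] by blast
    define u1 where "u1 = x1 * y1"
    \<comment> \<open>The preimage of the line through \<open>u\<close> in V / W.\<close>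
    define L where "L u = gen {r * u | r. r \<in> T}" for u
    have L: "submod T (L u)" "W \<subseteq> L u" for u
      unfolding L_def using gen(1,3)[OF submod_cyclic[OF orderD(1)[OF T]]] by auto
    have LI: "v \<in> L u" if "r \<in> T" "v - r * u \<in> W" for v r u
    proof -
      have "r * u + (v - r * u) \<in> L u" unfolding L_def using that by (intro genI) auto
      then show ?thesis by simp
    qed
    have LE: "\<exists>r\<in>T. v - r * u \<in> W" if v: "v \<in> L u" for v u
    proof -
      obtain r m where "v = r * u + m" "r \<in> T" "m \<in> W" using v unfolding L_def gen_def by blast
      then show ?thesis by (intro bexI[of _ r]) auto
    qed
    have Lsub: "L u \<subseteq> gen M" if "submod T M" "u \<in> M" for u M
    proof
      fix v assume "v \<in> L u"
      then obtain r where r: "r \<in> T" "v - r * u \<in> W" using LE by blast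
      have "r * u + (v - r * u) \<in> gen M" using r submodD(3)[OF that(1) r(1) that(2)] by (intro genI)
      then show "v \<in> gen M" by simp
    qed
    have mem: "x * y \<in> (*) x ` dual I" "x * y \<in> (*) y ` I" if "x \<in> I" "y \<in> dual I" for x y
      using that by (auto simp: mult.commute)
    have "\<not> V \<subseteq> L u1"
      using nx[OF 1(1)] Lsub[OF submod_scale[OF sd] mem(1)[OF 1(1,2)]] unfolding u1_def by blast
    then obtain x2 y2 where 2: "x2 \<in> I" "y2 \<in> dual I" "x2 * y2 \<notin> L u1" using ex[OF L(1)] by blast
    define u2 where "u2 = x2 * y2"
    have uV: "u1 \<in> V" "u2 \<in> V" using prodV 1 2 by (auto simp: u1_def u2_def)
    have uW: "u1 \<notin> W" "u2 \<notin> W" using 1 2 L(2) by (auto simp: u1_def u2_def)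
    have ind: "u2 - r * u1 \<notin> W" if "r \<in> T" for r using LI[OF that] 2(3) by (auto simp: u2_def)
    \<comment> \<open>Two elements of \<open>M\<close> are dependent modulo \<open>W\<close> if
      \<open>M\<close> does not generate \<open>V\<close> modulo \<open>W\<close>. This is where
      dimension at most 2 enters.\<close>
    have inL: "v \<in> L u" if "u \<in> V" "u \<notin> W" "v \<in> V" "submod T M" "u \<in> M" "v \<in> M" "\<not> V \<subseteq> gen M" for u v M
    proof (rule ccontr)
      assume "v \<notin> L u"
      then have "v - r * u \<notin> W" if "r \<in> T" for r using LI[OF that] by blast
      then have "V \<subseteq> gen M"
        using that(5,6) gen(2)[OF that(4)] by (intro two[OF that(1,3,2) _ gen(1,3)[OF that(4)]]) auto
      then show False using that(7) by blast
    qed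
    \<comment> \<open>The lines through two independent vectors meet only in 0.\<close>
    have LLW: "v \<in> W" if v: "v \<in> V" "v \<in> L u1" "v \<in> L u2" for v
    proof -
      obtain r where r: "r \<in> T" "v - r * u1 \<in> W" using LE[OF v(2)] by blast
      obtain t where t: "t \<in> T" "v - t * u2 \<in> W" using LE[OF v(3)] by blast
      have "t \<in> p"
      proof (rule ccontr)
        assume "t \<notin> p"
        then obtain e where e: "e \<in> T" "1 - e * t \<in> p" using primes_maximal[OF T p] t(1) by blast
        have "u2 - (e * r) * u1 = (1 - e * t) * u2 + e * ((v - r * u1) - (v - t * u2))"
          by (simp add: algebra_simps)
        also have "\<dots> \<in> W" using W1(2)[OF W(2)[OF e(2) uV(2)]
            W1(3)[OF e(1) submod_diff[OF orderD(1)[OF T] W(1) r(2) t(2)]]] .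
        finally show False using ind is_subringD(4)[OF orderD(1)[OF T] e(1) r(1)] by blast
      qed
      then have "(v - t * u2) + t * u2 \<in> W" using W1(2)[OF t(2) W(2)[OF _ uV(2)]] by blast
      then show ?thesis by simp
    qed
    have cross: "x1 * y2 \<in> W" "x2 * y1 \<in> W"
    proof -
      have "x1 * y2 \<in> L u1"
        by (rule inL[OF uV(1) uW(1) prodV[OF 1(1) 2(2)] submod_scale[OF sd] _ _ nx[OF 1(1)]])
          (auto simp: u1_def intro!: mem 1 2)
      moreover have "x1 * y2 \<in> L u2"
        by (rule inL[OF uV(2) uW(2) prodV[OF 1(1) 2(2)] submod_scale[OF lI(3)] _ _ ny[OF 2(2)]])
          (auto simp: u2_def intro!: mem 1 2)
      ultimately show "x1 * y2 \<in> W" using LLW[OF prodV[OF 1(1) 2(2)]] by blast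
      have "x2 * y1 \<in> L u2"
        by (rule inL[OF uV(2) uW(2) prodV[OF 2(1) 1(2)] submod_scale[OF sd] _ _ nx[OF 2(1)]])
          (auto simp: u2_def intro!: mem 1 2)
      moreover have "x2 * y1 \<in> L u1"
        by (rule inL[OF uV(1) uW(1) prodV[OF 2(1) 1(2)] submod_scale[OF lI(3)] _ _ ny[OF 1(2)]])
          (auto simp: u1_def intro!: mem 1 2)
      ultimately show "x2 * y1 \<in> W" using LLW[OF prodV[OF 2(1) 1(2)]] by blast
    qed
    define x where "x = x1 + x2"
    have xI: "x \<in> I" unfolding x_def using submodD(2)[OF lI(3) 1(1) 2(1)] .
    note G = gen[OF submod_scale[OF sd, of x]]
    have "x * y1 \<in> gen ((*) x ` dual I)" "x * y2 \<in> gen ((*) x ` dual I)"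
      using G(2) mem(1)[OF xI] 1 2 by auto
    then have "x * y1 - x2 * y1 \<in> gen ((*) x ` dual I)" "x * y2 - x1 * y2 \<in> gen ((*) x ` dual I)"
      using submod_diff[OF orderD(1)[OF T] G(1)] cross G(3) by blast+
    then have "u1 \<in> gen ((*) x ` dual I)" "u2 \<in> gen ((*) x ` dual I)"
      by (simp_all add: u1_def u2_def x_def distrib_right)
    then have "V \<subseteq> gen ((*) x ` dual I)" using two[OF uV uW(1) ind G(1,3)] by blast
    then show False using nx[OF xI] by blast
  qed
  then show ?thesis using fg sg unfolding V_def by blast
qed

text \<open>By Nakayama's lemma, local cyclicity of T^t can be tested modulo \<open>p\<close>.
  Conversely, if \<open>z\<close> and \<open>w\<close> are inverse up to a unit at \<open>p\<close>,
  then \<open>r * (z * v)\<close> is the coordinate of \<open>v\<close> with respect to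
  \<open>w\<close>.\<close>

lemma loc_iso_dual_iff_cyclic:
  assumes T: "order T" and p: "p \<in> primes T"
  shows "loc_iso p T (dual T) \<longleftrightarrow>
    (\<exists>w\<in>dual T. \<forall>v\<in>dual T. \<exists>a\<in>T. v - a * w \<in> p \<cdot>\<^bsub>ambient\<^esub> dual T)"
proof
  have pp: "is_prime T p" using p primes_iff[OF T] by auto
  note lV = mult_idealD[OF mult_ideal_dual[OF T]]
  {
    assume "\<exists>w\<in>dual T. \<forall>v\<in>dual T. \<exists>a\<in>T. v - a * w \<in> p \<cdot>\<^bsub>ambient\<^esub> dual T"
    then obtain w where w: "w \<in> dual T" "\<And>v. v \<in> dual T \<Longrightarrow> \<exists>a\<in>T. v - a * w \<in> p \<cdot>\<^bsub>ambient\<^esub> dual T"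
      by blast
    show "loc_iso p T (dual T)"
    proof (rule loc_iso_cyclic_mod_prime[OF T pp orderD(5)[OF T] lV(3,1)])
      show "w \<in> colon (dual T) T" using submodD(4)[OF lV(3) _ w(1)] by (auto simp: colon_def)
      show "\<exists>n\<in>(*) w ` T. v - n \<in> p \<cdot>\<^bsub>ambient\<^esub> dual T" if "v \<in> dual T" for v
        using w(2)[OF that] by (auto simp: mult.commute)
    qed
  }
  assume "loc_iso p T (dual T)"
  then obtain z w where zw: "z \<in> colon T (dual T)" "w \<in> colon (dual T) T" "z * w \<notin> p"
    by (auto simp: loc_iso_def)
  have wV: "w \<in> dual T" using colonD[OF zw(2) orderD(6)[OF T]] by simp
  have "z * w \<in> T" using colonD[OF zw(1) wV] .
  then obtain r where r: "r \<in> T" "1 - r * (z * w) \<in> p" using primes_maximal[OF T p] zw(3) by blast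
  have "\<exists>a\<in>T. v - a * w \<in> p \<cdot>\<^bsub>ambient\<^esub> dual T" if v: "v \<in> dual T" for v
  proof
    show "r * (z * v) \<in> T" using is_subringD(4)[OF orderD(1)[OF T] r(1) colonD[OF zw(1) v]] .
    have "v - r * (z * v) * w = (1 - r * (z * w)) * v" by (simp add: algebra_simps)
    then show "v - r * (z * v) * w \<in> p \<cdot>\<^bsub>ambient\<^esub> dual T" using ideal_prod_mem[OF r(2) v] by simp
  qed
  then show "\<exists>w\<in>dual T. \<forall>v\<in>dual T. \<exists>a\<in>T. v - a * w \<in> p \<cdot>\<^bsub>ambient\<^esub> dual T" using wV by blast
qed

text \<open>For \<open>x\<close> in (I : I) the denominators of \<open>x\<close> in \<open>T\<close>
  form an ideal \<open>C\<close>. It avoids every prime: \<open>z\<close> and \<open>y\<close> carry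
  \<open>x\<close> to \<open>z * x * y\<close>, which stabilizes the local model \<open>J\<close>
  and so lies in \<open>T\<close>, and thus \<open>y * z\<close> is in \<open>C\<close>.\<close>

lemma mult_ideal_if_loc_iso:
  assumes T: "order T" and I: "submod T I" "lattice I"
    and loc: "\<And>p. p \<in> primes T \<Longrightarrow> \<exists>J. mult_ideal T J \<and> loc_iso p I J"
  shows "mult_ideal T I"
proof -
  have "colon I I \<subseteq> T"
  proof
    fix x assume x: "x \<in> colon I I"
    define C where "C = {t\<in>T. t * x \<in> T}"
    have C: "submod T C"
      using orderD(5)[OF T] unfolding C_def submod_def by (auto simp: distrib_right mult.assoc)
    obtain d where d: "d \<in> Z" "d \<noteq> 0" "j d * x \<in> T"
      using latticeD(3)[OF orderD(2)[OF T]] by (auto simp: full_def)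
    then have "full C" using full_ideal[OF T C d(1,2)] orderD(3)[OF T] by (auto simp: C_def)
    moreover have "\<not> C \<subseteq> p" if pT: "p \<in> primes T" for p
    proof -
      obtain J where J: "mult_ideal T J" "loc_iso p I J" using loc[OF pT] by blast
      then obtain y z where yz: "y \<in> colon I J" "z \<in> colon J I" "y * z \<notin> p" by (auto simp: loc_iso_def)
      have "z * y \<in> T" "z * (x * y) \<in> T"
        using colon_trans[OF yz(2,1)] colon_trans[OF yz(2) colon_trans[OF x yz(1)]] mult_idealD(2)[OF J(1)] by auto
      then have "y * z \<in> C" by (simp add: C_def ac_simps)
      then show ?thesis using yz(3) by blast
    qed
    ultimately have "1 \<in> C" using ideal_eq_order[OF T C] by (auto simp: C_def)
    then show "x \<in> T" by (simp add: C_def)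
  qed
  moreover have "T \<subseteq> colon I I" using submodD(3)[OF I(1)] by (auto simp: colon_def)
  ultimately show ?thesis using I(2) by (auto simp: mult_ideal_def multiplicator_ring_def)
qed

text \<open>
  With \<open>D = d T\<^sup>t \<subseteq> T\<close> and primes \<open>P\<^sub>i\<close> with product in \<open>D\<close>, let \<open>I\<close> be the largest ideal of \<open>T\<close> that
  the product of the \<open>P\<^sub>i\<close> outside \<open>A\<close> multiplies into \<open>D\<close>. At primes in \<open>A\<close> that product is trivial,
  so \<open>I\<close> agrees with \<open>D\<close>; elsewhere \<open>I\<close> contains a locally trivial product of primes of \<open>A\<close>.
\<close>

lemma exists_mult_ideal:
  assumes T: "order T"
  shows "\<exists>I. mult_ideal T I \<and> (\<forall>p\<in>primes T. if p \<in> A then loc_iso p I (dual T) else loc_iso p I T)"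
proof -
  note lV = mult_idealD[OF mult_ideal_dual[OF T]]
  obtain d where d: "d \<in> Z" "d \<noteq> 0" "\<forall>x\<in>dual T. j d * x \<in> T"
    using full_lattice[OF latticeD(2,3)[OF orderD(2)[OF T]] lV(1)] by blast
  define D where "D = (*) (j d) ` dual T"
  have D: "submod T D" "D \<subseteq> T" "full D"
    unfolding D_def using submod_scale[OF lV(3)] d(3) latticeD(3)[OF lattice_scale[OF lV(1) d(2)]] by auto
  obtain n :: nat and P where P: "\<And>i. i < n \<Longrightarrow> is_prime T (P i) \<and> D \<subseteq> P i"
    "\<And>x. (\<forall>i<n. x i \<in> P i) \<Longrightarrow> (\<Prod>i<n. x i) \<in> D"
    using prime_product_below[OF orderD(1,4)[OF T] D(1,2)] by blast
  have Pp: "P i \<in> primes T" if "i < n" for i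
    using P(1)[OF that] primes_iff[OF T] full_mono[OF D(3)] by blast
  have outside: "\<exists>x. \<forall>i\<in>B. x i \<in> P i - p" if "p \<in> primes T" "B \<subseteq> {..<n}" "\<And>i. i \<in> B \<Longrightarrow> P i \<noteq> p" for p B
  proof -
    have "\<forall>i\<in>B. \<exists>y. y \<in> P i - p" using primes_subset_eq[OF T Pp that(1)] that(2,3) by blast
    then show ?thesis by metis
  qed
  define B where "B = {i. i < n \<and> P i \<notin> A}"
  define C where "C = {i. i < n \<and> P i \<in> A}"
  have fin: "finite B" "finite C" and BC: "{..<n} = C \<union> B" "C \<inter> B = {}" and sub: "B \<subseteq> {..<n}" "C \<subseteq> {..<n}"
    unfolding B_def C_def by auto
  have PT: "P i \<subseteq> T" if "i < n" for i using P(1)[OF that] is_primeD(2) by blast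
  define I where "I = {x\<in>T. \<forall>y. (\<forall>i\<in>B. y i \<in> P i) \<longrightarrow> x * (\<Prod>i\<in>B. y i) \<in> D}"
  have sI: "submod T I"
    using orderD(5)[OF T] D(1) unfolding I_def submod_def by (auto simp: distrib_right mult.assoc)
  have prodT: "(\<Prod>i\<in>E. y i) \<in> T" if "\<forall>i\<in>E. y i \<in> P i" "E \<subseteq> {..<n}" for y E
  proof -
    have "(\<Prod>i\<in>F. y i) \<in> T" if "finite F" "\<forall>i\<in>F. y i \<in> T" for F
      using that by (induction F rule: finite_induct) (auto intro!: is_subringD[OF orderD(1)[OF T]])
    then show ?thesis using that PT finite_subset[OF that(2)] by blast
  qed
  have DI: "D \<subseteq> I" using D(2) submodD(4)[OF D(1)] prodT[OF _ sub(1)] unfolding I_def by blast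
  have IT: "I \<subseteq> T" by (auto simp: I_def)
  have lI: "lattice I"
    using lattice_subset[OF orderD(2)[OF T] submod_JZ[OF T sI] IT full_mono[OF D(3) DI]] .
  have loc: "if p \<in> A then loc_iso p I (dual T) else loc_iso p I T" if p: "p \<in> primes T" for p
  proof (cases "p \<in> A")
    case True
    have pp: "is_prime T p" using p primes_iff[OF T] by auto
    obtain y where y: "\<forall>i\<in>B. y i \<in> P i - p" using outside[OF p sub(1)] True by (auto simp: B_def)
    define b where "b = (\<Prod>i\<in>B. y i)"
    have "b \<in> T - p" unfolding b_def
      using y PT by (intro is_prime_prod[OF pp orderD(1)[OF T] fin(1)]) (auto simp: B_def)
    \<comment> \<open>Multiplication by \<open>d\<close> carries T^t onto \<open>D\<close> inside
      \<open>I\<close>. In the other direction \<open>b\<close> carries \<open>I\<close> into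
      \<open>D\<close>, and then one divides by \<open>d\<close>.\<close>
    moreover have "j d \<in> colon I (dual T)" using DI by (auto simp: colon_def D_def)
    moreover have "j (inverse d) * b \<in> colon (dual T) I"
    proof (rule colonI)
      fix x assume "x \<in> I"
      then have "x * b \<in> D" unfolding I_def b_def using y by auto
      then obtain v where v: "v \<in> dual T" "x * b = j d * v" by (auto simp: D_def)
      have "j (inverse d) * b * x = j (inverse d) * (j d * v)" by (simp add: mult.assoc mult.commute[of b] v(2))
      then show "j (inverse d) * b * x \<in> dual T" using v(1) j_inverse_cancel[OF d(2)] by simp
    qed
    moreover have "j d * (j (inverse d) * b) = b" using j_inverse[OF d(2)] by (simp add: mult.assoc[symmetric])
    ultimately show ?thesis using True unfolding loc_iso_def by (metis DiffD2)
  next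
    case False
    have pp: "is_prime T p" using p primes_iff[OF T] by auto
    obtain x where x: "\<forall>i\<in>C. x i \<in> P i - p" using outside[OF p sub(2)] False by (auto simp: C_def)
    define a where "a = (\<Prod>i\<in>C. x i)"
    have a: "a \<in> T - p" unfolding a_def
      using x PT by (intro is_prime_prod[OF pp orderD(1)[OF T] fin(2)]) (auto simp: C_def)
    have "a * (\<Prod>i\<in>B. y i) \<in> D" if y: "\<forall>i\<in>B. y i \<in> P i" for y
    proof -
      define z where "z i = (if i \<in> C then x i else y i)" for i
      have "(\<Prod>i<n. z i) = (\<Prod>i\<in>C. z i) * (\<Prod>i\<in>B. z i)" unfolding BC(1) by (rule prod.union_disjoint[OF fin(2,1) BC(2)])
      also have "(\<Prod>i\<in>C. z i) = a" unfolding a_def by (intro prod.cong) (auto simp: z_def)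
      also have "(\<Prod>i\<in>B. z i) = (\<Prod>i\<in>B. y i)" using BC(2) by (intro prod.cong) (auto simp: z_def)
      finally have "a * (\<Prod>i\<in>B. y i) = (\<Prod>i<n. z i)" by simp
      moreover have "\<forall>i<n. z i \<in> P i" using x y by (auto simp: z_def B_def C_def)
      ultimately show ?thesis using P(2)[of z] by simp
    qed
    then have "a \<in> I" using a by (auto simp: I_def)
    then have "a \<in> colon I T" using submodD(4)[OF sI] by (auto simp: colon_def)
    moreover have "1 \<in> colon T I" using IT by (auto simp: colon_def)
    ultimately have "loc_iso p I T" unfolding loc_iso_def using a by (intro bexI[of _ a] bexI[of _ 1]) auto
    then show ?thesis using False by simp
  qed
  have "mult_ideal T I"
    using loc mult_ideal_self[OF T] mult_ideal_dual[OF T]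
    by (intro mult_ideal_if_loc_iso[OF T sI lI]) (metis (full_types))
  then show ?thesis using loc by blast
qed

end

subsection \<open>The type of an order\<close>

text \<open>One form for the additive cosets of \<open>ambient\<close> and of
  \<open>ring_on R\<close>, independent of the carrier.\<close>

definition coset :: "'k::comm_ring_1 set \<Rightarrow> 'k \<Rightarrow> 'k set" where
  "coset W x = (\<lambda>w. w + x) ` W"

lemma coset_eq_image:
  "W +>\<^bsub>ambient\<^esub> x = coset W x" "W +>\<^bsub>ring_on R\<^esub> x = coset W x"
  by (auto simp: a_r_coset_def' coset_def)

lemma coset_eq_iff:
  assumes R: "is_subring R" "submod R W"
  shows "coset W x = coset W y \<longleftrightarrow> x - y \<in> W"
proof
  assume "coset W x = coset W y"
  moreover have "0 + x \<in> coset W x" using submodD(1)[OF R(2)] unfolding coset_def by blast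
  ultimately obtain w where "0 + x = w + y" "w \<in> W" unfolding coset_def by blast
  then show "x - y \<in> W" by (simp add: algebra_simps)
next
  assume xy: "x - y \<in> W"
  have "coset W a \<subseteq> coset W b" if "a - b \<in> W" for a b
  proof
    fix z assume "z \<in> coset W a"
    then obtain w where w: "z = w + a" "w \<in> W" unfolding coset_def by blast
    then have "z = (w + (a - b)) + b" "w + (a - b) \<in> W" using submodD(2)[OF R(2) w(2) that] by auto
    then show "z \<in> coset W b" unfolding coset_def by blast
  qed
  from this[of x y] this[of y x] show "coset W x = coset W y"
    using xy submod_uminus[OF R xy] by auto
qed

lemma coset_zero: "coset W 0 = W"
  by (simp add: coset_def)

context dedekind_algebra
begin

section \<open>The quotient V / p V as a vector space over the residue field\<close>

context
  fixes T p V W K Q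
  assumes T: "order T" and p: "p \<in> primes T" and V: "submod T V"
    and W_def: "W = p \<cdot>\<^bsub>ambient\<^esub> V" and K_def: "K = ring_on T Quot p" and Q_def: "Q = quot_module V W"
begin

lemmas subring_T = orderD(1)[OF T]

lemma is_prime_p: "is_prime T p" using p primes_iff[OF T] by auto

lemma submod_W: "submod T W" unfolding W_def by (rule submod_ideal_prod[OF is_primeD(1)[OF is_prime_p] V])

lemma prime_smult_mem: "r \<in> p \<Longrightarrow> v \<in> V \<Longrightarrow> r * v \<in> W"
  unfolding W_def by (rule ideal_prod_mem)

lemma residue_field: "Ring.field K"
  unfolding K_def
proof (rule maximalideal.quotient_is_field)
  interpret cring "ring_on T" by (rule cring_ring_on[OF subring_T])
  show "cring (ring_on T)" by (rule cring_ring_on[OF subring_T])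
  show "maximalideal p (ring_on T)"
  proof (rule maximalidealI)
    show "ideal p (ring_on T)" using ideal_ring_on_iff[OF subring_T] is_primeD(1,2)[OF is_prime_p] by simp
    show "carrier (ring_on T) \<noteq> p" using is_primeD(3)[OF is_prime_p] orderD(6)[OF T] by auto
    fix J assume "ideal J (ring_on T)" and J: "p \<subseteq> J" "J \<subseteq> carrier (ring_on T)"
    then have sJ: "submod T J" "J \<subseteq> T" using ideal_ring_on_iff[OF subring_T] by simp_all
    show "J = p \<or> J = carrier (ring_on T)"
    proof (cases "J \<subseteq> p")
      case False
      then obtain a where a: "a \<in> J" "a \<notin> p" by blast
      then obtain r where r: "r \<in> T" "1 - r * a \<in> p" using primes_maximal[OF T p, of a] sJ(2) by blast
      then have "1 - r * a + r * a \<in> J" using J(1) submodD(2)[OF sJ(1) _ submodD(3)[OF sJ(1) r(1) a(1)]] by blast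
      then have "1 \<in> J" by simp
      then have "T \<subseteq> J" using submodD(4)[OF sJ(1)] by force
      then show ?thesis using sJ(2) by auto
    qed (use J(1) in blast)
  qed
qed

lemma residue_field_carrier: "carrier K = coset p ` T"
  unfolding K_def FactRing_def by (auto simp: A_RCOSETS_def' coset_eq_image)

lemma residue_field_ops:
  assumes "s \<in> T" "t \<in> T"
  shows "coset p s \<oplus>\<^bsub>K\<^esub> coset p t = coset p (s + t)" "coset p s \<otimes>\<^bsub>K\<^esub> coset p t = coset p (s * t)"
    "\<one>\<^bsub>K\<^esub> = coset p 1"
proof -
  have id: "ideal p (ring_on T)" using ideal_ring_on_iff[OF subring_T] is_primeD(1,2)[OF is_prime_p] by simp
  show "coset p s \<otimes>\<^bsub>K\<^esub> coset p t = coset p (s * t)"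
    using ideal.rcoset_mult_add[OF id, of s t] assms unfolding K_def FactRing_def by (simp add: coset_eq_image)
  show "coset p s \<oplus>\<^bsub>K\<^esub> coset p t = coset p (s + t)"
    using abelian_subgroup.a_rcos_sum[OF abelian_subgroupI3[OF ideal.axioms(1)[OF id]
        ring.is_abelian_group[OF cring.axioms(1)[OF cring_ring_on[OF subring_T]]]], of s t] assms
    unfolding K_def FactRing_def by (simp add: coset_eq_image)
  show "\<one>\<^bsub>K\<^esub> = coset p 1" unfolding K_def FactRing_def by (simp add: coset_eq_image)
qed

lemma quot_carrier: "carrier Q = coset W ` V"
  by (simp add: Q_def quot_module_def coset_eq_image)

lemma quot_zero: "\<zero>\<^bsub>Q\<^esub> = coset W 0"
  by (simp add: Q_def quot_module_def coset_zero)

lemma quot_add: "coset W x \<oplus>\<^bsub>Q\<^esub> coset W y = coset W (x + y)"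
proof -
  have "coset W x \<oplus>\<^bsub>Q\<^esub> coset W y = {(v + x) + (w + y) | v w. v \<in> W \<and> w \<in> W}"
    by (auto simp: Q_def quot_module_def set_add_def' coset_def)
  also have "\<dots> = coset W (x + y)"
  proof safe
    fix v w assume "v \<in> W" "w \<in> W"
    then have "v + w \<in> W" using submodD(2)[OF submod_W] by blast
    then show "v + x + (w + y) \<in> coset W (x + y)" unfolding coset_def by (intro image_eqI[of _ _ "v + w"]) (auto simp: algebra_simps)
  next
    fix z assume "z \<in> coset W (x + y)"
    then obtain w where "z = w + (x + y)" "w \<in> W" unfolding coset_def by blast
    then show "\<exists>v w. z = v + x + (w + y) \<and> v \<in> W \<and> w \<in> W"
      using submodD(1)[OF submod_W] by (intro exI[of _ w] exI[of _ 0]) (auto simp: algebra_simps)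
  qed
  finally show ?thesis .
qed

text \<open>The scalar multiplication of \<open>quot_module\<close> is a union over all
  representatives; as \<open>W\<close> is the product of \<open>p\<close> and \<open>V\<close>,
  every member of the union is the same coset.\<close>

lemma quot_smult:
  assumes t: "t \<in> T" and x: "x \<in> V"
  shows "coset p t \<odot>\<^bsub>Q\<^esub> coset W x = coset W (t * x)"
proof -
  have "coset W ((q + t) * (w + x)) = coset W (t * x)" if "q \<in> p" "w \<in> W" for q w
  proof (rule coset_eq_iff[OF subring_T submod_W, THEN iffD2])
    have "(q + t) * (w + x) - t * x = (q + t) * w + q * x" by (simp add: algebra_simps)
    moreover have "q + t \<in> T" using that(1) t is_primeD(2)[OF is_prime_p] is_subringD(6)[OF subring_T] by blast
    ultimately show "(q + t) * (w + x) - t * x \<in> W"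
      using submodD(2)[OF submod_W submodD(3)[OF submod_W _ that(2)] prime_smult_mem[OF that(1) x]] by simp
  qed
  moreover have "coset p t \<odot>\<^bsub>Q\<^esub> coset W x = (\<Union>q\<in>p. \<Union>w\<in>W. coset W ((q + t) * (w + x)))"
    by (simp add: Q_def quot_module_def coset_eq_image coset_def[of p] coset_def[of W x])
  ultimately show ?thesis using submodD(1)[OF submod_W] submodD(1)[OF is_primeD(1)[OF is_prime_p]] by auto
qed

lemma vectorspace_quot: "vectorspace K Q"
proof -
  interpret K: Ring.field K by (rule residue_field)
  note a = submodD(2)[OF V] and s = submodD(3)[OF V] and z = submodD(1)[OF V]
  have "abelian_group Q"
  proof (rule abelian_groupI)
    fix x assume "x \<in> carrier Q"
    then obtain v where v: "x = coset W v" "v \<in> V" by (auto simp: quot_carrier)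
    have "coset W (- v) \<in> carrier Q" unfolding quot_carrier using submod_uminus[OF subring_T V v(2)] by (rule imageI)
    moreover have "coset W (- v) \<oplus>\<^bsub>Q\<^esub> x = \<zero>\<^bsub>Q\<^esub>" unfolding v(1) quot_add quot_zero by simp
    ultimately show "\<exists>y\<in>carrier Q. y \<oplus>\<^bsub>Q\<^esub> x = \<zero>\<^bsub>Q\<^esub>" by blast
  qed (unfold quot_carrier quot_zero, use a z in \<open>auto simp: quot_add ac_simps\<close>)
  then have "module K Q"
  proof (intro moduleI K.is_cring)
    fix r x assume "r \<in> carrier K" "x \<in> carrier Q"
    then show "r \<odot>\<^bsub>Q\<^esub> x \<in> carrier Q" using s by (auto simp: residue_field_carrier quot_carrier quot_smult)
  next
    fix r t x assume "r \<in> carrier K" "t \<in> carrier K" "x \<in> carrier Q"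
    then obtain r' t' v where e: "r = coset p r'" "t = coset p t'" "x = coset W v" "r' \<in> T" "t' \<in> T" "v \<in> V"
      by (auto simp: residue_field_carrier quot_carrier)
    show "(r \<oplus>\<^bsub>K\<^esub> t) \<odot>\<^bsub>Q\<^esub> x = r \<odot>\<^bsub>Q\<^esub> x \<oplus>\<^bsub>Q\<^esub> t \<odot>\<^bsub>Q\<^esub> x"
      using e is_subringD(6)[OF subring_T] by (simp add: residue_field_ops quot_smult quot_add distrib_right)
    show "(r \<otimes>\<^bsub>K\<^esub> t) \<odot>\<^bsub>Q\<^esub> x = r \<odot>\<^bsub>Q\<^esub> (t \<odot>\<^bsub>Q\<^esub> x)"
      using e is_subringD(4)[OF subring_T] s by (simp add: residue_field_ops quot_smult mult.assoc)
  next
    fix r x y assume "r \<in> carrier K" "x \<in> carrier Q" "y \<in> carrier Q"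
    then obtain r' u v where e: "r = coset p r'" "x = coset W u" "y = coset W v" "r' \<in> T" "u \<in> V" "v \<in> V"
      by (auto simp: residue_field_carrier quot_carrier)
    then show "r \<odot>\<^bsub>Q\<^esub> (x \<oplus>\<^bsub>Q\<^esub> y) = r \<odot>\<^bsub>Q\<^esub> x \<oplus>\<^bsub>Q\<^esub> r \<odot>\<^bsub>Q\<^esub> y"
      using a by (simp add: quot_smult quot_add distrib_left)
  next
    fix x assume "x \<in> carrier Q"
    then show "\<one>\<^bsub>K\<^esub> \<odot>\<^bsub>Q\<^esub> x = x"
      using residue_field_ops(3)[OF orderD(6)[OF T] orderD(6)[OF T]] quot_smult[OF orderD(6)[OF T]] by (auto simp: quot_carrier)
  qed
  then show ?thesis using residue_field by (simp add: vectorspace_def)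
qed

lemma quot_gen_set_iff:
  assumes B: "finite B" "B \<subseteq> V"
  shows "module.span K Q (coset W ` B) = carrier Q \<longleftrightarrow> (\<forall>v\<in>V. \<exists>m\<in>genby T B. v - m \<in> W)"
proof -
  interpret vectorspace K Q by (rule vectorspace_quot)
  have BQ: "coset W ` B \<subseteq> carrier Q" using B(2) by (auto simp: quot_carrier)
  have gV: "genby T B \<subseteq> V" by (rule genby_least[OF V B(2)])
  note sG = submod_genby[OF submod_self[OF subring_T], of B]
  have "LinearCombinations.submodule K (coset W ` genby T B) Q"
    unfolding LinearCombinations.submodule_def
  proof (intro conjI allI impI)
    show "module K Q" by unfold_locales
    show "coset W ` genby T B \<subseteq> carrier Q" using gV by (auto simp: quot_carrier)
    show "\<zero>\<^bsub>Q\<^esub> \<in> coset W ` genby T B" unfolding quot_zero using submodD(1)[OF sG] by blast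
    show "v \<oplus>\<^bsub>Q\<^esub> w \<in> coset W ` genby T B" if "v \<in> coset W ` genby T B" "w \<in> coset W ` genby T B" for v w
    proof -
      obtain x y where "v = coset W x" "w = coset W y" "x \<in> genby T B" "y \<in> genby T B" using \<open>v \<in> _\<close> \<open>w \<in> _\<close> by blast
      then show ?thesis using submodD(2)[OF sG] by (auto simp: quot_add)
    qed
    show "c \<odot>\<^bsub>Q\<^esub> v \<in> coset W ` genby T B" if "c \<in> carrier K" "v \<in> coset W ` genby T B" for c v
    proof -
      obtain t x where "c = coset p t" "v = coset W x" "t \<in> T" "x \<in> genby T B"
        using \<open>c \<in> _\<close> \<open>v \<in> _\<close> unfolding residue_field_carrier by blast
      then show ?thesis using submodD(3)[OF sG] gV by (auto simp: quot_smult)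
    qed
  qed
  moreover have "coset W ` B \<subseteq> coset W ` genby T B" using genby_superset[OF subring_T B(1)] by blast
  ultimately have "span (coset W ` B) \<subseteq> coset W ` genby T B" by (intro span_is_subset)
  moreover have "coset W ` genby T B \<subseteq> span (coset W ` B)"
  proof -
    interpret S: LinearCombinations.submodule K "span (coset W ` B)" Q by (rule span_is_submodule[OF BQ])
    have "submod T {v\<in>V. coset W v \<in> span (coset W ` B)}"
      unfolding submod_def
    proof (intro conjI ballI CollectI; (elim CollectE conjE)?)
      show "coset W 0 \<in> span (coset W ` B)" using S.zero_closed unfolding quot_zero .
      show "coset W (x + y) \<in> span (coset W ` B)"
        if "coset W x \<in> span (coset W ` B)" "coset W y \<in> span (coset W ` B)" for x y
        using S.m_closed[OF that] unfolding quot_add .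
      show "coset W (r * x) \<in> span (coset W ` B)"
        if "r \<in> T" "x \<in> V" "coset W x \<in> span (coset W ` B)" for r x
        using S.smult_closed[of "coset p r" "coset W x"] that unfolding residue_field_carrier by (auto simp: quot_smult)
    qed (use submodD[OF V] in auto)
    moreover have "B \<subseteq> {v\<in>V. coset W v \<in> span (coset W ` B)}"
      using B(2) in_own_span[OF BQ] by blast
    ultimately have "genby T B \<subseteq> {v\<in>V. coset W v \<in> span (coset W ` B)}" by (rule genby_least)
    then show ?thesis by blast
  qed
  ultimately have "span (coset W ` B) = coset W ` genby T B" by blast
  then have "span (coset W ` B) = carrier Q \<longleftrightarrow> coset W ` genby T B = coset W ` V"
    by (simp only: quot_carrier)
  also have "\<dots> \<longleftrightarrow> coset W ` V \<subseteq> coset W ` genby T B"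
    using image_mono[OF gV, of "coset W"] by (simp only: set_eq_subset simp_thms)
  also have "\<dots> \<longleftrightarrow> (\<forall>v\<in>V. \<exists>m\<in>genby T B. coset W v = coset W m)"
    by (simp only: image_subset_iff image_iff)
  finally show ?thesis unfolding coset_eq_iff[OF subring_T submod_W] .
qed

lemma quot_dim_le:
  assumes B: "finite B" "B \<subseteq> V" "\<forall>v\<in>V. \<exists>m\<in>genby T B. v - m \<in> W"
  shows "vectorspace.dim K Q \<le> card B"
proof -
  interpret vectorspace K Q by (rule vectorspace_quot)
  have "dim \<le> card (coset W ` B)"
    unfolding dim_def using B quot_gen_set_iff[OF B(1,2)] by (intro Least_le exI[of _ "coset W ` B"]) (auto simp: quot_carrier)
  also have "\<dots> \<le> card B" using B(1) by (rule card_image_le)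
  finally show ?thesis .
qed

text \<open>\<open>dim\<close> is a least cardinality, attained as soon as some finite generating
  set exists. One representative is chosen per coset, which preserves the cardinality.\<close>

lemma quot_dim_generators:
  assumes B: "finite B" "V = genby T B"
  shows "\<exists>C. finite C \<and> card C = vectorspace.dim K Q \<and> C \<subseteq> V \<and> (\<forall>v\<in>V. \<exists>m\<in>genby T C. v - m \<in> W)"
proof -
  interpret vectorspace K Q by (rule vectorspace_quot)
  have BV: "B \<subseteq> V" using genby_superset[OF subring_T B(1)] B(2) by simp
  have "\<forall>v\<in>V. \<exists>m\<in>genby T B. v - m \<in> W" using submodD(1)[OF submod_W] B(2) by (metis diff_self)
  then have "gen_set (coset W ` B)" using quot_gen_set_iff[OF B(1) BV] by simp
  then have "\<exists>n A. finite A \<and> card A = n \<and> A \<subseteq> carrier Q \<and> gen_set A"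
    using B(1) BV by (intro exI[of _ "coset W ` B"] exI[of _ "card (coset W ` B)"]) (auto simp: quot_carrier)
  then have "\<exists>A. finite A \<and> card A = dim \<and> A \<subseteq> carrier Q \<and> gen_set A"
    unfolding dim_def by (rule LeastI_ex)
  then obtain A where A: "finite A" "card A = dim" "A \<subseteq> coset W ` V" "gen_set A" unfolding quot_carrier by blast
  obtain C where C: "C \<subseteq> V" "inj_on (coset W) C" "A = coset W ` C"
    using subset_image_inj[of A "coset W" V] A(3) by blast
  have "finite C" using A(1) C finite_imageD by blast
  moreover have "card C = dim" using A(2) C card_image by metis
  ultimately show ?thesis using C(1) A(4) quot_gen_set_iff[of C] C(3) by blast
qed

end

section \<open>The type at a prime and the local comparison of T with its trace dual\<close>

lemma type_at_le:
  assumes "order T" "p \<in> primes T" "finite B" "B \<subseteq> dual T"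
    "\<forall>v\<in>dual T. \<exists>m\<in>genby T B. v - m \<in> p \<cdot>\<^bsub>ambient\<^esub> dual T"
  shows "type_at Z j T p \<le> card B"
  unfolding type_at_def
  using quot_dim_le[OF assms(1,2) mult_idealD(3)[OF mult_ideal_dual[OF assms(1)]] refl refl refl assms(3-5)] .

lemma type_at_generators:
  assumes "order T" "p \<in> primes T"
  shows "\<exists>B. finite B \<and> card B = type_at Z j T p \<and> B \<subseteq> dual T \<and>
    (\<forall>v\<in>dual T. \<exists>m\<in>genby T B. v - m \<in> p \<cdot>\<^bsub>ambient\<^esub> dual T)"
proof -
  note d = mult_idealD[OF mult_ideal_dual[OF assms(1)]]
  obtain B where B: "finite B" "dual T = genby T B" using lattice_fg[OF assms(1) d(3,1)] by blast
  show ?thesis unfolding type_at_def by (rule quot_dim_generators[OF assms d(3) refl refl refl B])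
qed

text \<open>A single generator is paired with itself, with second coefficient 0.\<close>

lemma genby_pair:
  assumes "is_subring T" "finite B" "card B \<le> 2" "B \<noteq> {}"
  shows "\<exists>w1\<in>B. \<exists>w2\<in>B. \<forall>m\<in>genby T B. \<exists>a\<in>T. \<exists>b\<in>T. m = a * w1 + b * w2"
proof -
  have "0 < card B" using assms(2,4) by (simp add: card_gt_0_iff)
  then have "card B = 1 \<or> card B = 2" using assms(3) by linarith
  then show ?thesis
  proof
    assume "card B = 1"
    then obtain w where w: "B = {w}" by (auto simp: card_1_singleton_iff)
    have "\<exists>a\<in>T. \<exists>b\<in>T. m = a * w + b * w" if "m \<in> genby T B" for m
    proof -
      obtain c where "m = c w * w" "c w \<in> T" using \<open>m \<in> genby T B\<close> unfolding w genby_def by auto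
      then show ?thesis using is_subringD(2)[OF assms(1)] by (intro bexI[of _ "c w"] bexI[of _ 0]) auto
    qed
    then show ?thesis using w by blast
  next
    assume "card B = 2"
    then obtain w1 w2 where w: "B = {w1, w2}" "w1 \<noteq> w2" by (auto simp: card_2_iff)
    have "\<exists>a\<in>T. \<exists>b\<in>T. m = a * w1 + b * w2" if "m \<in> genby T B" for m
      using that w(2) unfolding w(1) genby_def by auto
    then show ?thesis using w by blast
  qed
qed

lemma type_at_le_one_iff:
  assumes T: "order T" and p: "p \<in> primes T"
  shows "type_at Z j T p \<le> 1 \<longleftrightarrow> loc_iso p T (dual T)"
  unfolding loc_iso_dual_iff_cyclic[OF T p]
proof
  note d = mult_idealD[OF mult_ideal_dual[OF T]]
  assume "type_at Z j T p \<le> 1"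
  then obtain B where B: "finite B" "card B \<le> 1" "B \<subseteq> dual T"
    "\<forall>v\<in>dual T. \<exists>m\<in>genby T B. v - m \<in> p \<cdot>\<^bsub>ambient\<^esub> dual T"
    using type_at_generators[OF T p] by auto
  \<comment> \<open>The zero vector serves as \<open>w\<close> if \<open>B\<close> is empty.\<close>
  then obtain w where w: "w \<in> dual T" "B \<subseteq> {w}"
    using submodD(1)[OF d(3)] by (metis card_le_Suc0_iff_eq insertCI insert_absorb One_nat_def subsetI subset_iff singletonI)
  have "genby T B \<subseteq> {a * w | a. a \<in> T}"
    using w(2) orderD(6)[OF T] by (intro genby_least submod_cyclic[OF orderD(1)[OF T]]) force
  then show "\<exists>w\<in>dual T. \<forall>v\<in>dual T. \<exists>a\<in>T. v - a * w \<in> p \<cdot>\<^bsub>ambient\<^esub> dual T"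
    using w(1) B(4) by blast
next
  assume "\<exists>w\<in>dual T. \<forall>v\<in>dual T. \<exists>a\<in>T. v - a * w \<in> p \<cdot>\<^bsub>ambient\<^esub> dual T"
  then obtain w where w: "w \<in> dual T" "\<forall>v\<in>dual T. \<exists>a\<in>T. v - a * w \<in> p \<cdot>\<^bsub>ambient\<^esub> dual T" by blast
  then have "\<forall>v\<in>dual T. \<exists>m\<in>genby T {w}. v - m \<in> p \<cdot>\<^bsub>ambient\<^esub> dual T"
    using genby_mult_mem[of "{w}" w _ T] is_subringD(2)[OF orderD(1)[OF T]] by blast
  then show "type_at Z j T p \<le> 1" using type_at_le[OF T p, of "{w}"] w(1) by simp
qed

text \<open>\<open>order_type\<close> is a \<open>Max\<close>, which bounds the single types only
  over a finite set. A finite generating set of T^t bounds them uniformly.\<close>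

lemma finite_types:
  assumes T: "order T"
  shows "finite (type_at Z j T ` primes T)"
proof -
  note d = mult_idealD[OF mult_ideal_dual[OF T]]
  obtain B where B: "finite B" "dual T = genby T B" using lattice_fg[OF T d(3,1)] by blast
  have "type_at Z j T p \<le> card B" if "p \<in> primes T" for p
  proof (rule type_at_le[OF T that B(1)])
    show "B \<subseteq> dual T" using genby_superset[OF orderD(1)[OF T] B(1)] B(2) by simp
    have "0 \<in> p \<cdot>\<^bsub>ambient\<^esub> dual T"
      using that primes_iff[OF T] submodD(1)[OF submod_ideal_prod[OF is_primeD(1) d(3)]] by blast
    then show "\<forall>v\<in>dual T. \<exists>m\<in>genby T B. v - m \<in> p \<cdot>\<^bsub>ambient\<^esub> dual T"
      unfolding B(2)[symmetric] by (metis diff_self)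
  qed
  then have "type_at Z j T ` primes T \<subseteq> {..card B}" by auto
  then show ?thesis using finite_subset by blast
qed

lemma loc_iso_dichotomy:
  assumes T: "order T" and p: "p \<in> primes T" and ty: "type_at Z j T p \<le> 2" and I: "mult_ideal T I"
  shows "loc_iso p I T \<or> loc_iso p I (dual T)"
proof -
  note d = mult_idealD[OF mult_ideal_dual[OF T]]
  obtain B where B: "finite B" "card B \<le> 2" "B \<subseteq> dual T"
    "\<forall>v\<in>dual T. \<exists>m\<in>genby T B. v - m \<in> p \<cdot>\<^bsub>ambient\<^esub> dual T"
    using type_at_generators[OF T p] ty by auto
  have "\<exists>w1\<in>dual T. \<exists>w2\<in>dual T. \<forall>m\<in>genby T B. \<exists>a\<in>T. \<exists>b\<in>T. m = a * w1 + b * w2"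
  proof (cases "B = {}")
    case True
    then show ?thesis using submodD(1)[OF d(3)] is_subringD(2)[OF orderD(1)[OF T]]
      by (intro bexI[of _ 0]) (auto simp: genby_def)
  next
    case False
    then show ?thesis using genby_pair[OF orderD(1)[OF T] B(1,2)] B(3) by blast
  qed
  then obtain w1 w2 where w: "w1 \<in> dual T" "w2 \<in> dual T"
    "\<forall>m\<in>genby T B. \<exists>a\<in>T. \<exists>b\<in>T. m = a * w1 + b * w2" by blast
  then show ?thesis using loc_iso_order_or_dual[OF T p I w(1,2)] B(4) by metis
qed

text \<open>Let \<open>c\<close> and \<open>e\<close> be nonzero scalars that multiply T^t into T
  and T into T^t. Their product lies in every prime at which the two are not locally isomorphic, and
  only finitely many primes contain it.\<close>

lemma finite_not_loc_iso_dual: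
  assumes T: "order T"
  shows "finite {p \<in> primes T. \<not> loc_iso p T (dual T)}"
proof -
  note d = mult_idealD[OF mult_ideal_dual[OF T]]
  obtain c where c: "c \<in> Z" "c \<noteq> 0" "j c \<in> colon T (dual T)"
    using latticeD(4)[OF lattice_colon[OF orderD(2)[OF T] d(1)]] by blast
  obtain e where e: "e \<in> Z" "e \<noteq> 0" "j e \<in> colon (dual T) T"
    using latticeD(4)[OF lattice_colon[OF d(1) orderD(2)[OF T]]] by blast
  define I where "I = {r * j (c * e) | r. r \<in> T}"
  have "j (c * e) \<in> T" using orderD(3)[OF T] Z_simps(4)[OF c(1) e(1)] by blast
  then have I: "submod T I" "I \<subseteq> T" "j (c * e) \<in> I"
    unfolding I_def using submod_cyclic[OF orderD(1)[OF T]] is_subringD(1,4)[OF orderD(1)[OF T]]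
    by (auto intro!: exI[of _ 1] simp del: j_simps(2))
  have "full I" by (rule full_ideal[OF T I(1) Z_simps(4)[OF c(1) e(1)] _ I(3)]) (use c e in auto)
  have "I \<subseteq> p" if "p \<in> {p \<in> primes T. \<not> loc_iso p T (dual T)}" for p
  proof -
    have sp: "submod T p" using that primes_iff[OF T] is_primeD(1) by blast
    have "j c * j e \<in> p" using that c(3) e(3) by (auto simp: loc_iso_def)
    then show ?thesis unfolding I_def using submodD(3)[OF sp] by auto
  qed
  then have "{p \<in> primes T. \<not> loc_iso p T (dual T)} \<subseteq> {p \<in> primes T. I \<subseteq> p}" by blast
  then show ?thesis using finite_primes_above[OF T I(1,2) \<open>full I\<close>] finite_subset by blast
qed

end

subsection \<open>Localizations and isomorphisms\<close>

text \<open>The operations on fractions are unions over representatives; this evaluates them once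
  independence of the representatives is known.\<close>

lemma UN_pairs_const:
  assumes "(a, b) \<in> A" "\<And>x s. (x, s) \<in> A \<Longrightarrow> F x s = C"
  shows "(\<Union>(x, s)\<in>A. F x s) = C"
  using assms by auto

section \<open>Calculus of fractions at a prime\<close>

context
  fixes S q :: "'k::comm_ring_1 set"
  assumes S: "is_subring S" and q: "is_prime S q"
begin

lemma denom_mult: "s \<in> S - q \<Longrightarrow> t \<in> S - q \<Longrightarrow> s * t \<in> S - q"
  using is_primeD(4)[OF q] is_subringD(4)[OF S] by blast

lemma denom_one: "1 \<in> S - q"
  using is_primeD(3)[OF q] is_subringD(1)[OF S] by blast

lemma loc_frac_eq_iff:
  assumes M: "submod S M" and x: "x \<in> M" "y \<in> M" "s \<in> S - q" "t \<in> S - q"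
  shows "loc_frac S q M x s = loc_frac S q M y t \<longleftrightarrow> (\<exists>u\<in>S - q. u * (t * x) = u * (s * y))"
proof
  assume "loc_frac S q M x s = loc_frac S q M y t"
  moreover have "(y, t) \<in> loc_frac S q M y t"
    using x denom_one unfolding loc_frac_def loc_rel_def by auto
  ultimately have "(y, t) \<in> loc_frac S q M x s" by simp
  then have "((x, s), (y, t)) \<in> loc_rel S q M" by (simp add: loc_frac_def)
  then show "\<exists>u\<in>S - q. u * (t * x) = u * (s * y)"
    unfolding loc_rel_def by (auto simp: right_diff_distrib)
next
  assume "\<exists>u\<in>S - q. u * (t * x) = u * (s * y)"
  then obtain u where u: "u \<in> S - q" "u * (t * x) = u * (s * y)" by blast
  have *: "loc_frac S q M x s \<subseteq> loc_frac S q M y t"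
    if "x \<in> M" "y \<in> M" "s \<in> S - q" "t \<in> S - q" "u \<in> S - q" "u * (t * x) = u * (s * y)" for x y s t u
  proof
    fix z assume "z \<in> loc_frac S q M x s"
    then obtain v k w where z: "z = (v, k)" "v \<in> M" "k \<in> S - q" "w \<in> S - q" "w * (k * x - s * v) = 0"
      unfolding loc_frac_def loc_rel_def by auto
    have "(w * u * s) * (k * y - t * v) = w * k * (u * (s * y)) - w * u * s * t * v" by (simp add: algebra_simps)
    also have "\<dots> = u * t * (w * (k * x - s * v))" unfolding that(6)[symmetric] by (simp add: algebra_simps)
    finally have "(w * u * s) * (k * y - t * v) = 0" using z(5) by simp
    moreover have "w * u * s \<in> S - q" using denom_mult that z by blast
    ultimately show "z \<in> loc_frac S q M y t"
      using that z unfolding loc_frac_def loc_rel_def by auto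
  qed
  show "loc_frac S q M x s = loc_frac S q M y t"
    using *[OF x u] *[OF x(2,1,4,3) u(1) u(2)[symmetric]] by blast
qed

lemma loc_frac_memD:
  assumes "(y, t) \<in> loc_frac S q M x s"
  shows "y \<in> M" "t \<in> S - q" "\<exists>u\<in>S - q. u * (t * x) = u * (s * y)"
  using assms unfolding loc_frac_def loc_rel_def by (auto simp: right_diff_distrib)

lemma loc_frac_self: "x \<in> M \<Longrightarrow> s \<in> S - q \<Longrightarrow> (x, s) \<in> loc_frac S q M x s"
  using denom_one unfolding loc_frac_def loc_rel_def by auto

lemma loc_carrier:
  "carrier (loc_module S q M) = {loc_frac S q M x s | x s. x \<in> M \<and> s \<in> S - q}"
  "carrier (loc_ring S q) = {loc_frac S q S x s | x s. x \<in> S \<and> s \<in> S - q}"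
  by (auto simp: loc_module_def loc_ring_def quotient_def loc_frac_def)

lemma loc_add_frac:
  assumes M: "submod S M" and x: "x \<in> M" "y \<in> M" "s \<in> S - q" "t \<in> S - q"
  shows "loc_add S q M (loc_frac S q M x s) (loc_frac S q M y t) = loc_frac S q M (t * x + s * y) (s * t)"
proof -
  note a = submodD(2)[OF M] and m = submodD(3)[OF M]
  have "loc_frac S q M (t' * x' + s' * y') (s' * t') = loc_frac S q M (t * x + s * y) (s * t)"
    if "(x', s') \<in> loc_frac S q M x s" "(y', t') \<in> loc_frac S q M y t" for x' y' s' t'
  proof -
    note 1 = loc_frac_memD[OF that(1)] and 2 = loc_frac_memD[OF that(2)]
    obtain u where u: "u \<in> S - q" "u * (s' * x) = u * (s * x')" using 1(3) by blast
    obtain v where v: "v \<in> S - q" "v * (t' * y) = v * (t * y')" using 2(3) by blast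
    have "(u * v) * ((s * t) * (t' * x' + s' * y')) = v * t * t' * (u * (s * x')) + u * s * s' * (v * (t * y'))"
      by (simp add: algebra_simps)
    also have "\<dots> = (u * v) * ((s' * t') * (t * x + s * y))"
      unfolding u(2)[symmetric] v(2)[symmetric] by (simp add: algebra_simps)
    finally show ?thesis
      using x 1 2 denom_mult u(1) v(1) by (intro loc_frac_eq_iff[OF M, THEN iffD2] a m) auto
  qed
  then show ?thesis
    unfolding loc_add_def by (intro UN_pairs_const[OF loc_frac_self] x)
qed

lemma loc_mult_frac:
  assumes M: "submod S M" and x: "a \<in> S" "x \<in> M" "s \<in> S - q" "t \<in> S - q"
  shows "loc_mult S q M (loc_frac S q S a s) (loc_frac S q M x t) = loc_frac S q M (a * x) (s * t)"
proof -
  note m = submodD(3)[OF M]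
  have "loc_frac S q M (a' * x') (s' * t') = loc_frac S q M (a * x) (s * t)"
    if "(a', s') \<in> loc_frac S q S a s" "(x', t') \<in> loc_frac S q M x t" for a' x' s' t'
  proof -
    note 1 = loc_frac_memD[OF that(1)] and 2 = loc_frac_memD[OF that(2)]
    obtain u where u: "u \<in> S - q" "u * (s' * a) = u * (s * a')" using 1(3) by blast
    obtain v where v: "v \<in> S - q" "v * (t' * x) = v * (t * x')" using 2(3) by blast
    have "(u * v) * ((s * t) * (a' * x')) = (u * (s * a')) * (v * (t * x'))" by (simp add: algebra_simps)
    also have "\<dots> = (u * v) * ((s' * t') * (a * x))"
      unfolding u(2)[symmetric] v(2)[symmetric] by (simp add: algebra_simps)
    finally show ?thesis
      using x 1 2 denom_mult u(1) v(1) by (intro loc_frac_eq_iff[OF M, THEN iffD2] m) auto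
  qed
  then show ?thesis
    unfolding loc_mult_def by (intro UN_pairs_const[OF loc_frac_self] x)
qed

text \<open>The isomorphism multiplies numerators by \<open>x\<close>. Its inverse multiplies
  numerators by \<open>y\<close> and denominators by \<open>x * y\<close>, which is a permitted
  denominator.\<close>

lemma module_isomorphic_loc:
  assumes I: "submod S I" and J: "submod S J"
    and x: "x \<in> colon J I" and y: "y \<in> colon I J" and xy: "x * y \<in> S - q"
  shows "module_isomorphic (loc_ring S q) (loc_module S q I) (loc_module S q J)"
proof -
  define f where "f A = (\<Union>(m, t)\<in>A. loc_frac S q J (x * m) t)" for A
  have xm: "x * m \<in> J" if "m \<in> I" for m using colonD[OF x that] .
  have ym: "y * m \<in> I" if "m \<in> J" for m using colonD[OF y that] .
  have f: "f (loc_frac S q I m t) = loc_frac S q J (x * m) t" if mt: "m \<in> I" "t \<in> S - q" for m t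
  proof -
    have "loc_frac S q J (x * m') t' = loc_frac S q J (x * m) t" if e: "(m', t') \<in> loc_frac S q I m t" for m' t'
    proof -
      note 1 = loc_frac_memD[OF e]
      obtain u where u: "u \<in> S - q" "u * (t' * m) = u * (t * m')" using 1(3) by blast
      have "u * (t * (x * m')) = x * (u * (t * m'))" by (simp add: ac_simps)
      also have "\<dots> = u * (t' * (x * m))" unfolding u(2)[symmetric] by (simp add: ac_simps)
      finally show ?thesis using 1 mt u(1) xm by (intro loc_frac_eq_iff[OF J, THEN iffD2]) auto
    qed
    then show ?thesis unfolding f_def by (intro UN_pairs_const[OF loc_frac_self] mt)
  qed
  have fcarr: "f A \<in> carrier (loc_module S q J)" if A: "A \<in> carrier (loc_module S q I)" for A
  proof -
    obtain m t where "A = loc_frac S q I m t" "m \<in> I" "t \<in> S - q" using A unfolding loc_carrier by blast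
    then have "f A = loc_frac S q J (x * m) t" "x * m \<in> J" "t \<in> S - q" using f xm by simp_all
    then show ?thesis unfolding loc_carrier by blast
  qed
  have "f \<in> LinearCombinations.module_hom (loc_ring S q) (loc_module S q I) (loc_module S q J)"
    unfolding LinearCombinations.module_hom_def mem_Collect_eq
  proof (intro conjI allI impI)
    show "f \<in> carrier (loc_module S q I) \<rightarrow> carrier (loc_module S q J)"
      using fcarr by blast
    fix A B assume "A \<in> carrier (loc_module S q I) \<and> B \<in> carrier (loc_module S q I)"
    then obtain m s n t where e: "A = loc_frac S q I m s" "B = loc_frac S q I n t" "m \<in> I" "n \<in> I"
      "s \<in> S - q" "t \<in> S - q" unfolding loc_carrier by blast
    have "t * m + s * n \<in> I" using e submodD(2)[OF I] submodD(3)[OF I] by blast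
    then have "f (loc_add S q I A B) = loc_frac S q J (x * (t * m + s * n)) (s * t)"
      unfolding e(1,2) loc_add_frac[OF I e(3-6)] using f denom_mult[OF e(5,6)] by blast
    also have "x * (t * m + s * n) = t * (x * m) + s * (x * n)" by (simp add: algebra_simps)
    finally show "f (A \<oplus>\<^bsub>loc_module S q I\<^esub> B) = f A \<oplus>\<^bsub>loc_module S q J\<^esub> f B"
      using f e loc_add_frac[OF J xm[OF e(3)] xm[OF e(4)] e(5,6)] by (simp add: loc_module_def)
  next
    fix R A assume "R \<in> carrier (loc_ring S q) \<and> A \<in> carrier (loc_module S q I)"
    then obtain r s m t where e: "R = loc_frac S q S r s" "A = loc_frac S q I m t" "r \<in> S" "m \<in> I"
      "s \<in> S - q" "t \<in> S - q" unfolding loc_carrier by blast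
    have "f (loc_mult S q I R A) = loc_frac S q J (x * (r * m)) (s * t)"
      unfolding e(1,2) loc_mult_frac[OF I e(3-6)] using f denom_mult[OF e(5,6)] submodD(3)[OF I e(3,4)] by blast
    also have "x * (r * m) = r * (x * m)" by (simp add: ac_simps)
    finally show "f (R \<odot>\<^bsub>loc_module S q I\<^esub> A) = R \<odot>\<^bsub>loc_module S q J\<^esub> f A"
      using f e loc_mult_frac[OF J e(3) xm[OF e(4)] e(5,6)] by (simp add: loc_module_def)
  qed
  moreover have "bij_betw f (carrier (loc_module S q I)) (carrier (loc_module S q J))"
    unfolding bij_betw_def
  proof
    show "inj_on f (carrier (loc_module S q I))"
    proof (rule inj_onI)
      fix A B assume "A \<in> carrier (loc_module S q I)" "B \<in> carrier (loc_module S q I)" and eq: "f A = f B"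
      then obtain m s n t where e: "A = loc_frac S q I m s" "B = loc_frac S q I n t" "m \<in> I" "n \<in> I"
        "s \<in> S - q" "t \<in> S - q" unfolding loc_carrier by blast
      then obtain u where u: "u \<in> S - q" "u * (t * (x * m)) = u * (s * (x * n))"
        using eq loc_frac_eq_iff[OF J xm[OF e(3)] xm[OF e(4)] e(5,6)] by (auto simp: f)
      have "(u * (x * y)) * (t * m) = y * (u * (t * (x * m)))" by (simp add: ac_simps)
      also have "\<dots> = (u * (x * y)) * (s * n)" unfolding u(2) by (simp add: ac_simps)
      finally show "A = B"
        unfolding e(1,2) using loc_frac_eq_iff[OF I e(3-6)] denom_mult[OF u(1) xy] by blast
    qed
    show "f ` carrier (loc_module S q I) = carrier (loc_module S q J)"
    proof
      show "f ` carrier (loc_module S q I) \<subseteq> carrier (loc_module S q J)"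
        using fcarr by blast
      show "carrier (loc_module S q J) \<subseteq> f ` carrier (loc_module S q I)"
      proof
        fix A assume "A \<in> carrier (loc_module S q J)"
        then obtain n t where e: "A = loc_frac S q J n t" "n \<in> J" "t \<in> S - q" unfolding loc_carrier by blast
        have "f (loc_frac S q I (y * n) (x * y * t)) = loc_frac S q J (x * (y * n)) (x * y * t)"
          using f[OF ym[OF e(2)] denom_mult[OF xy e(3)]] .
        also have "\<dots> = A" unfolding e(1)
          using xm[OF ym[OF e(2)]] e(2,3) denom_mult[OF xy e(3)] denom_one
          by (intro loc_frac_eq_iff[OF J, THEN iffD2] bexI[of _ 1]) (auto simp: ac_simps)
        finally show "A \<in> f ` carrier (loc_module S q I)"
          using ym[OF e(2)] denom_mult[OF xy e(3)] unfolding loc_carrier by blast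
      qed
    qed
  qed
  ultimately show ?thesis unfolding module_isomorphic_def by blast
qed

lemma inverse_loc_hom:
  assumes I: "submod S I" and J: "submod S J"
    and f: "f \<in> LinearCombinations.module_hom (loc_ring S q) (loc_module S q I) (loc_module S q J)"
    and b: "bij_betw f (carrier (loc_module S q I)) (carrier (loc_module S q J))"
  shows "inv_into (carrier (loc_module S q I)) f \<in>
    LinearCombinations.module_hom (loc_ring S q) (loc_module S q J) (loc_module S q I)"
proof -
  let ?I = "loc_module S q I" and ?J = "loc_module S q J" and ?R = "loc_ring S q"
  define g where "g = inv_into (carrier ?I) f"
  have g: "g B \<in> carrier ?I" "f (g B) = B" if "B \<in> carrier ?J" for B
    using that b inv_into_into[of B f "carrier ?I"] f_inv_into_f[of B f "carrier ?I"]
    unfolding g_def bij_betw_def by auto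
  have gf: "g (f A) = A" if "A \<in> carrier ?I" for A
    using that b inv_into_f_f unfolding g_def bij_betw_def by metis
  have add: "A \<oplus>\<^bsub>?I\<^esub> B \<in> carrier ?I" if AB: "A \<in> carrier ?I" "B \<in> carrier ?I" for A B
  proof -
    obtain m s n t where e: "A = loc_frac S q I m s" "B = loc_frac S q I n t" "m \<in> I" "n \<in> I"
      "s \<in> S - q" "t \<in> S - q" using AB unfolding loc_carrier by blast
    have "A \<oplus>\<^bsub>?I\<^esub> B = loc_frac S q I (t * m + s * n) (s * t)"
      using loc_add_frac[OF I e(3-6)] e(1,2) by (simp add: loc_module_def)
    moreover have "t * m + s * n \<in> I" using e submodD(2)[OF I] submodD(3)[OF I] by blast
    ultimately show ?thesis using denom_mult[OF e(5,6)] unfolding loc_carrier by blast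
  qed
  have smult: "R \<odot>\<^bsub>?I\<^esub> A \<in> carrier ?I" if RA: "R \<in> carrier ?R" "A \<in> carrier ?I" for R A
  proof -
    obtain r s m t where e: "R = loc_frac S q S r s" "A = loc_frac S q I m t" "r \<in> S" "m \<in> I"
      "s \<in> S - q" "t \<in> S - q" using RA unfolding loc_carrier by blast
    have "R \<odot>\<^bsub>?I\<^esub> A = loc_frac S q I (r * m) (s * t)"
      using loc_mult_frac[OF I e(3-6)] e(1,2) by (simp add: loc_module_def)
    then show ?thesis using denom_mult[OF e(5,6)] submodD(3)[OF I e(3,4)] unfolding loc_carrier by blast
  qed
  have fadd: "f (A \<oplus>\<^bsub>?I\<^esub> B) = f A \<oplus>\<^bsub>?J\<^esub> f B" if "A \<in> carrier ?I" "B \<in> carrier ?I" for A B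
    using f that unfolding LinearCombinations.module_hom_def by blast
  have fsm: "f (R \<odot>\<^bsub>?I\<^esub> A) = R \<odot>\<^bsub>?J\<^esub> f A" if "R \<in> carrier ?R" "A \<in> carrier ?I" for R A
    using f that unfolding LinearCombinations.module_hom_def by blast
  show ?thesis
    unfolding LinearCombinations.module_hom_def mem_Collect_eq g_def[symmetric]
  proof (intro conjI allI impI)
    show "g \<in> carrier ?J \<rightarrow> carrier ?I" using g(1) by blast
    fix A B assume "A \<in> carrier ?J \<and> B \<in> carrier ?J"
    then show "g (A \<oplus>\<^bsub>?J\<^esub> B) = g A \<oplus>\<^bsub>?I\<^esub> g B"
      using gf[OF add[of "g A" "g B"]] fadd[of "g A" "g B"] g[of A] g[of B] by simp
  next
    fix R A assume "R \<in> carrier ?R \<and> A \<in> carrier ?J"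
    then show "g (R \<odot>\<^bsub>?J\<^esub> A) = R \<odot>\<^bsub>?I\<^esub> g A"
      using gf[OF smult[of R "g A"]] fsm[of R "g A"] g[of A] by simp
  qed
qed

end

section \<open>Module homomorphisms as multiplications; weak equivalence\<close>

context dedekind_algebra
begin

text \<open>The value at one invertible scalar \<open>j d\<close> of \<open>I\<close> determines
  \<open>f\<close>, because each \<open>m\<close> in \<open>I\<close> becomes, after multiplication
  by a nonzero scalar from \<open>Z\<close>, a multiple of \<open>j d\<close> by an element of
  \<open>S\<close>. So \<open>f\<close> is multiplication by a fraction \<open>a / s\<close>, and
  \<open>w\<close> clears the denominators of \<open>a\<close> on finitely many generators of
  \<open>I\<close>.\<close>

lemma loc_hom_is_mult:
  assumes Sord: "order S" and q: "is_prime S q" and I: "submod S I" "lattice I" and J: "submod S J"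
    and f: "f \<in> LinearCombinations.module_hom (loc_ring S q) (loc_module S q I) (loc_module S q J)"
  shows "\<exists>a. \<exists>s\<in>S - q. (\<forall>m\<in>I. \<forall>n\<in>J. \<forall>t\<in>S - q. f (loc_frac S q I m 1) = loc_frac S q J n t \<longrightarrow>
      (\<exists>u\<in>S - q. u * (s * n) = u * (t * (a * m)))) \<and> (\<exists>w\<in>S - q. w * a \<in> colon J I)"
proof -
  note sub = orderD(1)[OF Sord]
  note d1 = denom_one[OF sub q] and dm = denom_mult[OF sub q]
  have fc: "f A \<in> carrier (loc_module S q J)" if "A \<in> carrier (loc_module S q I)" for A
    using f that unfolding LinearCombinations.module_hom_def by blast
  have fex: "\<exists>n\<in>J. \<exists>t\<in>S - q. f (loc_frac S q I m 1) = loc_frac S q J n t" if "m \<in> I" for m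
    using fc[of "loc_frac S q I m 1"] that d1 unfolding loc_carrier[OF sub q] by blast
  have fsm: "f (loc_frac S q I (r * m) 1) = loc_frac S q J (r * n) t"
    if "r \<in> S" "m \<in> I" "n \<in> J" "t \<in> S - q" "f (loc_frac S q I m 1) = loc_frac S q J n t" for r m n t
  proof -
    have c: "loc_frac S q S r 1 \<in> carrier (loc_ring S q)" "loc_frac S q I m 1 \<in> carrier (loc_module S q I)"
      using that d1 unfolding loc_carrier[OF sub q] by blast+
    then have "f (loc_frac S q S r 1 \<odot>\<^bsub>loc_module S q I\<^esub> loc_frac S q I m 1)
      = loc_frac S q S r 1 \<odot>\<^bsub>loc_module S q J\<^esub> f (loc_frac S q I m 1)"
      using f unfolding LinearCombinations.module_hom_def by blast
    then show ?thesis
      using loc_mult_frac[OF sub q I(1) that(1,2) d1 d1] loc_mult_frac[OF sub q J that(1,3) d1 that(4)] that(5)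
      by (simp add: loc_module_def)
  qed
  obtain d where d: "d \<in> Z" "d \<noteq> 0" "j d \<in> I" using latticeD(4)[OF I(2)] by blast
  obtain a0 s where as: "a0 \<in> J" "s \<in> S - q" "f (loc_frac S q I (j d) 1) = loc_frac S q J a0 s"
    using fex[OF d(3)] by blast
  \<comment> \<open>Since \<open>j d\<close> goes to the fraction \<open>a0 / s\<close>, the
    multiplier is \<open>a / s\<close> with \<open>a\<close> the quotient of \<open>a0\<close> by
    \<open>d\<close>, formed in \<open>K\<close>.\<close>
  define a where "a = j (inverse d) * a0"
  have a0: "a0 = j d * a" using j_inverse[OF d(2)] by (simp add: a_def mult.assoc[symmetric])
  have key: "\<exists>u\<in>S - q. u * (s * n) = u * (t * (a * m))"
    if m: "m \<in> I" "n \<in> J" "t \<in> S - q" "f (loc_frac S q I m 1) = loc_frac S q J n t" for m n t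
  proof -
    obtain e where e: "e \<in> Z" "e \<noteq> 0" "j e * (m * j (inverse d)) \<in> S"
      using latticeD(3)[OF orderD(2)[OF Sord]] by (auto simp: full_def)
    define k where "k = j e * (m * j (inverse d))"
    have kd: "k * j d = j e * m"
      using j_inverse[OF d(2)] by (simp add: k_def mult.assoc mult.commute[of "j (inverse d)"])
    have jeS: "j e \<in> S" using orderD(3)[OF Sord] e(1) by blast
    have "loc_frac S q J (j e * n) t = loc_frac S q J (k * a0) s"
      using fsm[OF jeS m] fsm[OF e(3)[folded k_def] d(3) as] kd by simp
    then obtain u where u: "u \<in> S - q" "u * (s * (j e * n)) = u * (t * (k * a0))"
      using loc_frac_eq_iff[OF sub q J submodD(3)[OF J jeS m(2)] submodD(3)[OF J e(3)[folded k_def] as(1)] m(3) as(2)]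
      by blast
    have "j e * (u * (s * n)) = u * (s * (j e * n))" by (simp add: ac_simps)
    also have "\<dots> = u * (t * ((k * j d) * a))" unfolding u(2) a0 by (simp add: ac_simps)
    also have "\<dots> = j e * (u * (t * (a * m)))" unfolding kd by (simp add: ac_simps)
    finally show ?thesis using u(1) j_cancel[OF e(2)] by blast
  qed
  have loc: "\<exists>w\<in>S - q. w * (a * m) \<in> J" if m: "m \<in> I" for m
  proof -
    obtain n t where nt: "n \<in> J" "t \<in> S - q" "f (loc_frac S q I m 1) = loc_frac S q J n t" using fex[OF m] by blast
    obtain u where u: "u \<in> S - q" "u * (s * n) = u * (t * (a * m))" using key[OF m nt] by blast
    have "(u * t) * (a * m) \<in> J"
      using submodD(3)[OF J _ submodD(3)[OF J _ nt(1)], of u s] u as(2) by (simp add: mult.assoc)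
    then show ?thesis using dm[OF u(1) nt(2)] by blast
  qed
  obtain B where B: "finite B" "I = genby S B" using lattice_fg[OF Sord I] by blast
  have BI: "B \<subseteq> I" using genby_superset[OF sub B(1)] B(2) by simp
  obtain w where w: "\<And>b. b \<in> B \<Longrightarrow> w b \<in> S - q \<and> w b * (a * b) \<in> J" using loc BI by (metis subsetD)
  define w0 where "w0 = (\<Prod>b\<in>B. w b)"
  have w0: "w0 \<in> S - q" unfolding w0_def using w by (intro is_prime_prod[OF q sub B(1)]) auto
  have "B \<subseteq> {m. w0 * a * m \<in> J}"
  proof
    fix b assume b: "b \<in> B"
    have "w0 = (\<Prod>b\<in>B - {b}. w b) * w b" unfolding w0_def using prod.remove[OF B(1) b, of w] by (simp add: mult.commute)
    moreover have "(\<Prod>b\<in>B - {b}. w b) \<in> S" using is_prime_prod[OF q sub, of "B - {b}" w] w B(1) by auto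
    ultimately show "b \<in> {m. w0 * a * m \<in> J}" using submodD(3)[OF J _ w[OF b, THEN conjunct2]] by (simp add: mult.assoc)
  qed
  moreover have "submod S {m. w0 * a * m \<in> J}"
    using J unfolding submod_def by (auto simp: distrib_left) (metis mult.left_commute)
  ultimately have "I \<subseteq> {m. w0 * a * m \<in> J}" unfolding B(2) by (intro genby_least)
  then have "w0 * a \<in> colon J I" by (auto simp: colon_def)
  then show ?thesis using key as(2) w0 by blast
qed

text \<open>The isomorphism is multiplication by \<open>a / s\<close> and its inverse by
  \<open>c / r\<close>. Following \<open>j d\<close> there and back gives
  \<open>a * c = s * r\<close> up to a denominator \<open>h\<close>.\<close>

lemma module_isomorphic_loc_imp:
  assumes Sord: "order S" and q: "is_prime S q" and I: "submod S I" "lattice I" and J: "submod S J" "lattice J"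
    and iso: "module_isomorphic (loc_ring S q) (loc_module S q I) (loc_module S q J)"
  shows "\<exists>x\<in>colon J I. \<exists>y\<in>colon I J. x * y \<in> S - q"
proof -
  note sub = orderD(1)[OF Sord]
  note d1 = denom_one[OF sub q] and dm = denom_mult[OF sub q]
  obtain f where f: "f \<in> LinearCombinations.module_hom (loc_ring S q) (loc_module S q I) (loc_module S q J)"
    and b: "bij_betw f (carrier (loc_module S q I)) (carrier (loc_module S q J))"
    using iso unfolding module_isomorphic_def by blast
  define g where "g = inv_into (carrier (loc_module S q I)) f"
  have g: "g \<in> LinearCombinations.module_hom (loc_ring S q) (loc_module S q J) (loc_module S q I)"
    unfolding g_def by (rule inverse_loc_hom[OF sub q I(1) J(1) f b])
  have gf: "g (f A) = A" if "A \<in> carrier (loc_module S q I)" for A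
    using that b inv_into_f_f unfolding g_def bij_betw_def by metis
  obtain a s w where a: "s \<in> S - q" "w \<in> S - q" "w * a \<in> colon J I" and fa:
    "\<And>m n t. m \<in> I \<Longrightarrow> n \<in> J \<Longrightarrow> t \<in> S - q \<Longrightarrow> f (loc_frac S q I m 1) = loc_frac S q J n t \<Longrightarrow>
      \<exists>u\<in>S - q. u * (s * n) = u * (t * (a * m))"
    using loc_hom_is_mult[OF Sord q I J(1) f] by blast
  obtain c r v where c: "r \<in> S - q" "v \<in> S - q" "v * c \<in> colon I J" and gc:
    "\<And>m n t. m \<in> J \<Longrightarrow> n \<in> I \<Longrightarrow> t \<in> S - q \<Longrightarrow> g (loc_frac S q J m 1) = loc_frac S q I n t \<Longrightarrow>
      \<exists>u\<in>S - q. u * (r * n) = u * (t * (c * m))"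
    using loc_hom_is_mult[OF Sord q J I(1) g] by blast
  obtain d where d: "d \<in> Z" "d \<noteq> 0" "j d \<in> I" using latticeD(4)[OF I(2)] by blast
  have dc: "loc_frac S q I (j d) 1 \<in> carrier (loc_module S q I)"
    using d(3) d1 unfolding loc_carrier[OF sub q] by blast
  then have "f (loc_frac S q I (j d) 1) \<in> carrier (loc_module S q J)"
    using f unfolding LinearCombinations.module_hom_def by blast
  then obtain n t where nt: "n \<in> J" "t \<in> S - q" "f (loc_frac S q I (j d) 1) = loc_frac S q J n t"
    unfolding loc_carrier[OF sub q] by blast
  obtain u where u: "u \<in> S - q" "u * (s * n) = u * (t * (a * j d))" using fa[OF d(3) nt] by blast
  have nc: "loc_frac S q J n 1 \<in> carrier (loc_module S q J)" using nt(1) d1 unfolding loc_carrier[OF sub q] by blast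
  then have "g (loc_frac S q J n 1) \<in> carrier (loc_module S q I)"
    using g unfolding LinearCombinations.module_hom_def by blast
  then obtain m t' where mt: "m \<in> I" "t' \<in> S - q" "g (loc_frac S q J n 1) = loc_frac S q I m t'"
    unfolding loc_carrier[OF sub q] by blast
  obtain u' where u': "u' \<in> S - q" "u' * (r * m) = u' * (t' * (c * n))" using gc[OF nt(1) mt] by blast
  have oneS: "1 \<in> S" using is_subringD(1)[OF sub] .
  have "loc_frac S q S 1 t \<in> carrier (loc_ring S q)" using oneS nt(2) unfolding loc_carrier[OF sub q] by blast
  then have "g (loc_frac S q S 1 t \<odot>\<^bsub>loc_module S q J\<^esub> loc_frac S q J n 1)
      = loc_frac S q S 1 t \<odot>\<^bsub>loc_module S q I\<^esub> g (loc_frac S q J n 1)"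
    using g nc unfolding LinearCombinations.module_hom_def by blast
  then have "g (loc_frac S q J n t) = loc_frac S q I m (t * t')"
    using loc_mult_frac[OF sub q J(1) oneS nt(1) nt(2) d1] loc_mult_frac[OF sub q I(1) oneS mt(1) nt(2) mt(2)] mt(3)
    by (simp add: loc_module_def)
  then have "loc_frac S q I (j d) 1 = loc_frac S q I m (t * t')" using gf[OF dc] nt(3) by simp
  then obtain e where e: "e \<in> S - q" "e * ((t * t') * j d) = e * (1 * m)"
    using loc_frac_eq_iff[OF sub q I(1) d(3) mt(1) d1 dm[OF nt(2) mt(2)]] by blast
  \<comment> \<open>Collects the denominators met on the way from \<open>j d\<close> to
    \<open>n / t\<close> and back.\<close>
  define h where "h = u * u' * e * t * t'"
  have "h \<in> S - q" unfolding h_def by (intro dm u(1) u'(1) e(1) nt(2) mt(2))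
  have "j d * (h * (a * c)) = u' * e * t' * c * (u * (t * (a * j d)))" by (simp add: h_def ac_simps)
  also have "\<dots> = u * e * s * (u' * (t' * (c * n)))" unfolding u(2)[symmetric] by (simp add: ac_simps)
  also have "\<dots> = u * u' * s * r * (e * (1 * m))" unfolding u'(2)[symmetric] by (simp add: ac_simps)
  also have "\<dots> = j d * (h * (s * r))" unfolding e(2)[symmetric] by (simp add: h_def ac_simps)
  finally have hac: "h * (a * c) = h * (s * r)" using j_cancel[OF d(2)] by blast
  have "h * (w * a) \<in> colon J I" using submodD(3)[OF submod_colon[OF J(1)] _ a(3)] \<open>h \<in> S - q\<close> by blast
  moreover have "(h * (w * a)) * (v * c) = (w * v) * (h * (s * r))" unfolding hac[symmetric] by (simp add: ac_simps)
  moreover have "(w * v) * (h * (s * r)) \<in> S - q" by (intro dm a(1,2) c(1,2) \<open>h \<in> S - q\<close>)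
  ultimately show ?thesis using c(3) by metis
qed

text \<open>
  A suitable \<open>x\<close> is found by the Chinese remainder theorem for the finitely many primes of \<open>T\<close>
  above \<open>q\<close>; then \<open>x (I : J) + q T = T\<close>, and Nakayama's lemma over \<open>S\<close> applies.
\<close>

lemma loc_iso_imp_loc_unit:
  assumes Sord: "order S" and T: "order T" and ST: "S \<subseteq> T" and q: "q \<in> primes S"
    and I: "mult_ideal T I" and J: "mult_ideal T J" and loc: "\<And>p. p \<in> primes T \<Longrightarrow> loc_iso p J I"
  shows "\<exists>x\<in>colon J I. \<exists>y\<in>colon I J. x * y \<in> S - q"
proof -
  have pq: "is_prime S q" "full q" using q primes_iff[OF Sord] by auto
  note sT = orderD(1)[OF T]
  define qT where "qT = q \<cdot>\<^bsub>ambient\<^esub> T"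
  have qT_sub: "submod T qT"
  proof -
    have "qT = T \<cdot>\<^bsub>ambient\<^esub> q"
    proof
      show "qT \<subseteq> T \<cdot>\<^bsub>ambient\<^esub> q" unfolding qT_def
        using ideal_prod_mem[of _ T _ q] by (intro ideal_prod_least[OF submod_ideal_prod[OF orderD(5)[OF T] is_primeD(1)[OF pq(1)]]])
          (metis mult.commute)
      show "T \<cdot>\<^bsub>ambient\<^esub> q \<subseteq> qT" unfolding qT_def
        using ideal_prod_mem[of _ q _ T] by (intro ideal_prod_least[OF submod_ideal_prod[OF is_primeD(1)[OF pq(1)] orderD(5)[OF T]]])
          (metis mult.commute)
    qed
    then show ?thesis using submod_ideal_prod[OF orderD(5)[OF T] is_primeD(1)[OF pq(1)]] by simp
  qed
  have q_qT: "q \<subseteq> qT" unfolding qT_def using ideal_prod_mem[OF _ orderD(6)[OF T], of _ q] by auto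
  have qT_T: "qT \<subseteq> T" unfolding qT_def using is_primeD(2)[OF pq(1)] ST is_subringD(4)[OF sT]
    by (intro ideal_prod_least[OF orderD(5)[OF T]]) auto
  have qT_full: "full qT" using full_mono[OF pq(2) q_qT] .
  define F where "F = {p \<in> primes T. qT \<subseteq> p}"
  have F: "finite F" unfolding F_def by (rule finite_primes_above[OF T qT_sub qT_T qT_full])
  have Fp: "is_prime T p" if "p \<in> F" for p using that primes_iff[OF T] by (auto simp: F_def)
  have "\<forall>p\<in>F. \<exists>x y. x \<in> colon J I \<and> y \<in> colon I J \<and> x * y \<notin> p"
    using loc unfolding F_def loc_iso_def by blast
  then obtain x y where xy: "\<And>p. p \<in> F \<Longrightarrow> x p \<in> colon J I \<and> y p \<in> colon I J \<and> x p * y p \<notin> p" by metis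
  \<comment> \<open>The coefficients for the Chinese remainder theorem: outside \<open>p\<close> but
    inside all other primes of \<open>F\<close>.\<close>
  have "\<exists>e\<in>T - p. \<forall>p'\<in>F - {p}. e \<in> p'" if p: "p \<in> F" for p
  proof -
    have "\<forall>p'\<in>F - {p}. \<exists>z. z \<in> p' - p" using primes_subset_eq[OF T] p unfolding F_def by blast
    then obtain z where z: "\<And>p'. p' \<in> F - {p} \<Longrightarrow> z p' \<in> p' - p" by metis
    have fin: "finite (F - {p})" using F by simp
    have zT: "z p' \<in> T - p" if "p' \<in> F - {p}" for p'
      using z[OF that] is_primeD(2)[OF Fp[of p']] that by blast
    have "(\<Prod>p'\<in>F - {p}. z p') \<in> T - p" using is_prime_prod[OF Fp[OF p] sT fin zT] .
    moreover have "(\<Prod>p'\<in>F - {p}. z p') \<in> p'" if p': "p' \<in> F - {p}" for p'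
    proof -
      have "(\<Prod>p'\<in>F - {p} - {p'}. z p') \<in> T"
        using is_prime_prod[OF Fp[OF p] sT, of "F - {p} - {p'}" z] fin zT by blast
      then have "z p' * (\<Prod>p'\<in>F - {p} - {p'}. z p') \<in> p'"
        using submodD(4)[OF is_primeD(1)[OF Fp[of p']]] z[OF p'] p' by blast
      then show ?thesis using prod.remove[OF fin p', of z] by simp
    qed
    ultimately show ?thesis by blast
  qed
  then obtain e where e: "\<And>p. p \<in> F \<Longrightarrow> e p \<in> T - p \<and> (\<forall>p'\<in>F - {p}. e p \<in> p')" by metis
  define x0 where "x0 = (\<Sum>p\<in>F. e p * x p)"
  have sc: "submod T (colon J I)" "submod T (colon I J)"
    using submod_colon mult_idealD(3) I J by blast+
  have x0: "x0 \<in> colon J I" unfolding x0_def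
    using e xy by (intro submod_sum[OF sc(1)] submodD(3)[OF sc(1)]) auto
  have prodT: "a * b \<in> T" if "a \<in> colon J I" "b \<in> colon I J" for a b
    using colon_trans[OF that] mult_idealD(2)[OF J] by simp
  have notin: "x0 * y p \<notin> p" if p: "p \<in> F" for p
  proof
    assume a: "x0 * y p \<in> p"
    note sp = is_primeD(1)[OF Fp[OF p]]
    have "(\<Sum>p'\<in>F - {p}. e p' * (x p' * y p)) \<in> p"
    proof (rule submod_sum[OF sp])
      fix p' assume "p' \<in> F - {p}"
      then have "e p' \<in> p" "x p' * y p \<in> T" using e[of p'] p prodT xy[of p'] xy[OF p] by auto
      then show "e p' * (x p' * y p) \<in> p" using submodD(4)[OF sp] by blast
    qed
    moreover have "x0 * y p = e p * (x p * y p) + (\<Sum>p'\<in>F - {p}. e p' * (x p' * y p))"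
      unfolding x0_def sum_distrib_right using sum.remove[OF F p, of "\<lambda>p'. e p' * x p' * y p"] by (simp add: mult.assoc)
    ultimately have "e p * (x p * y p) \<in> p" using submod_diff[OF sT sp a] by fastforce
    then show False using is_primeD(4)[OF Fp[OF p]] e[OF p] xy[OF p] prodT by blast
  qed
  define N where "N = (*) x0 ` colon I J"
  have N: "submod T N" unfolding N_def by (rule submod_scale[OF sc(2)])
  have NT: "N \<subseteq> T" unfolding N_def using prodT[OF x0] by auto
  define M where "M = {m + n | m n. m \<in> N \<and> n \<in> qT}"
  have M: "submod T M" unfolding M_def by (rule submod_plus[OF N qT_sub])
  have MI: "m + n \<in> M" if "m \<in> N" "n \<in> qT" for m n using that unfolding M_def by blast
  have NM: "N \<subseteq> M" "qT \<subseteq> M"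
    using MI[of _ 0] MI[of 0] submodD(1)[OF N] submodD(1)[OF qT_sub] by auto
  have MT: "M \<subseteq> T" unfolding M_def using NT qT_T is_subringD(6)[OF sT] by blast
  \<comment> \<open>A prime that contains \<open>qT\<close> belongs to \<open>F\<close>, and there
    \<open>x0 * y p\<close> escapes it.\<close>
  have "1 \<in> M"
  proof (rule ideal_eq_order[OF T M MT full_mono[OF qT_full NM(2)]])
    fix p assume p: "p \<in> primes T"
    show "\<not> M \<subseteq> p"
    proof
      assume Mp: "M \<subseteq> p"
      then have pF: "p \<in> F" using NM(2) p by (auto simp: F_def)
      have "x0 * y p \<in> N" unfolding N_def using xy[OF pF] by blast
      then show False using notin[OF pF] NM(1) Mp by blast
    qed
  qed
  then obtain m n where mn: "1 = m + n" "m \<in> N" "n \<in> qT" unfolding M_def by blast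
  have "\<exists>n\<in>N. v - n \<in> q \<cdot>\<^bsub>ambient\<^esub> T" if v: "v \<in> T" for v
  proof
    show "v * m \<in> N" by (rule submodD(3)[OF N v mn(2)])
    have "v - v * m = v * (m + n) - v * m" unfolding mn(1)[symmetric] by simp
    also have "\<dots> = v * n" by (simp add: algebra_simps)
    finally show "v - v * m \<in> q \<cdot>\<^bsub>ambient\<^esub> T" using submodD(3)[OF qT_sub v mn(3)] by (simp add: qT_def)
  qed
  then obtain s where s: "s \<in> S - q" "\<forall>v\<in>T. s * v \<in> N"
    using local_nakayama[OF Sord pq(1) submod_mono[OF orderD(5)[OF T] ST] orderD(2)[OF T] submod_mono[OF N ST]] by blast
  then have "s * 1 \<in> N" using orderD(6)[OF T] by blast
  then obtain y where "s = x0 * y" "y \<in> colon I J" unfolding N_def by auto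
  then show ?thesis using x0 s(1) by blast
qed

text \<open>If the localizations at all primes of \<open>S\<close> are isomorphic, then (J : I)(I :
  J) meets \<open>S\<close> in an ideal that lies in no prime of \<open>S\<close>; so it contains 1
  and lies in no prime of \<open>T\<close>. The converse rests on
  \<open>loc_iso_imp_loc_unit\<close>.\<close>

lemma weakly_equivalent_iff:
  assumes Sord: "order S" and T: "order T" and ST: "S \<subseteq> T" and I: "mult_ideal T I" and J: "mult_ideal T J"
  shows "weakly_equivalent Z j S I J \<longleftrightarrow> (\<forall>p\<in>primes T. loc_iso p I J)"
proof
  have sI: "submod S I" "submod S J" using submod_mono[OF mult_idealD(3) ST] I J by blast+
  {
    assume "\<forall>p\<in>primes T. loc_iso p I J"
    then have loc: "loc_iso p J I" if "p \<in> primes T" for p using that loc_iso_sym by blast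
    show "weakly_equivalent Z j S I J" unfolding weakly_equivalent_def
    proof
      fix q assume q: "q \<in> primes S"
      then have pq: "is_prime S q" using primes_iff[OF Sord] by blast
      show "module_isomorphic (loc_ring S q) (loc_module S q I) (loc_module S q J)"
        using loc_iso_imp_loc_unit[OF Sord T ST q I J loc] module_isomorphic_loc[OF orderD(1)[OF Sord] pq sI] by blast
    qed
  }
  assume we: "weakly_equivalent Z j S I J"
  have unit: "\<exists>x\<in>colon J I. \<exists>y\<in>colon I J. x * y \<in> S - q" if "q \<in> primes S" for q
    using that we module_isomorphic_loc_imp[OF Sord _ sI(1) mult_idealD(1)[OF I] sI(2) mult_idealD(1)[OF J]]
      primes_iff[OF Sord] unfolding weakly_equivalent_def by blast
  define M where "M = colon J I \<cdot>\<^bsub>ambient\<^esub> colon I J"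
  have M: "submod T M" unfolding M_def
    using submod_ideal_prod[OF submod_colon[OF mult_idealD(3)[OF J]] submod_colon[OF mult_idealD(3)[OF I]]] .
  have lM: "lattice M" unfolding M_def using lattice_ideal_prod lattice_colon mult_idealD(1) I J by blast
  obtain d where d: "d \<in> Z" "d \<noteq> 0" "j d \<in> M" using latticeD(4)[OF lM] by blast
  have sMS: "submod S (M \<inter> S)" using submod_Int[OF submod_mono[OF M ST] orderD(5)[OF Sord]] .
  have "1 \<in> M \<inter> S"
  proof (rule ideal_eq_order[OF Sord sMS])
    show "full (M \<inter> S)" using full_ideal[OF Sord sMS d(1,2)] d(1,3) orderD(3)[OF Sord] by blast
    show "\<not> M \<inter> S \<subseteq> q" if "q \<in> primes S" for q
      using unit[OF that] ideal_prod_mem[of _ "colon J I" _ "colon I J"] unfolding M_def by blast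
  qed simp
  then have 1: "1 \<in> M" by simp
  show "\<forall>p\<in>primes T. loc_iso p I J"
  proof (rule ballI, rule ccontr)
    fix p assume p: "p \<in> primes T" and n: "\<not> loc_iso p I J"
    then have pp: "is_prime T p" using primes_iff[OF T] by blast
    have "x * y \<in> p" if "x \<in> colon J I" "y \<in> colon I J" for x y
      using n that unfolding loc_iso_def by (metis mult.commute)
    then have "M \<subseteq> p" unfolding M_def by (intro ideal_prod_least[OF is_primeD(1)[OF pp]])
    then show False using 1 is_primeD(3)[OF pp] by blast
  qed
qed

text \<open>A linear map is multiplication by the \<alpha> read off from its value at an invertible
  scalar \<open>j d\<close>. Surjectivity gives \<open>j c = \<alpha> * m\<close> with
  \<open>c\<close> nonzero, so \<alpha> is a unit of \<open>K\<close>.\<close>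

lemma ideal_isomorphic_iff:
  assumes Sord: "order S" and I: "submod S I" "lattice I" and J: "submod S J" "lattice J"
  shows "ideal_isomorphic S I J \<longleftrightarrow> (\<exists>\<alpha> \<beta>. \<alpha> * \<beta> = 1 \<and> J = (*) \<alpha> ` I)"
proof
  assume "\<exists>\<alpha> \<beta>. \<alpha> * \<beta> = 1 \<and> J = (*) \<alpha> ` I"
  then obtain \<alpha> \<beta> where ab: "\<alpha> * \<beta> = 1" "J = (*) \<alpha> ` I" by blast
  have "inj ((*) \<alpha>)"
  proof (rule injI)
    fix x y assume "\<alpha> * x = \<alpha> * y"
    then have "(\<alpha> * \<beta>) * x = (\<alpha> * \<beta>) * y" by (metis mult.assoc mult.commute)
    then show "x = y" using ab(1) by simp
  qed
  then have "bij_betw ((*) \<alpha>) I J" unfolding bij_betw_def ab(2) using inj_on_subset by blast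
  moreover have "(*) \<alpha> \<in> LinearCombinations.module_hom (ring_on S) (module_on I) (module_on J)"
    unfolding LinearCombinations.module_hom_def module_on_def using ab(2) by (auto simp: distrib_left mult.left_commute)
  ultimately show "ideal_isomorphic S I J"
    unfolding ideal_isomorphic_def module_isomorphic_def by (auto simp: module_on_def)
next
  assume "ideal_isomorphic S I J"
  then obtain f where f: "f \<in> LinearCombinations.module_hom (ring_on S) (module_on I) (module_on J)"
    and b: "bij_betw f I J"
    unfolding ideal_isomorphic_def module_isomorphic_def by (auto simp: module_on_def)
  have fs: "f (r * m) = r * f m" if "r \<in> S" "m \<in> I" for r m
    using f that unfolding LinearCombinations.module_hom_def module_on_def by simp
  obtain d where d: "d \<in> Z" "d \<noteq> 0" "j d \<in> I" using latticeD(4)[OF I(2)] by blast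
  define \<alpha> where "\<alpha> = j (inverse d) * f (j d)"
  have fd: "f (j d) = j d * \<alpha>" using j_inverse[OF d(2)] by (simp add: \<alpha>_def mult.assoc[symmetric])
  have fm: "f m = \<alpha> * m" if m: "m \<in> I" for m
  proof -
    obtain e where e: "e \<in> Z" "e \<noteq> 0" "j e * (m * j (inverse d)) \<in> S"
      using latticeD(3)[OF orderD(2)[OF Sord]] by (auto simp: full_def)
    define k where "k = j e * (m * j (inverse d))"
    have kd: "k * j d = j e * m"
      using j_inverse[OF d(2)] by (simp add: k_def mult.assoc mult.commute[of "j (inverse d)"])
    have "j e * f m = f (j e * m)" using fs[of "j e" m] orderD(3)[OF Sord] e(1) m by auto
    also have "\<dots> = k * f (j d)" unfolding kd[symmetric] using fs[OF e(3)[folded k_def] d(3)] .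
    also have "\<dots> = (k * j d) * \<alpha>" unfolding fd by (simp add: mult.assoc)
    also have "\<dots> = j e * (\<alpha> * m)" unfolding kd by (simp add: ac_simps)
    finally show ?thesis using j_cancel[OF e(2)] by blast
  qed
  have JI: "J = (*) \<alpha> ` I" using b fm unfolding bij_betw_def by (metis (no_types, lifting) image_cong)
  obtain c where c: "c \<in> Z" "c \<noteq> 0" "j c \<in> J" using latticeD(4)[OF J(2)] by blast
  then obtain m where m: "j c = \<alpha> * m" unfolding JI by blast
  have "\<alpha> * (m * j (inverse c)) = j c * j (inverse c)" by (simp add: m mult.assoc)
  then have "\<alpha> * (m * j (inverse c)) = 1" using j_inverse[OF c(2)] by simp
  then show "\<exists>\<alpha> \<beta>. \<alpha> * \<beta> = 1 \<and> J = (*) \<alpha> ` I" using JI by blast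
qed

end

subsection \<open>Counting classes\<close>

lemma quotient_kernel_eqpoll:
  assumes "\<And>x y. x \<in> A \<Longrightarrow> y \<in> A \<Longrightarrow> R x y \<longleftrightarrow> g x = g y"
  shows "A // {(x, y). x \<in> A \<and> y \<in> A \<and> R x y} \<approx> g ` A"
proof -
  have cls: "{(x, y). x \<in> A \<and> y \<in> A \<and> R x y} `` {x} = {y\<in>A. g y = g x}" if "x \<in> A" for x
    using assms that by auto
  have "bij_betw (\<lambda>c. {y\<in>A. g y = c}) (g ` A) (A // {(x, y). x \<in> A \<and> y \<in> A \<and> R x y})"
    unfolding bij_betw_def
  proof
    show "inj_on (\<lambda>c. {y\<in>A. g y = c}) (g ` A)" by (rule inj_onI) blast
    show "(\<lambda>c. {y\<in>A. g y = c}) ` (g ` A) = A // {(x, y). x \<in> A \<and> y \<in> A \<and> R x y}"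
      unfolding quotient_def using cls by auto
  qed
  then show ?thesis using eqpoll_def eqpoll_sym by blast
qed

lemma ideal_prod_scale: "((*) a ` L) \<cdot>\<^bsub>ambient\<^esub> I = (*) a ` (L \<cdot>\<^bsub>ambient\<^esub> I)"
proof
  show "((*) a ` L) \<cdot>\<^bsub>ambient\<^esub> I \<subseteq> (*) a ` (L \<cdot>\<^bsub>ambient\<^esub> I)"
  proof
    fix x assume "x \<in> ((*) a ` L) \<cdot>\<^bsub>ambient\<^esub> I"
    then show "x \<in> (*) a ` (L \<cdot>\<^bsub>ambient\<^esub> I)"
    proof (induction rule: ideal_prod.induct)
      case (prod i k)
      then show ?case using ideal_prod_mem[of _ L k I] by (auto simp: mult.assoc)
    next
      case (sum x y)
      then obtain u v where "x = a * u" "y = a * v" "u \<in> L \<cdot>\<^bsub>ambient\<^esub> I" "v \<in> L \<cdot>\<^bsub>ambient\<^esub> I" by blast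
      then show ?case using ideal_prod.sum[of u ambient L I v] by (auto simp flip: distrib_left)
    qed
  qed
  show "(*) a ` (L \<cdot>\<^bsub>ambient\<^esub> I) \<subseteq> ((*) a ` L) \<cdot>\<^bsub>ambient\<^esub> I"
  proof safe
    fix x assume "x \<in> L \<cdot>\<^bsub>ambient\<^esub> I"
    then show "a * x \<in> ((*) a ` L) \<cdot>\<^bsub>ambient\<^esub> I"
    proof (induction rule: ideal_prod.induct)
      case (prod i k)
      then show ?case using ideal_prod_mem[of "a * i" "(*) a ` L" k I] by (auto simp: mult.assoc)
    next
      case (sum x y)
      then show ?case using ideal_prod.sum[OF sum.IH] by (simp add: distrib_left)
    qed
  qed
qed

section \<open>The action of invertible ideals on isomorphism classes\<close>

context dedekind_algebra
begin

lemma invertible_ideals_iff: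
  assumes "order T"
  shows "L \<in> invertible_ideals Z j T \<longleftrightarrow> submod T L \<and> lattice L \<and> L \<cdot>\<^bsub>ambient\<^esub> colon T L = T"
  by (simp add: invertible_ideals_def fractional_ideal_iff[OF assms] invertible_ideal_def)

text \<open>(J : I)(I : J) lies in no prime of \<open>T\<close>, hence contains 1. Both claims
  follow, since (I : J) is contained in (T : (J : I)) and maps \<open>J\<close> into
  \<open>I\<close>.\<close>

lemma colon_invertible:
  assumes T: "order T" and I: "mult_ideal T I" and J: "mult_ideal T J"
    and loc: "\<And>p. p \<in> primes T \<Longrightarrow> loc_iso p J I"
  shows "colon J I \<in> invertible_ideals Z j T" "colon J I \<cdot>\<^bsub>ambient\<^esub> I = J"
proof -
  define L where "L = colon J I"
  define M where "M = L \<cdot>\<^bsub>ambient\<^esub> colon I J"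
  have sL: "submod T L" unfolding L_def by (rule submod_colon[OF mult_idealD(3)[OF J]])
  have lL: "lattice L" unfolding L_def using lattice_colon mult_idealD(1) I J by blast
  have M: "submod T M" unfolding M_def using submod_ideal_prod[OF sL submod_colon[OF mult_idealD(3)[OF I]]] .
  have lM: "lattice M" unfolding M_def using lattice_ideal_prod[OF lL] lattice_colon mult_idealD(1) I J by blast
  have MT: "M \<subseteq> T" unfolding M_def L_def using colon_trans[of _ J I _ J] mult_idealD(2)[OF J]
    by (intro ideal_prod_least[OF orderD(5)[OF T]]) blast
  have 1: "1 \<in> M"
  proof (rule ideal_eq_order[OF T M MT latticeD(3)[OF lM]])
    show "\<not> M \<subseteq> p" if "p \<in> primes T" for p
      using loc[OF that] ideal_prod_mem[of _ L _ "colon I J"] unfolding loc_iso_def L_def M_def by blast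
  qed
  have "L \<cdot>\<^bsub>ambient\<^esub> colon T L = T"
  proof
    show "L \<cdot>\<^bsub>ambient\<^esub> colon T L \<subseteq> T"
      by (rule ideal_prod_least[OF orderD(5)[OF T]]) (auto simp: colon_def mult.commute)
    have sP: "submod T (L \<cdot>\<^bsub>ambient\<^esub> colon T L)" using submod_ideal_prod[OF sL submod_colon[OF orderD(5)[OF T]]] .
    have "colon I J \<subseteq> colon T L"
      using colon_trans[of _ I J _ I] mult_idealD(2)[OF I] unfolding L_def by (auto intro: colonI)
    then have "M \<subseteq> L \<cdot>\<^bsub>ambient\<^esub> colon T L"
      unfolding M_def by (intro ideal_prod_least[OF sP] ideal_prod_mem) auto
    then show "T \<subseteq> L \<cdot>\<^bsub>ambient\<^esub> colon T L" using 1 submodD(4)[OF sP, of _ 1] by auto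
  qed
  then show "colon J I \<in> invertible_ideals Z j T" using sL lL invertible_ideals_iff[OF T] unfolding L_def by blast
  show "colon J I \<cdot>\<^bsub>ambient\<^esub> I = J"
  proof
    show "colon J I \<cdot>\<^bsub>ambient\<^esub> I \<subseteq> J" by (rule ideal_prod_least[OF mult_idealD(3)[OF J]]) (rule colonD)
    have sLI: "submod T (L \<cdot>\<^bsub>ambient\<^esub> I)" by (rule submod_ideal_prod[OF sL mult_idealD(3)[OF I]])
    have "M \<subseteq> colon (L \<cdot>\<^bsub>ambient\<^esub> I) J"
      unfolding M_def
    proof (rule ideal_prod_least[OF submod_colon[OF sLI]])
      fix x y assume "x \<in> L" "y \<in> colon I J"
      then show "x * y \<in> colon (L \<cdot>\<^bsub>ambient\<^esub> I) J"
        using ideal_prod_mem[of x L _ I] colonD[of y I J] by (intro colonI) (simp add: mult.assoc)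
    qed
    then have "1 \<in> colon (L \<cdot>\<^bsub>ambient\<^esub> I) J" using 1 by blast
    then show "J \<subseteq> colon J I \<cdot>\<^bsub>ambient\<^esub> I" unfolding colon_def[of _ J] L_def by auto
  qed
qed

text \<open>Writing 1 as a sum of products of elements of \<open>L\<close> and (T : L) allows
  cancelling \<open>L\<close>. The second claim makes the action free, the third keeps it inside a
  weak equivalence class.\<close>

lemma invertible_times_mult_ideal:
  assumes T: "order T" and I: "mult_ideal T I" and L: "L \<in> invertible_ideals Z j T"
  shows "mult_ideal T (L \<cdot>\<^bsub>ambient\<^esub> I)" "colon (L \<cdot>\<^bsub>ambient\<^esub> I) I = L"
    "p \<in> primes T \<Longrightarrow> loc_iso p (L \<cdot>\<^bsub>ambient\<^esub> I) I"
proof -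
  have L': "submod T L" "lattice L" "L \<cdot>\<^bsub>ambient\<^esub> colon T L = T" using L invertible_ideals_iff[OF T] by auto
  define LI where "LI = L \<cdot>\<^bsub>ambient\<^esub> I"
  have sLI: "submod T LI" unfolding LI_def by (rule submod_ideal_prod[OF L'(1) mult_idealD(3)[OF I]])
  have unit: "1 \<in> U" if "submod T U" "\<And>l y. l \<in> L \<Longrightarrow> y \<in> colon T L \<Longrightarrow> l * y \<in> U" for U
    using ideal_prod_least[OF that] L'(3) orderD(6)[OF T] by blast
  have y: "y * w \<in> I" if "y \<in> colon T L" "w \<in> LI" for y w
  proof -
    have "LI \<subseteq> {w. y * w \<in> I}" unfolding LI_def
    proof (rule ideal_prod_least)
      show "submod T {w. y * w \<in> I}" using mult_idealD(3)[OF I] unfolding submod_def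
        by (auto simp: distrib_left) (metis mult.left_commute)
      show "l * i \<in> {w. y * w \<in> I}" if "l \<in> L" "i \<in> I" for l i
        using submodD(3)[OF mult_idealD(3)[OF I] colonD[OF \<open>y \<in> colon T L\<close> that(1)] that(2)] by (simp add: mult.assoc)
    qed
    then show ?thesis using that(2) by blast
  qed
  have l: "l * i \<in> LI" if "l \<in> L" "i \<in> I" for l i unfolding LI_def by (rule ideal_prod_mem[OF that])
  have "x \<in> T" if x: "x \<in> colon LI LI" for x
  proof -
    have "1 \<in> {m. m * x \<in> T}"
    proof (rule unit)
      show "submod T {m. m * x \<in> T}" using orderD(5)[OF T] unfolding submod_def by (auto simp: distrib_right mult.assoc)
      fix a b assume ab: "a \<in> L" "b \<in> colon T L"
      have "a * b * x \<in> colon I I"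
      proof (rule colonI)
        fix i assume "i \<in> I"
        then have "b * (x * (a * i)) \<in> I" using y[OF ab(2) colonD[OF x l[OF ab(1)]]] by blast
        then show "a * b * x * i \<in> I" by (simp add: ac_simps)
      qed
      then show "a * b \<in> {m. m * x \<in> T}" using mult_idealD(2)[OF I] by simp
    qed
    then show ?thesis by simp
  qed
  moreover have "T \<subseteq> colon LI LI" using submodD(3)[OF sLI] by (auto simp: colon_def)
  ultimately show "mult_ideal T (L \<cdot>\<^bsub>ambient\<^esub> I)"
    using lattice_ideal_prod[OF L'(2) mult_idealD(1)[OF I]]
    unfolding mult_ideal_def multiplicator_ring_def LI_def by blast
  have "x \<in> L" if x: "x \<in> colon LI I" for x
  proof -
    have "1 \<in> {m. m * x \<in> L}"
    proof (rule unit)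
      show "submod T {m. m * x \<in> L}" using L'(1) unfolding submod_def by (auto simp: distrib_right mult.assoc)
      fix a b assume ab: "a \<in> L" "b \<in> colon T L"
      have "b * x \<in> colon I I" using y[OF ab(2) colonD[OF x]] by (intro colonI) (simp add: mult.assoc)
      then show "a * b \<in> {m. m * x \<in> L}"
        using submodD(4)[OF L'(1) _ ab(1)] mult_idealD(2)[OF I] by (simp add: mult.assoc)
    qed
    then show ?thesis by simp
  qed
  moreover have "L \<subseteq> colon LI I" using l by (auto simp: colon_def)
  ultimately show "colon (L \<cdot>\<^bsub>ambient\<^esub> I) I = L" unfolding LI_def by blast
  show "loc_iso p (L \<cdot>\<^bsub>ambient\<^esub> I) I" if p: "p \<in> primes T"
  proof (rule ccontr)
    assume n: "\<not> loc_iso p (L \<cdot>\<^bsub>ambient\<^esub> I) I"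
    have pp: "is_prime T p" using p primes_iff[OF T] by blast
    have "1 \<in> p"
    proof (rule unit[OF is_primeD(1)[OF pp]])
      fix a b assume ab: "a \<in> L" "b \<in> colon T L"
      have "a \<in> colon LI I" using l[OF ab(1)] by (rule colonI)
      moreover have "b \<in> colon I LI" using y[OF ab(2)] by (rule colonI)
      ultimately show "a * b \<in> p" using n unfolding loc_iso_def LI_def by blast
    qed
    then show False using is_primeD(3)[OF pp] by blast
  qed
qed

lemma scale_inverse:
  fixes \<alpha> \<beta> :: 'k
  assumes "\<alpha> * \<beta> = 1"
  shows "\<beta> * (\<alpha> * x) = x"
  using assms by (metis mult.assoc mult.commute mult_1)

lemma colon_scale:
  fixes \<alpha> \<beta> :: 'k
  assumes "\<alpha> * \<beta> = 1"
  shows "colon ((*) \<alpha> ` I) J = (*) \<alpha> ` colon I J"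
proof -
  have "x \<in> (*) \<alpha> ` K \<longleftrightarrow> \<beta> * x \<in> K" for x K
    using scale_inverse[OF assms] scale_inverse[of \<beta> \<alpha>] assms by (auto simp: mult.commute image_iff) (metis mult.commute)
  then show ?thesis by (intro Set.set_eqI) (simp only: colon_def mem_Collect_eq mult.assoc)
qed

text \<open>The set \<open>A I\<close> of primes in \<open>P\<close> at which \<open>I\<close> is
  not locally \<open>T\<close> is a complete invariant of weak equivalence. With a chosen
  representative \<open>R B\<close> for each subset, \<open>I\<close> is the product of
  \<open>R (A I)\<close> and an invertible ideal, recovered as \<open>colon I (R (A I))\<close>; the
  class of the latter is the second component of \<open>g\<close>.\<close>

lemma weak_classes_ICM_eqpoll:
  assumes Sord: "order S" and T: "order T" and ST: "S \<subseteq> T" and ty: "order_type Z j T = 2"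
    and P: "P = {p \<in> primes T. type_at Z j T p = 2}"
  shows "finite P" "weak_classes Z j S T \<approx> Pow P" "ICM Z j S T \<approx> Pow P \<times> Pic Z j T"
proof -
  have ty2: "type_at Z j T p \<le> 2" if "p \<in> primes T" for p
    using Max_ge[OF finite_types[OF T], of "type_at Z j T p"] that ty unfolding order_type_def by simp
  \<comment> \<open>All types are at most 2, so type 2 means that the type is not at most 1, that
    is, \<open>T\<close> and its trace dual differ at \<open>p\<close>.\<close>
  have P': "P = {p \<in> primes T. \<not> loc_iso p T (dual T)}"
    unfolding P using ty2 type_at_le_one_iff[OF T] by force
  show "finite P" unfolding P' by (rule finite_not_loc_iso_dual[OF T])
  define M where "M = Collect (mult_ideal T)"
  have Meq: "ideals_with_mult_ring Z j S T = M" unfolding M_def by (rule ideals_with_mult_ring_eq[OF Sord T ST])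
  have MM: "mult_ideal T I" if "I \<in> M" for I using that by (simp add: M_def)
  have prime: "is_prime T p" if "p \<in> primes T" for p using that primes_iff[OF T] by blast
  have trans: "loc_iso p I L" if "p \<in> primes T" "mult_ideal T I" "mult_ideal T J" "loc_iso p I J" "loc_iso p J L" for p I J L
    using loc_iso_trans[OF prime] that by blast
  note mT = mult_ideal_self[OF T] and mV = mult_ideal_dual[OF T]
  define A where "A I = {p \<in> P. \<not> loc_iso p I T}" for I
  have wA: "(\<forall>p\<in>primes T. loc_iso p I J) \<longleftrightarrow> A I = A J" if I: "I \<in> M" and J: "J \<in> M" for I J
  proof
    assume "\<forall>p\<in>primes T. loc_iso p I J"
    then have "loc_iso p I T \<longleftrightarrow> loc_iso p J T" if "p \<in> primes T" for p
      using that trans[OF that MM[OF I] MM[OF J]] trans[OF that MM[OF J] MM[OF I]] loc_iso_sym by blast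
    then show "A I = A J" unfolding A_def P by blast
  next
    assume eq: "A I = A J"
    show "\<forall>p\<in>primes T. loc_iso p I J"
    proof
      fix p assume p: "p \<in> primes T"
      have d: "loc_iso p K T \<or> loc_iso p K (dual T)" if "K \<in> M" for K
        using loc_iso_dichotomy[OF T p ty2[OF p] MM[OF that]] .
      show "loc_iso p I J"
      proof (cases "loc_iso p I T \<and> loc_iso p J T")
        case True
        then show ?thesis using trans[OF p MM[OF I] mT] loc_iso_sym by blast
      next
        case False
        \<comment> \<open>Outside \<open>P\<close> the two local models coincide, and both ideals
          would be locally \<open>T\<close>.\<close>
        have "p \<in> P"
        proof (rule ccontr)
          assume "p \<notin> P"
          then have "loc_iso p (dual T) T" using p loc_iso_sym unfolding P' by blast
          then have "loc_iso p I T" "loc_iso p J T"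
            using d[OF I] d[OF J] trans[OF p MM[OF I] mV] trans[OF p MM[OF J] mV] by blast+
          then show False using False by blast
        qed
        then have "\<not> loc_iso p I T" "\<not> loc_iso p J T" using False eq unfolding A_def by blast+
        then have "loc_iso p I (dual T)" "loc_iso p J (dual T)" using d[OF I] d[OF J] by blast+
        then show ?thesis using trans[OF p MM[OF I] mV] loc_iso_sym by blast
      qed
    qed
  qed
  have we: "weakly_equivalent Z j S I J \<longleftrightarrow> A I = A J" if "I \<in> M" "J \<in> M" for I J
    using wA[OF that] weakly_equivalent_iff[OF Sord T ST MM[OF that(1)] MM[OF that(2)]] by simp
  have surj: "\<exists>I\<in>M. A I = B" if B: "B \<subseteq> P" for B
  proof -
    obtain I where I: "mult_ideal T I" "\<And>p. p \<in> primes T \<Longrightarrow> if p \<in> B then loc_iso p I (dual T) else loc_iso p I T"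
      using exists_mult_ideal[OF T, of B] by blast
    have "loc_iso p I T \<longleftrightarrow> p \<notin> B" if p: "p \<in> P" for p
    proof -
      have pT: "p \<in> primes T" "\<not> loc_iso p T (dual T)" using p unfolding P' by auto
      show ?thesis using I(2)[OF pT(1)] trans[OF pT(1) mT I(1), of "dual T"] pT(2) loc_iso_sym by (cases "p \<in> B") auto
    qed
    then have "A I = B" using B unfolding A_def by blast
    then show ?thesis using I(1) by (auto simp: M_def)
  qed
  have AM: "A ` M = Pow P"
  proof
    show "A ` M \<subseteq> Pow P" by (auto simp: A_def)
    show "Pow P \<subseteq> A ` M" using surj by blast
  qed
  have "weak_classes Z j S T \<approx> A ` M"
    unfolding weak_classes_def Meq using we by (rule quotient_kernel_eqpoll)
  then show "weak_classes Z j S T \<approx> Pow P" unfolding AM .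
  define R where "R B = (SOME I. I \<in> M \<and> A I = B)" for B
  have R: "R B \<in> M" "A (R B) = B" if "B \<subseteq> P" for B
    using someI_ex[of "\<lambda>I. I \<in> M \<and> A I = B"] surj[OF that] unfolding R_def by blast+
  have AP: "A I \<subseteq> P" for I by (auto simp: A_def)
  note RA = R[OF AP]
  define Inv where "Inv = invertible_ideals Z j T"
  define iso where "iso = {(L, L'). L \<in> Inv \<and> L' \<in> Inv \<and> ideal_isomorphic T L L'}"
  have isoT: "ideal_isomorphic T L L' \<longleftrightarrow> (\<exists>\<alpha> \<beta>. \<alpha> * \<beta> = 1 \<and> L' = (*) \<alpha> ` L)" if "L \<in> Inv" "L' \<in> Inv" for L L'
    using ideal_isomorphic_iff[OF T] that invertible_ideals_iff[OF T] unfolding Inv_def by blast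
  have isoS: "ideal_isomorphic S I J \<longleftrightarrow> (\<exists>\<alpha> \<beta>. \<alpha> * \<beta> = 1 \<and> J = (*) \<alpha> ` I)" if "I \<in> M" "J \<in> M" for I J
    using ideal_isomorphic_iff[OF Sord submod_mono[OF mult_idealD(3) ST] mult_idealD(1)
        submod_mono[OF mult_idealD(3) ST] mult_idealD(1), OF MM MM MM MM] that by blast
  \<comment> \<open>Comparing classes in \<open>Pic\<close> requires the relation to be an
    equivalence, which is read off from the description by units of \<open>K\<close>.\<close>
  have equiv: "equiv Inv iso"
  proof (rule equivI)
    show "iso \<subseteq> Inv \<times> Inv" by (auto simp: iso_def)
    show "refl_on Inv iso"
    proof (rule refl_onI)
      fix L assume "L \<in> Inv"
      moreover have "(1::'k) * 1 = 1 \<and> L = (*) 1 ` L" by simp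
      ultimately show "(L, L) \<in> iso" unfolding iso_def using isoT[of L L] by blast
    qed
    show "sym iso"
    proof (rule symI)
      fix L L' assume "(L, L') \<in> iso"
      then obtain \<alpha> \<beta> where e: "L \<in> Inv" "L' \<in> Inv" "\<alpha> * \<beta> = 1" "L' = (*) \<alpha> ` L" using isoT unfolding iso_def by blast
      have "\<beta> * \<alpha> = 1" "L = (*) \<beta> ` L'" unfolding e(4) image_image scale_inverse[OF e(3)] using e(3) by (simp_all add: mult.commute)
      then show "(L', L) \<in> iso" unfolding iso_def using isoT[OF e(2,1)] e(1,2) by blast
    qed
    show "trans iso"
    proof (rule transI)
      fix L L' L'' assume "(L, L') \<in> iso" "(L', L'') \<in> iso"
      then have i: "L \<in> Inv" "L' \<in> Inv" "L'' \<in> Inv" "ideal_isomorphic T L L'" "ideal_isomorphic T L' L''"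
        by (simp_all add: iso_def)
      obtain \<alpha> \<beta> where ab: "\<alpha> * \<beta> = 1" "L' = (*) \<alpha> ` L" using isoT[OF i(1,2)] i(4) by blast
      obtain \<gamma> \<delta> where cd: "\<gamma> * \<delta> = 1" "L'' = (*) \<gamma> ` L'" using isoT[OF i(2,3)] i(5) by blast
      note e = i(1,3) ab cd
      have "(\<gamma> * \<alpha>) * (\<beta> * \<delta>) = \<gamma> * ((\<alpha> * \<beta>) * \<delta>)" by (simp only: ac_simps)
      then have "(\<gamma> * \<alpha>) * (\<beta> * \<delta>) = 1" using e(3,5) by simp
      moreover have "L'' = (*) (\<gamma> * \<alpha>) ` L" unfolding e(4,6) image_image by (simp add: mult.assoc)
      ultimately show "(L, L'') \<in> iso" unfolding iso_def using isoT[OF e(1,2)] e(1,2) by blast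
    qed
  qed
  have Pic: "Pic Z j T = (\<lambda>L. iso `` {L}) ` Inv"
    unfolding Pic_def iso_def Inv_def quotient_def by blast
  have cl: "iso `` {L} = iso `` {L'} \<longleftrightarrow> (\<exists>\<alpha> \<beta>. \<alpha> * \<beta> = 1 \<and> L' = (*) \<alpha> ` L)" if "L \<in> Inv" "L' \<in> Inv" for L L'
    using eq_equiv_class_iff[OF equiv that] isoT[OF that] that by (simp add: iso_def)
  define g where "g I = (A I, iso `` {colon I (R (A I))})" for I
  have col: "colon I (R (A I)) \<in> Inv" "colon I (R (A I)) \<cdot>\<^bsub>ambient\<^esub> R (A I) = I" if I: "I \<in> M" for I
  proof -
    have "loc_iso p I (R (A I))" if "p \<in> primes T" for p
      using wA[OF I RA(1)] RA(2) that by blast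
    then show "colon I (R (A I)) \<in> Inv" "colon I (R (A I)) \<cdot>\<^bsub>ambient\<^esub> R (A I) = I"
      using colon_invertible[OF T MM[OF RA(1)] MM[OF I]] unfolding Inv_def by blast+
  qed
  have "ideal_isomorphic S I J \<longleftrightarrow> g I = g J" if I: "I \<in> M" and J: "J \<in> M" for I J
  proof
    assume "ideal_isomorphic S I J"
    then obtain \<alpha> \<beta> where ab: "\<alpha> * \<beta> = 1" "J = (*) \<alpha> ` I" using isoS[OF I J] by blast
    have "loc_iso p I J" if "p \<in> primes T" for p
      unfolding loc_iso_def
    proof (intro bexI)
      show "\<beta> * \<alpha> \<notin> p" using ab(1) is_primeD(3)[OF prime[OF that]] by (simp add: mult.commute)
      show "\<alpha> \<in> colon J I" "\<beta> \<in> colon I J" unfolding ab(2) colon_def using scale_inverse[OF ab(1)] by auto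
    qed
    then have eq: "A I = A J" using wA[OF I J] by blast
    have "colon J (R (A J)) = (*) \<alpha> ` colon I (R (A I))" unfolding eq ab(2) by (rule colon_scale[OF ab(1)])
    then show "g I = g J" using cl[OF col(1)[OF I] col(1)[OF J]] ab(1) eq unfolding g_def by blast
  next
    assume "g I = g J"
    then have eq: "A I = A J" "iso `` {colon I (R (A I))} = iso `` {colon J (R (A J))}" by (auto simp: g_def)
    then obtain \<alpha> \<beta> where ab: "\<alpha> * \<beta> = 1" "colon J (R (A J)) = (*) \<alpha> ` colon I (R (A I))"
      using cl[OF col(1)[OF I] col(1)[OF J]] by blast
    have "J = (*) \<alpha> ` I" using col(2)[OF J] col(2)[OF I] unfolding ab(2) ideal_prod_scale eq(1) by simp
    then show "ideal_isomorphic S I J" using isoS[OF I J] ab(1) by blast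
  qed
  then have "ICM Z j S T \<approx> g ` M" unfolding ICM_def Meq by (rule quotient_kernel_eqpoll)
  also have "g ` M = Pow P \<times> Pic Z j T"
  proof
    show "g ` M \<subseteq> Pow P \<times> Pic Z j T" using col(1) AP unfolding g_def Pic by blast
    show "Pow P \<times> Pic Z j T \<subseteq> g ` M"
    proof
      fix x assume "x \<in> Pow P \<times> Pic Z j T"
      then obtain B L where x: "x = (B, iso `` {L})" "B \<subseteq> P" "L \<in> Inv" unfolding Pic by blast
      note RB = R[OF x(2)]
      note i = invertible_times_mult_ideal[OF T MM[OF RB(1)] x(3)[unfolded Inv_def]]
      have IM: "L \<cdot>\<^bsub>ambient\<^esub> R B \<in> M" using i(1) by (simp add: M_def)
      have "A (L \<cdot>\<^bsub>ambient\<^esub> R B) = B" using wA[OF IM RB(1)] i(3) RB(2) by blast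
      then have "g (L \<cdot>\<^bsub>ambient\<^esub> R B) = x" unfolding g_def x(1) by (simp add: i(2))
      then show "x \<in> g ` M" using IM by blast
    qed
  qed
  finally show "ICM Z j S T \<approx> Pow P \<times> Pic Z j T" .
qed

end

text \<open>Generators of one lattice over \<open>Z\<close> span \<open>K\<close> over Q; this
  supplies the finite dimension demanded by \<open>dedekind_algebra\<close>.\<close>

lemma (in q_algebra) lattice_finite_dim:
  assumes "lattice_in Z j L"
  shows "\<exists>A. finite A \<and> vs.span A = UNIV"
proof -
  obtain B where B: "B \<subseteq> L" "vs.span B = UNIV" using assms by (auto simp: lattice_in_def)
  obtain A where A: "finite A" "L = {\<Sum>b\<in>A. c b * b | c. c \<in> A \<rightarrow> j ` Z}"
    using assms by (auto simp: lattice_in_def fg_submodule_def)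
  have "L \<subseteq> vs.span A"
  proof
    fix x assume "x \<in> L"
    then obtain c where c: "c \<in> A \<rightarrow> j ` Z" "x = (\<Sum>b\<in>A. c b * b)" unfolding A(2) by blast
    have "c b * b \<in> vs.span A" if "b \<in> A" for b
    proof -
      obtain z where "c b = j z" using c(1) \<open>b \<in> A\<close> by blast
      then show ?thesis using vs.span_scale[OF vs.span_base[OF \<open>b \<in> A\<close>], of z] by (simp add: alg_scale_def)
    qed
    then show "x \<in> vs.span A" unfolding c(2) by (rule vs.span_sum)
  qed
  then have "vs.span B \<subseteq> vs.span A" using B(1) by (meson order_trans vs.span_minimal vs.subspace_span)
  then show ?thesis using A(1) B(2) by blast
qed

theorem corollary6p5:
  fixes Z :: "'q::field set" and j :: "'q \<Rightarrow> 'k::comm_ring_1"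
    and S T :: "'k set" and P :: "'k set set" and N :: nat
  assumes "dedekind_domain Z" and "has_field_of_fractions_UNIV Z"
    and "etale_algebra j"
    and "order_in Z j S" and "order_in Z j T" and "S \<subseteq> T"
    and "order_type Z j T = 2"
    and "P = {p \<in> primes_of Z j T. type_at Z j T p = 2}" and "N = card P"
  shows "finite P \<and> finite (weak_classes Z j S T) \<and> card (weak_classes Z j S T) = 2 ^ N \<and>
    ICM Z j S T \<approx> {..<(2::nat) ^ N} \<times> Pic Z j T"
proof -
  interpret dedekind Z using assms(1,2) by unfold_locales
  interpret q_algebra j using assms(3) by unfold_locales (simp add: etale_algebra_def)
  interpret dedekind_algebra Z j
    using assms(3) lattice_finite_dim[of Z T] assms(5) by unfold_locales (auto simp: order_in_def)
  note m = weak_classes_ICM_eqpoll[OF _ _ assms(6-8), unfolded order_in_iff[symmetric], OF assms(4,5)]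
  have "finite (Pow P)" "card (Pow P) = 2 ^ N" using m(1) assms(9) by (simp_all add: card_Pow)
  then have "finite (weak_classes Z j S T) \<and> card (weak_classes Z j S T) = 2 ^ N"
    using m(2) eqpoll_finite_iff bij_betw_same_card unfolding eqpoll_def by metis
  moreover have "Pow P \<approx> {..<(2::nat) ^ N}"
    using \<open>finite (Pow P)\<close> \<open>card (Pow P) = 2 ^ N\<close> by (simp add: eqpoll_iff_card)
  then have "ICM Z j S T \<approx> {..<(2::nat) ^ N} \<times> Pic Z j T"
    using eqpoll_trans[OF m(3) times_eqpoll_cong] by blast
  ultimately show ?thesis using m(1) by blast
qed

end
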